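(* Let $M$ be a smooth manifold with an affine connection $\nabla$ and let $Z$ be its geodesic spray. Let $v\in T_xM$ for some $x\in M$, and let $X_v$ be an arbitrary vector field on $M$ that has the value $v$ at $x$. Then $$Z(v)=(X_v)^T(v)-\mathrm{vlft}_v\big(\nabla_{X_v}X_v(x)\big).$$
   Context: The geodesic spray of $\nabla$ is the vector field $Z$ on $TM$ defined by $Z(v)=T_u\Phi_\xi(B(\xi)_u)$, where $u:\mathbb R^n\to T_xM$ is a linear frame at $x=\tau_M(v)$ and $\xi\in\mathbb R^n$ with $u\xi=v$, $\Phi_\xi:L(M)\to TM$ is $\Phi_\xi(u)=u\xi$ on the linear frame bundle $\pi_M:L(M)\to M$, and $B(\xi)_u$ is the unique vector at $u$, horizontal for the principal connection on $L(M)$ corresponding to $\nabla$, with $T_u\pi_M(B(\xi)_u)=u\xi$. (In tangent bundle coordinates, $Z=v^i\partial_{x^i}-\Gamma^i_{jk}v^jv^k\partial_{v^i}$ with $\nabla_{\partial_j}\partial_k=\Gamma^i_{jk}\partial_i$.) The tangent lift of a vector field $X$ with flow $\phi^X_t$ is the vector field $X^T$ on $TM$, $X^T(v_x)=\frac{d}{dt}|_{t=0}T\phi^X_t(v_x)$. The vertical lift is $\mathrm{vlft}_{v_x}(w_x)=\frac{d}{dt}|_{t=0}(v_x+tw_x)$ for $v_x,w_x\in T_xM$. *)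

theory Defs
  imports "HOL-Analysis.Analysis"
begin

section \<open>Smooth manifolds\<close>

text \<open>The following two notions are intended for open sets \<open>S\<close> and finite-dimensional domains,
  where they are the usual classes \<open>C^k\<close> and \<open>C^\<infinity>\<close>.\<close>

primrec Ck_on :: "nat \<Rightarrow> 'e::real_normed_vector set \<Rightarrow> ('e \<Rightarrow> 'f::real_normed_vector) \<Rightarrow> bool" where
  "Ck_on 0 S f \<longleftrightarrow> continuous_on S f"
| "Ck_on (Suc k) S f \<longleftrightarrow>
     f differentiable_on S \<and> (\<forall>h. Ck_on k S (\<lambda>x. frechet_derivative f (at x) h))"

definition smooth_on :: "'e::real_normed_vector set \<Rightarrow> ('e \<Rightarrow> 'f::real_normed_vector) \<Rightarrow> bool" where
  "smooth_on S f \<longleftrightarrow> (\<forall>k. Ck_on k S f)"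

text \<open>A chart is a pair of its domain and a coordinate map, whose values outside the domain are
  irrelevant. The points of a manifold are those covered by its atlas; the atlas need not be
  maximal. The model space is \<open>real^'n\<close> for the base manifold, and a product of Euclidean spaces
  for its tangent bundle and frame bundle.\<close>

type_synonym ('a, 'e) chart = "'a set \<times> ('a \<Rightarrow> 'e)"
type_synonym ('a, 'e) atlas = "('a, 'e) chart set"

definition mcarrier :: "('a, 'e) atlas \<Rightarrow> 'a set" where
  "mcarrier A = (\<Union>c\<in>A. fst c)"

definition chart_inv :: "('a, 'e) chart \<Rightarrow> 'e \<Rightarrow> 'a" where
  "chart_inv c = inv_into (fst c) (snd c)"

definition charts_at :: "('a, 'e) atlas \<Rightarrow> 'a \<Rightarrow> ('a, 'e) chart set" where
  "charts_at A p = {c \<in> A. p \<in> fst c}"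

definition chart_at :: "('a, 'e) atlas \<Rightarrow> 'a \<Rightarrow> ('a, 'e) chart" where
  "chart_at A p = (SOME c. c \<in> charts_at A p)"

definition smooth_atlas :: "('a, 'e::euclidean_space) atlas \<Rightarrow> bool" where
  "smooth_atlas A \<longleftrightarrow>
     (\<forall>c\<in>A. inj_on (snd c) (fst c) \<and> open (snd c ` fst c)) \<and>
     (\<forall>c\<in>A. \<forall>d\<in>A. open (snd c ` (fst c \<inter> fst d)) \<and>
        smooth_on (snd c ` (fst c \<inter> fst d)) (snd d \<circ> chart_inv c))"

definition manifold_topology :: "('a, 'e::euclidean_space) atlas \<Rightarrow> 'a topology" where
  "manifold_topology A =
     topology_generated_by {fst c \<inter> snd c -` V | c V. c \<in> A \<and> open V}"

definition smooth_manifold :: "('a, 'e::euclidean_space) atlas \<Rightarrow> bool" where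
  "smooth_manifold A \<longleftrightarrow> smooth_atlas A \<and>
     Hausdorff_space (manifold_topology A) \<and> second_countable (manifold_topology A)"

definition smooth_map ::
    "('a, 'e::euclidean_space) atlas \<Rightarrow> ('b, 'f::euclidean_space) atlas \<Rightarrow> ('a \<Rightarrow> 'b) \<Rightarrow> bool" where
  "smooth_map A B f \<longleftrightarrow> f ` mcarrier A \<subseteq> mcarrier B \<and>
     (\<forall>c\<in>A. \<forall>d\<in>B. open (snd c ` (fst c \<inter> f -` fst d)) \<and>
        smooth_on (snd c ` (fst c \<inter> f -` fst d)) (snd d \<circ> f \<circ> chart_inv c))"

definition smooth_function :: "('a, 'e::euclidean_space) atlas \<Rightarrow> ('a \<Rightarrow> real) \<Rightarrow> bool" where
  "smooth_function A f \<longleftrightarrow> (\<forall>c\<in>A. smooth_on (snd c ` fst c) (f \<circ> chart_inv c))"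

section \<open>Tangent vectors\<close>

text \<open>A tangent vector at \<open>p\<close> is a pair of \<open>p\<close> and the family of its coordinate vectors in all the
  charts around \<open>p\<close>, which transform by the derivatives of the coordinate changes. The family is
  zero at all other charts, so that the linear operations are pointwise.\<close>

type_synonym ('a, 'e) tvec = "'a \<times> (('a, 'e) chart \<Rightarrow> 'e)"

definition tangent_space :: "('a, 'e::euclidean_space) atlas \<Rightarrow> 'a \<Rightarrow> ('a, 'e) tvec set" where
  "tangent_space A p = {v. fst v = p \<and>
     (\<forall>c. c \<notin> charts_at A p \<longrightarrow> snd v c = 0) \<and>
     (\<forall>c\<in>charts_at A p. \<forall>d\<in>charts_at A p.
        snd v d = frechet_derivative (snd d \<circ> chart_inv c) (at (snd c p)) (snd v c))}"

definition tangent_bundle :: "('a, 'e::euclidean_space) atlas \<Rightarrow> ('a, 'e) tvec set" where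
  "tangent_bundle A = (\<Union>p\<in>mcarrier A. tangent_space A p)"

definition tangent_atlas ::
    "('a, 'e::euclidean_space) atlas \<Rightarrow> (('a, 'e) tvec, 'e \<times> 'e) atlas" where
  "tangent_atlas A =
     (\<lambda>c. ({v \<in> tangent_bundle A. fst v \<in> fst c}, \<lambda>v. (snd c (fst v), snd v c))) ` A"

text \<open>The operations below are only meaningful for tangent vectors with the same base point.\<close>

definition tadd :: "('a, 'e::euclidean_space) tvec \<Rightarrow> ('a, 'e) tvec \<Rightarrow> ('a, 'e) tvec" where
  "tadd v w = (fst v, \<lambda>c. snd v c + snd w c)"

definition tscale :: "real \<Rightarrow> ('a, 'e::euclidean_space) tvec \<Rightarrow> ('a, 'e) tvec" where
  "tscale r v = (fst v, \<lambda>c. r *\<^sub>R snd v c)"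

definition tminus :: "('a, 'e::euclidean_space) tvec \<Rightarrow> ('a, 'e) tvec \<Rightarrow> ('a, 'e) tvec" where
  "tminus v w = (fst v, \<lambda>c. snd v c - snd w c)"

definition tsubspace :: "('a, 'e::euclidean_space) tvec set \<Rightarrow> bool" where
  "tsubspace S \<longleftrightarrow> S \<noteq> {} \<and> (\<forall>v\<in>S. \<forall>w\<in>S. tadd v w \<in> S) \<and> (\<forall>r. \<forall>v\<in>S. tscale r v \<in> S)"

text \<open>The tangent map \<open>Tf\<close>. For \<open>f\<close> differentiable at the base point of the vector, it does not
  depend on the chart chosen there.\<close>

definition tmap ::
    "('a, 'e::euclidean_space) atlas \<Rightarrow> ('b, 'f::euclidean_space) atlas \<Rightarrow> ('a \<Rightarrow> 'b) \<Rightarrow>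
     ('a, 'e) tvec \<Rightarrow> ('b, 'f) tvec" where
  "tmap A B f v = (let p = fst v; c = chart_at A p in
     (f p, \<lambda>d. if d \<in> charts_at B (f p)
        then frechet_derivative (snd d \<circ> f \<circ> chart_inv c) (at (snd c p)) (snd v c) else 0))"

text \<open>The derivative of a vector-valued function in the direction of a tangent vector.\<close>

definition dirder ::
    "('a, 'e::euclidean_space) atlas \<Rightarrow> ('a \<Rightarrow> 'f::euclidean_space) \<Rightarrow> ('a, 'e) tvec \<Rightarrow> 'f" where
  "dirder A f v = (let p = fst v; c = chart_at A p in
     frechet_derivative (f \<circ> chart_inv c) (at (snd c p)) (snd v c))"

definition has_velocity ::
    "('a, 'e::euclidean_space) atlas \<Rightarrow> (real \<Rightarrow> 'a) \<Rightarrow> real \<Rightarrow> ('a, 'e) tvec \<Rightarrow> bool" where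
  "has_velocity A \<gamma> t w \<longleftrightarrow> \<gamma> t \<in> mcarrier A \<and> w \<in> tangent_space A (\<gamma> t) \<and>
     (\<forall>c\<in>charts_at A (\<gamma> t). (\<forall>\<^sub>F s in nhds t. \<gamma> s \<in> fst c) \<and>
        ((snd c \<circ> \<gamma>) has_vector_derivative snd w c) (at t))"

definition velocity ::
    "('a, 'e::euclidean_space) atlas \<Rightarrow> (real \<Rightarrow> 'a) \<Rightarrow> real \<Rightarrow> ('a, 'e) tvec" where
  "velocity A \<gamma> t = (THE w. has_velocity A \<gamma> t w)"

section \<open>Vector fields, flows and lifts to the tangent bundle\<close>

definition vector_fields :: "('a, 'e::euclidean_space) atlas \<Rightarrow> ('a \<Rightarrow> ('a, 'e) tvec) set" where
  "vector_fields A = {X \<in> extensional (mcarrier A).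
     (\<forall>p\<in>mcarrier A. X p \<in> tangent_space A p) \<and> smooth_map A (tangent_atlas A) X}"

definition vf_add ::
    "('a, 'e::euclidean_space) atlas \<Rightarrow> ('a \<Rightarrow> ('a, 'e) tvec) \<Rightarrow> ('a \<Rightarrow> ('a, 'e) tvec) \<Rightarrow>
     'a \<Rightarrow> ('a, 'e) tvec" where
  "vf_add A X Y = (\<lambda>p\<in>mcarrier A. tadd (X p) (Y p))"

definition vf_scale ::
    "('a, 'e::euclidean_space) atlas \<Rightarrow> ('a \<Rightarrow> real) \<Rightarrow> ('a \<Rightarrow> ('a, 'e) tvec) \<Rightarrow>
     'a \<Rightarrow> ('a, 'e) tvec" where
  "vf_scale A f X = (\<lambda>p\<in>mcarrier A. tscale (f p) (X p))"

definition integral_curve ::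
    "('a, 'e::euclidean_space) atlas \<Rightarrow> ('a \<Rightarrow> ('a, 'e) tvec) \<Rightarrow> real set \<Rightarrow> (real \<Rightarrow> 'a) \<Rightarrow> bool" where
  "integral_curve A X J \<gamma> \<longleftrightarrow> open J \<and> is_interval J \<and> 0 \<in> J \<and>
     (\<forall>t\<in>J. has_velocity A \<gamma> t (X (\<gamma> t)))"

text \<open>The maximal flow: the value at time \<open>t\<close> of any integral curve that starts at \<open>y\<close> and is
  defined up to time \<open>t\<close>; unspecified if there is no such curve.\<close>

definition flow ::
    "('a, 'e::euclidean_space) atlas \<Rightarrow> ('a \<Rightarrow> ('a, 'e) tvec) \<Rightarrow> real \<Rightarrow> 'a \<Rightarrow> 'a" where
  "flow A X t y = (THE z. \<exists>J \<gamma>. integral_curve A X J \<gamma> \<and> \<gamma> 0 = y \<and> t \<in> J \<and> \<gamma> t = z)"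

definition tangent_lift ::
    "('a, 'e::euclidean_space) atlas \<Rightarrow> ('a \<Rightarrow> ('a, 'e) tvec) \<Rightarrow>
     ('a, 'e) tvec \<Rightarrow> (('a, 'e) tvec, 'e \<times> 'e) tvec" where
  "tangent_lift A X v = velocity (tangent_atlas A) (\<lambda>t. tmap A A (flow A X t) v) 0"

definition vlft ::
    "('a, 'e::euclidean_space) atlas \<Rightarrow> ('a, 'e) tvec \<Rightarrow>
     ('a, 'e) tvec \<Rightarrow> (('a, 'e) tvec, 'e \<times> 'e) tvec" where
  "vlft A v w = velocity (tangent_atlas A) (\<lambda>t. tadd v (tscale t w)) 0"

section \<open>Affine connections\<close>

definition affine_connection ::
    "('a, 'e::euclidean_space) atlas \<Rightarrow>
     (('a \<Rightarrow> ('a, 'e) tvec) \<Rightarrow> ('a \<Rightarrow> ('a, 'e) tvec) \<Rightarrow> 'a \<Rightarrow> ('a, 'e) tvec) \<Rightarrow> bool" where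
  "affine_connection A D \<longleftrightarrow>
     (\<forall>X\<in>vector_fields A. \<forall>Y\<in>vector_fields A. D X Y \<in> vector_fields A) \<and>
     (\<forall>X\<in>vector_fields A. \<forall>X'\<in>vector_fields A. \<forall>Y\<in>vector_fields A.
        D (vf_add A X X') Y = vf_add A (D X Y) (D X' Y)) \<and>
     (\<forall>f. \<forall>X\<in>vector_fields A. \<forall>Y\<in>vector_fields A. smooth_function A f \<longrightarrow>
        D (vf_scale A f X) Y = vf_scale A f (D X Y)) \<and>
     (\<forall>X\<in>vector_fields A. \<forall>Y\<in>vector_fields A. \<forall>Y'\<in>vector_fields A.
        D X (vf_add A Y Y') = vf_add A (D X Y) (D X Y')) \<and>
     (\<forall>f. \<forall>X\<in>vector_fields A. \<forall>Y\<in>vector_fields A. smooth_function A f \<longrightarrow>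
        D X (vf_scale A f Y) =
          vf_add A (vf_scale A (\<lambda>p. dirder A f (X p)) Y) (vf_scale A f (D X Y)))"

section \<open>The linear frame bundle\<close>

type_synonym ('a, 'n) frame = "real^'n \<Rightarrow> ('a, real^'n) tvec"

definition frames_at :: "('a, real^'n) atlas \<Rightarrow> 'a \<Rightarrow> ('a, 'n::finite) frame set" where
  "frames_at A p = {u. bij_betw u UNIV (tangent_space A p) \<and>
     (\<forall>\<xi> \<eta>. u (\<xi> + \<eta>) = tadd (u \<xi>) (u \<eta>)) \<and> (\<forall>r \<xi>. u (r *\<^sub>R \<xi>) = tscale r (u \<xi>))}"

definition frames :: "('a, real^'n) atlas \<Rightarrow> ('a, 'n::finite) frame set" where
  "frames A = (\<Union>p\<in>mcarrier A. frames_at A p)"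

text \<open>All the vectors \<open>u \<xi>\<close> have the same base point.\<close>

definition frame_proj :: "('a, 'n::finite) frame \<Rightarrow> 'a" where
  "frame_proj u = fst (u 0)"

definition frame_atlas ::
    "('a, real^'n) atlas \<Rightarrow> (('a, 'n::finite) frame, (real^'n) \<times> (real^'n^'n)) atlas" where
  "frame_atlas A =
     (\<lambda>c. ({u \<in> frames A. frame_proj u \<in> fst c},
           \<lambda>u. (snd c (frame_proj u), matrix (\<lambda>\<xi>. snd (u \<xi>) c)))) ` A"

type_synonym ('a, 'n) frame_tvec = "(('a, 'n) frame, (real^'n) \<times> (real^'n^'n)) tvec"

definition frame_act :: "real^'n^'n \<Rightarrow> ('a, 'n::finite) frame \<Rightarrow> ('a, 'n) frame" where
  "frame_act g u = (\<lambda>\<xi>. u (g *v \<xi>))"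

abbreviation tproj ::
    "('a, real^'n) atlas \<Rightarrow> ('a, 'n::finite) frame_tvec \<Rightarrow> ('a, real^'n) tvec" where
  "tproj A \<equiv> tmap (frame_atlas A) A frame_proj"

definition vertical_space ::
    "('a, real^'n) atlas \<Rightarrow> ('a, 'n::finite) frame \<Rightarrow> ('a, 'n) frame_tvec set" where
  "vertical_space A u =
     {w \<in> tangent_space (frame_atlas A) u. tproj A w = (frame_proj u, \<lambda>_. 0)}"

text \<open>A principal connection is given by its set \<open>H\<close> of horizontal vectors: a complement of the
  vertical bundle in the tangent bundle of the frame bundle, which is invariant under the right
  action of \<open>GL(n)\<close> and smooth, in the sense that the horizontal part of each smooth vector field
  is smooth. (In the last condition, \<open>W'\<close> is the horizontal part of \<open>W\<close>.)\<close>

definition principal_connection ::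
    "('a, real^'n) atlas \<Rightarrow> ('a, 'n::finite) frame_tvec set \<Rightarrow> bool" where
  "principal_connection A H \<longleftrightarrow>
     H \<subseteq> tangent_bundle (frame_atlas A) \<and>
     (\<forall>u\<in>frames A. tsubspace {h \<in> H. fst h = u} \<and>
        (\<forall>w\<in>tangent_space (frame_atlas A) u.
           \<exists>!h. h \<in> H \<and> fst h = u \<and> (\<exists>k\<in>vertical_space A u. w = tadd h k))) \<and>
     (\<forall>u\<in>frames A. \<forall>g. invertible g \<longrightarrow>
        tmap (frame_atlas A) (frame_atlas A) (frame_act g) ` {h \<in> H. fst h = u} =
          {h \<in> H. fst h = frame_act g u}) \<and>
     (\<forall>W\<in>vector_fields (frame_atlas A). \<exists>W'\<in>vector_fields (frame_atlas A).
        \<forall>u\<in>frames A. W' u \<in> H \<and> (\<exists>k\<in>vertical_space A u. W u = tadd (W' u) k))"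

text \<open>A principal connection induces a covariant derivative: a vector field \<open>Y\<close> corresponds to the
  equivariant function \<open>u \<mapsto> u\<inverse>(Y(\<pi>(u)))\<close> on the frame bundle, and \<open>(D X Y)(x)\<close> is obtained by
  differentiating this function along the horizontal lift of \<open>X(x)\<close> to a frame \<open>u\<close> at \<open>x\<close>, and
  applying \<open>u\<close> to the result.\<close>

definition corresponds ::
    "('a, real^'n) atlas \<Rightarrow> ('a, 'n::finite) frame_tvec set \<Rightarrow>
     (('a \<Rightarrow> ('a, real^'n) tvec) \<Rightarrow> ('a \<Rightarrow> ('a, real^'n) tvec) \<Rightarrow> 'a \<Rightarrow> ('a, real^'n) tvec) \<Rightarrow>
     bool" where
  "corresponds A H D \<longleftrightarrow>
     (\<forall>X\<in>vector_fields A. \<forall>Y\<in>vector_fields A. \<forall>u\<in>frames A. \<forall>h\<in>H.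
        fst h = u \<and> tproj A h = X (frame_proj u) \<longrightarrow>
        D X Y (frame_proj u) =
          u (dirder (frame_atlas A) (\<lambda>u'. inv u' (Y (frame_proj u'))) h))"

definition connection_of ::
    "('a, real^'n) atlas \<Rightarrow>
     (('a \<Rightarrow> ('a, real^'n) tvec) \<Rightarrow> ('a \<Rightarrow> ('a, real^'n) tvec) \<Rightarrow> 'a \<Rightarrow> ('a, real^'n) tvec) \<Rightarrow>
     ('a, 'n::finite) frame_tvec set" where
  "connection_of A D = (THE H. principal_connection A H \<and> corresponds A H D)"

section \<open>The geodesic spray\<close>

definition std_horizontal ::
    "('a, real^'n) atlas \<Rightarrow>
     (('a \<Rightarrow> ('a, real^'n) tvec) \<Rightarrow> ('a \<Rightarrow> ('a, real^'n) tvec) \<Rightarrow> 'a \<Rightarrow> ('a, real^'n) tvec) \<Rightarrow>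
     real^'n \<Rightarrow> ('a, 'n::finite) frame \<Rightarrow> ('a, 'n) frame_tvec" where
  "std_horizontal A D \<xi> u =
     (THE h. h \<in> connection_of A D \<and> fst h = u \<and> tproj A h = u \<xi>)"

definition geodesic_spray ::
    "('a, real^'n) atlas \<Rightarrow>
     (('a \<Rightarrow> ('a, real^'n) tvec) \<Rightarrow> ('a \<Rightarrow> ('a, real^'n) tvec) \<Rightarrow> 'a \<Rightarrow> ('a, real^'n) tvec) \<Rightarrow>
     ('a, real^'n) tvec \<Rightarrow> (('a, real^'n::finite) tvec, (real^'n) \<times> (real^'n)) tvec" where
  "geodesic_spray A D v =
     (THE z. \<exists>u\<in>frames_at A (fst v). \<exists>\<xi>. u \<xi> = v \<and>
        z = tmap (frame_atlas A) (tangent_atlas A) (\<lambda>u'. u' \<xi>) (std_horizontal A D \<xi> u))"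

end

theory Submission
  imports Defs
begin

text \<open>In a chart \<open>c\<close> around \<open>x\<close>, the connection is \<open>D X Y = Y'(X) + \<Gamma>(X, Y)\<close> with a smooth bilinear
  \<open>\<Gamma>\<close>, because the difference \<open>D X Y - Y'(X)\<close> is tensorial in both arguments. A vector at a frame \<open>u\<close>
  with coordinate matrix \<open>G\<close> and with coordinates \<open>(a, b)\<close> turns out to be horizontal if and only if
  \<open>b \<xi> = - \<Gamma>(a, G \<xi>)\<close>, and the map \<open>u \<mapsto> u \<xi>\<close> sends \<open>(a, b)\<close> to \<open>(a, b \<xi>)\<close>. Hence the spray is
  \<open>(v, - \<Gamma>(v, v))\<close>. Differentiating the linearised flow equation at time \<open>0\<close> gives \<open>(v, X'(v))\<close> for the
  tangent lift, the vertical lift is \<open>(0, D X X)\<close>, and the three expressions match.\<close>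

section \<open>Closure properties of the classes C^k, up to composition and bump functions\<close>

section \<open>Calculus of smooth functions\<close>

text \<open>Several notions are definite descriptions, so existence and uniqueness come before any
  computation. For the connection on the frame bundle, the candidate is the set of all vectors that
  satisfy the correspondence condition: every competitor lies inside it, and since both are
  complements of the vertical bundle, they coincide. For the flow, two integral curves with the same
  start must agree wherever both are defined, an open-closed argument that rests on the Hausdorff
  property. The affine connection acts on global fields only, so computing at a point requires
  global fields with prescribed values there. They are cut off by bump functions and extended by
  zero, which is smooth because compact sets are closed in a Hausdorff space. The tangent lift
  requires the flow to be differentiable in the initial point, but only at the base point of
  \<open>v\<close> and for small times; a quadratic error bound is enough for that.\<close>

lemma Ck_on_mono:
  assumes "Ck_on k S f" "T \<subseteq> S"
  shows "Ck_on k T f"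
  using assms
proof (induction k arbitrary: f)
  case 0
  then show ?case by (auto intro: continuous_on_subset)
next
  case (Suc k)
  then show ?case by (auto intro: differentiable_on_subset)
qed

text \<open>\<open>frechet_derivative\<close> is a choice among the derivatives of a function. Both
  functions have the same derivatives at \<open>x\<close>, so the choices coincide even where there
  is none.\<close>

lemma frechet_derivative_cong_open:
  assumes "open S" "x \<in> S" "\<And>y. y \<in> S \<Longrightarrow> f y = g y"
  shows "frechet_derivative f (at x) = frechet_derivative g (at x)"
proof -
  have "(f has_derivative D) (at x) \<longleftrightarrow> (g has_derivative D) (at x)" for D
    using has_derivative_transform_within_open[OF _ assms(1,2), of f D UNIV g]
      has_derivative_transform_within_open[OF _ assms(1,2), of g D UNIV f] assms(3) by auto
  then show ?thesis unfolding frechet_derivative_def by simp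
qed

lemma differentiable_on_cong:
  assumes "\<And>y. y \<in> S \<Longrightarrow> f y = g y" "f differentiable_on S"
  shows "g differentiable_on S"
  unfolding differentiable_on_def
proof
  fix x assume x: "x \<in> S"
  then obtain D where "(f has_derivative D) (at x within S)"
    using assms(2) unfolding differentiable_on_def differentiable_def by blast
  then have "(g has_derivative D) (at x within S)"
    using has_derivative_transform[OF x] assms(1) by metis
  then show "g differentiable at x within S" unfolding differentiable_def by blast
qed

lemma Ck_on_cong:
  assumes "open S" "\<And>y. y \<in> S \<Longrightarrow> f y = g y" "Ck_on k S f"
  shows "Ck_on k S g"
  using assms(2,3)
proof (induction k arbitrary: f g)
  case 0
  then show ?case by (auto cong: continuous_on_cong)
next
  case (Suc k)
  have "frechet_derivative f (at x) h = frechet_derivative g (at x) h" if "x \<in> S" for x h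
    using frechet_derivative_cong_open[OF assms(1) that, of f g] Suc.prems by simp
  then have "Ck_on k S (\<lambda>x. frechet_derivative g (at x) h)" for h
    using Suc.IH[of "\<lambda>x. frechet_derivative f (at x) h" "\<lambda>x. frechet_derivative g (at x) h"]
      Suc.prems(2) by simp
  then show ?case using Suc.prems differentiable_on_cong[of S f g] by auto
qed

lemma Ck_on_differentiable:
  assumes "Ck_on (Suc k) S f" "open S" "x \<in> S"
  shows "f differentiable (at x)"
proof -
  have "f differentiable (at x within S)"
    using assms(1,3) by (simp add: differentiable_on_def)
  then show ?thesis by (simp add: at_within_open[OF assms(3,2)])
qed

lemma Ck_on_has_derivative:
  assumes "Ck_on (Suc k) S f" "open S" "x \<in> S"
  shows "(f has_derivative frechet_derivative f (at x)) (at x)"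
  using Ck_on_differentiable[OF assms] by (simp add: frechet_derivative_works)

text \<open>The working rule for the closure lemmas: the derivative may be given by any formula
  valid on \<open>S\<close>, in place of the chosen \<open>frechet_derivative\<close>.\<close>

lemma Ck_on_Suc_I:
  assumes "open S" "\<And>x. x \<in> S \<Longrightarrow> (f has_derivative D x) (at x)" "\<And>h. Ck_on k S (\<lambda>x. D x h)"
  shows "Ck_on (Suc k) S f"
proof -
  have eq: "D x h = frechet_derivative f (at x) h" if "x \<in> S" for x h
    using frechet_derivative_at[OF assms(2)[OF that]] by simp
  have "Ck_on k S (\<lambda>x. frechet_derivative f (at x) h)" for h
    by (rule Ck_on_cong[OF assms(1) eq assms(3)])
  moreover have "f differentiable_on S"
    unfolding differentiable_on_def differentiable_def
    using assms(2) has_derivative_at_withinI by blast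
  ultimately show ?thesis by simp
qed

lemma Ck_on_SucD:
  assumes "open S" "Ck_on (Suc k) S f"
  shows "Ck_on k S f"
  using assms(2)
proof (induction k arbitrary: f)
  case 0
  then show ?case by (simp add: differentiable_imp_continuous_on)
qed auto

lemma Ck_on_frechet_derivative: "Ck_on (Suc k) S f \<Longrightarrow> Ck_on k S (\<lambda>x. frechet_derivative f (at x) h)"
  by simp

text \<open>The derivative in \<open>Ck_on\<close> is taken at \<open>x\<close> in the full space,
  so it is the same for every open set around \<open>x\<close>.\<close>

lemma Ck_on_local:
  assumes "open S" "\<And>x. x \<in> S \<Longrightarrow> \<exists>T. open T \<and> x \<in> T \<and> Ck_on k T f"
  shows "Ck_on k S f"
  using assms(2)
proof (induction k arbitrary: f)
  case 0
  have "isCont f x" if "x \<in> S" for x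
    using 0[OF that] by (auto simp: continuous_on_eq_continuous_at)
  then show ?case by (simp add: continuous_at_imp_continuous_on)
next
  case (Suc k)
  have "f differentiable (at x)" if "x \<in> S" for x
    using Suc.prems[OF that] Ck_on_differentiable by blast
  then have "f differentiable_on S"
    by (simp add: differentiable_on_def differentiable_at_withinI)
  moreover have "Ck_on k S (\<lambda>x. frechet_derivative f (at x) h)" for h
  proof (rule Suc.IH)
    show "\<exists>T. open T \<and> x \<in> T \<and> Ck_on k T (\<lambda>x. frechet_derivative f (at x) h)" if "x \<in> S" for x
      using Suc.prems[OF that] Ck_on_frechet_derivative by blast
  qed
  ultimately show ?case by simp
qed

lemma Ck_on_const: "Ck_on k S (\<lambda>x. c)"
proof (induction k arbitrary: c)
  case (Suc k)
  then show ?case by (simp add: differentiable_on_def)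
qed auto

lemma Ck_on_bounded_linear:
  assumes "bounded_linear L" "open S" "Ck_on k S f"
  shows "Ck_on k S (\<lambda>x. L (f x))"
  using assms(3)
proof (induction k arbitrary: f)
  case 0
  then show ?case
    using bounded_linear.continuous_on[OF assms(1)] by auto
next
  case (Suc k)
  show ?case
  proof (rule Ck_on_Suc_I[OF assms(2)])
    show "((\<lambda>x. L (f x)) has_derivative (\<lambda>h. L (frechet_derivative f (at x) h))) (at x)" if "x \<in> S" for x
      using bounded_linear.has_derivative[OF assms(1) Ck_on_has_derivative[OF Suc.prems assms(2) that]] .
    show "Ck_on k S (\<lambda>x. L (frechet_derivative f (at x) h))" for h
      by (rule Suc.IH[OF Ck_on_frechet_derivative[OF Suc.prems]])
  qed
qed

lemma Ck_on_id: "open S \<Longrightarrow> Ck_on k S (\<lambda>x. x)"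
proof (cases k)
  case (Suc j)
  assume "open S"
  then show ?thesis unfolding Suc
    by (intro Ck_on_Suc_I[where D="\<lambda>_ h. h"]) (auto intro: Ck_on_const)
qed auto

lemma Ck_on_linear: "bounded_linear L \<Longrightarrow> open S \<Longrightarrow> Ck_on k S L"
  using Ck_on_bounded_linear[OF _ _ Ck_on_id] by blast

lemma Ck_on_add:
  assumes "open S" "Ck_on k S f" "Ck_on k S g"
  shows "Ck_on k S (\<lambda>x. f x + g x)"
  using assms(2,3)
proof (induction k arbitrary: f g)
  case 0
  then show ?case by (auto intro: continuous_on_add)
next
  case (Suc k)
  show ?case
  proof (rule Ck_on_Suc_I[OF assms(1)])
    show "((\<lambda>x. f x + g x) has_derivative
        (\<lambda>h. frechet_derivative f (at x) h + frechet_derivative g (at x) h)) (at x)" if "x \<in> S" for x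
      using that Suc.prems assms(1) Ck_on_has_derivative by (blast intro: has_derivative_add)
    show "Ck_on k S (\<lambda>x. frechet_derivative f (at x) h + frechet_derivative g (at x) h)" for h
      by (rule Suc.IH[OF Ck_on_frechet_derivative[OF Suc.prems(1)] Ck_on_frechet_derivative[OF Suc.prems(2)]])
  qed
qed

lemma Ck_on_sum:
  assumes "open S" "\<And>i. i \<in> I \<Longrightarrow> Ck_on k S (f i)"
  shows "Ck_on k S (\<lambda>x. \<Sum>i\<in>I. f i x)"
  using assms(2)
proof (induction I rule: infinite_finite_induct)
  case (insert i I)
  then show ?case by (simp add: Ck_on_add[OF assms(1)])
qed (simp_all add: Ck_on_const)

text \<open>By the Leibniz rule the derivative is a sum of two expressions of the same kind, so the
  induction runs over all pairs \<open>f\<close>, \<open>g\<close>.\<close>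

lemma Ck_on_bilinear:
  assumes "bounded_bilinear B" "open S" "Ck_on k S f" "Ck_on k S g"
  shows "Ck_on k S (\<lambda>x. B (f x) (g x))"
  using assms(3,4)
proof (induction k arbitrary: f g)
  case 0
  then show ?case
    using bounded_bilinear.continuous_on[OF assms(1)] by auto
next
  case (Suc k)
  show ?case
  proof (rule Ck_on_Suc_I[OF assms(2)])
    show "((\<lambda>x. B (f x) (g x)) has_derivative
      (\<lambda>h. B (f x) (frechet_derivative g (at x) h) + B (frechet_derivative f (at x) h) (g x))) (at x)"
      if "x \<in> S" for x
      by (rule bounded_bilinear.FDERIV[OF assms(1)]; rule Ck_on_has_derivative[OF _ assms(2) that];
        rule Suc.prems)
    show "Ck_on k S (\<lambda>x. B (f x) (frechet_derivative g (at x) h) + B (frechet_derivative f (at x) h) (g x))" for h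
      by (rule Ck_on_add[OF assms(2)]; rule Suc.IH; rule Ck_on_SucD[OF assms(2)] Ck_on_frechet_derivative;
        rule Suc.prems)
  qed
qed

text \<open>\<open>Ck_on\<close> speaks of derivatives in fixed directions. Expanding in the basis
  reduces a derivative in a moving direction to finitely many fixed ones.\<close>

lemma linear_euclidean_sum:
  fixes L :: "'e::euclidean_space \<Rightarrow> 'f::real_vector"
  assumes "linear L"
  shows "L w = (\<Sum>b\<in>Basis. (w \<bullet> b) *\<^sub>R L b)"
proof -
  interpret linear L by fact
  have "L (\<Sum>b\<in>Basis. (w \<bullet> b) *\<^sub>R b) = (\<Sum>b\<in>Basis. (w \<bullet> b) *\<^sub>R L b)"
    by (simp only: sum scale)
  then show ?thesis by (simp add: euclidean_representation)
qed

lemma Ck_on_compose: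
  fixes f :: "'e::real_normed_vector \<Rightarrow> 'f::euclidean_space"
    and g :: "'f \<Rightarrow> 'g::real_normed_vector"
  assumes "open S" "open T" "f ` S \<subseteq> T" "Ck_on k S f" "Ck_on k T g"
  shows "Ck_on k S (\<lambda>x. g (f x))"
  using assms(4,5)
proof (induction k arbitrary: g)
  case 0
  then show ?case using continuous_on_compose2[of T g S f] assms(3) by auto
next
  case (Suc k)
  \<comment> \<open>The chain rule applies the derivative of \<open>g\<close> at \<open>f x\<close>
    to a vector that moves with \<open>x\<close>. After expansion only derivatives of
    \<open>g\<close> in fixed directions remain, and the induction hypothesis covers them because it
    is stated for all \<open>g\<close>.\<close>
  define D where "D = (\<lambda>x h. \<Sum>b\<in>Basis.
    (frechet_derivative f (at x) h \<bullet> b) *\<^sub>R frechet_derivative g (at (f x)) b)"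
  show ?case
  proof (rule Ck_on_Suc_I[OF assms(1), where D = D])
    fix x assume x: "x \<in> S"
    then have fx: "f x \<in> T" using assms(3) by blast
    have g: "(g has_derivative frechet_derivative g (at (f x))) (at (f x))"
      by (rule Ck_on_has_derivative[OF Suc.prems(2) assms(2) fx])
    have "((\<lambda>x. g (f x)) has_derivative
       (\<lambda>h. frechet_derivative g (at (f x)) (frechet_derivative f (at x) h))) (at x)"
      by (rule has_derivative_compose[OF Ck_on_has_derivative[OF Suc.prems(1) assms(1) x] g])
    moreover have "(\<lambda>h. frechet_derivative g (at (f x)) (frechet_derivative f (at x) h)) = D x"
      unfolding D_def by (rule ext, rule linear_euclidean_sum[OF has_derivative_linear[OF g]])
    ultimately show "((\<lambda>x. g (f x)) has_derivative D x) (at x)" by simp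
  next
    fix h
    have f: "Ck_on k S f" using Ck_on_SucD[OF assms(1) Suc.prems(1)] .
    show "Ck_on k S (\<lambda>x. D x h)"
      unfolding D_def
    proof (intro Ck_on_sum[OF assms(1)] Ck_on_bilinear[OF bounded_bilinear_scaleR assms(1)])
      fix b :: 'f
      show "Ck_on k S (\<lambda>x. frechet_derivative f (at x) h \<bullet> b)"
        by (rule Ck_on_bounded_linear[OF bounded_linear_inner_left assms(1)
          Ck_on_frechet_derivative[OF Suc.prems(1)]])
      show "Ck_on k S (\<lambda>x. frechet_derivative g (at (f x)) b)"
        by (rule Suc.IH[OF f Ck_on_frechet_derivative[OF Suc.prems(2)]])
    qed
  qed
qed

lemma smooth_on_mono: "smooth_on S f \<Longrightarrow> T \<subseteq> S \<Longrightarrow> smooth_on T f"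
  unfolding smooth_on_def using Ck_on_mono by blast

lemma smooth_on_cong:
  "open S \<Longrightarrow> (\<And>y. y \<in> S \<Longrightarrow> f y = g y) \<Longrightarrow> smooth_on S f \<Longrightarrow> smooth_on S g"
  unfolding smooth_on_def using Ck_on_cong by metis

lemma smooth_on_local:
  assumes "open S" "\<And>x. x \<in> S \<Longrightarrow> \<exists>T. open T \<and> x \<in> T \<and> smooth_on T f"
  shows "smooth_on S f"
  unfolding smooth_on_def
proof
  show "Ck_on k S f" for k
    by (rule Ck_on_local[OF assms(1)]) (use assms(2) smooth_on_def in blast)
qed

lemma smooth_on_const: "smooth_on S (\<lambda>x. c)"
  by (simp add: smooth_on_def Ck_on_const)

lemma smooth_on_id: "open S \<Longrightarrow> smooth_on S (\<lambda>x. x)"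
  by (simp add: smooth_on_def Ck_on_id)

lemma smooth_on_linear: "bounded_linear L \<Longrightarrow> open S \<Longrightarrow> smooth_on S L"
  by (simp add: smooth_on_def Ck_on_linear)

lemma smooth_on_bounded_linear:
  "bounded_linear L \<Longrightarrow> open S \<Longrightarrow> smooth_on S f \<Longrightarrow> smooth_on S (\<lambda>x. L (f x))"
  by (simp add: smooth_on_def Ck_on_bounded_linear)

lemma smooth_on_add:
  "open S \<Longrightarrow> smooth_on S f \<Longrightarrow> smooth_on S g \<Longrightarrow> smooth_on S (\<lambda>x. f x + g x)"
  by (simp add: smooth_on_def Ck_on_add)

lemma smooth_on_minus: "open S \<Longrightarrow> smooth_on S f \<Longrightarrow> smooth_on S (\<lambda>x. - f x)"
  by (intro smooth_on_bounded_linear[of uminus] bounded_linear_minus bounded_linear_ident)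

lemma smooth_on_diff:
  "open S \<Longrightarrow> smooth_on S f \<Longrightarrow> smooth_on S g \<Longrightarrow> smooth_on S (\<lambda>x. f x - g x)"
  using smooth_on_add[of S f "\<lambda>x. - g x"] smooth_on_minus[of S g] by simp

lemma smooth_on_sum:
  "open S \<Longrightarrow> (\<And>i. i \<in> I \<Longrightarrow> smooth_on S (f i)) \<Longrightarrow> smooth_on S (\<lambda>x. \<Sum>i\<in>I. f i x)"
  by (simp add: smooth_on_def Ck_on_sum)

lemma smooth_on_scaleR:
  "open S \<Longrightarrow> smooth_on S f \<Longrightarrow> smooth_on S g \<Longrightarrow> smooth_on S (\<lambda>x. f x *\<^sub>R g x)"
  by (simp add: smooth_on_def Ck_on_bilinear bounded_bilinear_scaleR)

lemma smooth_on_mult: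
  fixes f g :: "'e::real_normed_vector \<Rightarrow> real"
  shows "open S \<Longrightarrow> smooth_on S f \<Longrightarrow> smooth_on S g \<Longrightarrow> smooth_on S (\<lambda>x. f x * g x)"
  by (simp add: smooth_on_def Ck_on_bilinear bounded_bilinear_mult)

lemma smooth_on_prod:
  fixes f :: "'i \<Rightarrow> 'e::real_normed_vector \<Rightarrow> real"
  assumes "open S" "\<And>i. i \<in> I \<Longrightarrow> smooth_on S (f i)"
  shows "smooth_on S (\<lambda>x. \<Prod>i\<in>I. f i x)"
  using assms(2)
proof (induction I rule: infinite_finite_induct)
  case (insert i I)
  then show ?case by (simp add: smooth_on_mult[OF assms(1)])
qed (simp_all add: smooth_on_const)

lemma smooth_on_inner:
  "open S \<Longrightarrow> smooth_on S f \<Longrightarrow> smooth_on S g \<Longrightarrow> smooth_on S (\<lambda>x. f x \<bullet> g x)"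
  by (simp add: smooth_on_def Ck_on_bilinear bounded_bilinear_inner)

lemma smooth_on_Pair:
  assumes "open S" "smooth_on S f" "smooth_on S g"
  shows "smooth_on S (\<lambda>x. (f x, g x))"
proof -
  have "smooth_on S (\<lambda>x. (f x, 0) + (0, g x))"
    using assms by (intro smooth_on_add smooth_on_bounded_linear[where L="\<lambda>x. (x, 0)"]
      smooth_on_bounded_linear[where L="\<lambda>x. (0, x)"] bounded_linear_Pair bounded_linear_ident bounded_linear_zero)
  then show ?thesis by simp
qed

lemma smooth_on_fst: "open S \<Longrightarrow> smooth_on S f \<Longrightarrow> smooth_on S (\<lambda>x. fst (f x))"
  by (rule smooth_on_bounded_linear[OF bounded_linear_fst])

lemma smooth_on_snd: "open S \<Longrightarrow> smooth_on S f \<Longrightarrow> smooth_on S (\<lambda>x. snd (f x))"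
  by (rule smooth_on_bounded_linear[OF bounded_linear_snd])

lemma smooth_on_vec_nth:
  fixes f :: "'e::real_normed_vector \<Rightarrow> 'f::real_normed_vector ^ 'n"
  shows "open S \<Longrightarrow> smooth_on S f \<Longrightarrow> smooth_on S (\<lambda>x. f x $ i)"
  by (rule smooth_on_bounded_linear[OF bounded_linear_vec_nth])

lemma bounded_linear_axis: "bounded_linear (axis i :: 'f::euclidean_space \<Rightarrow> 'f ^ 'n::finite)"
  by (intro linear_conv_bounded_linear[THEN iffD1] linearI) (auto simp: axis_def vec_eq_iff)

lemma smooth_on_vec:
  fixes f :: "'e::real_normed_vector \<Rightarrow> 'f::euclidean_space ^ 'n"
  assumes "open S" "\<And>i. smooth_on S (\<lambda>x. f x $ i)"
  shows "smooth_on S f"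
proof -
  have eq: "f = (\<lambda>x. \<Sum>i\<in>UNIV. axis i (f x $ i))"
    by (rule ext) (simp add: vec_eq_iff axis_def)
  have "smooth_on S (\<lambda>x. \<Sum>i\<in>UNIV. axis i (f x $ i))"
    by (intro smooth_on_sum[OF assms(1)] smooth_on_bounded_linear[OF bounded_linear_axis assms(1)] assms(2))
  then show ?thesis using eq by simp
qed

lemma smooth_on_compose:
  fixes f :: "'e::real_normed_vector \<Rightarrow> 'f::euclidean_space"
  assumes "open S" "open T" "f ` S \<subseteq> T" "smooth_on S f" "smooth_on T g"
  shows "smooth_on S (\<lambda>x. g (f x))"
  using assms by (simp add: smooth_on_def Ck_on_compose)

lemma smooth_on_frechet_derivative:
  "smooth_on S f \<Longrightarrow> smooth_on S (\<lambda>x. frechet_derivative f (at x) h)"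
  unfolding smooth_on_def using Ck_on.simps(2) by blast

lemma smooth_on_has_derivative:
  "smooth_on S f \<Longrightarrow> open S \<Longrightarrow> x \<in> S \<Longrightarrow> (f has_derivative frechet_derivative f (at x)) (at x)"
  unfolding smooth_on_def using Ck_on_has_derivative by blast

lemma smooth_on_continuous_on: "smooth_on S f \<Longrightarrow> continuous_on S f"
  unfolding smooth_on_def using Ck_on.simps(1) by blast

text \<open>Joint smoothness in a point and a vector follows from smoothness in the point for fixed
  vectors. Derivatives along fields, coordinate changes in the fibres and Christoffel symbols with
  varying arguments are treated this way.\<close>

lemma smooth_on_apply_linear:
  fixes f :: "'e::euclidean_space \<Rightarrow> 'f::euclidean_space" and L :: "'e \<Rightarrow> 'f \<Rightarrow> 'g::real_normed_vector"
  assumes "open S" "\<And>x. x \<in> S \<Longrightarrow> linear (L x)" "\<And>b. smooth_on S (\<lambda>x. L x b)" "smooth_on S f"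
  shows "smooth_on S (\<lambda>x. L x (f x))"
proof -
  have eq: "(\<Sum>b\<in>Basis. (f x \<bullet> b) *\<^sub>R L x b) = L x (f x)" if "x \<in> S" for x
    by (rule linear_euclidean_sum[OF assms(2)[OF that], symmetric])
  have "smooth_on S (\<lambda>x. \<Sum>b\<in>Basis. (f x \<bullet> b) *\<^sub>R L x b)"
    by (rule smooth_on_sum[OF assms(1)], rule smooth_on_scaleR[OF assms(1)],
      rule smooth_on_inner[OF assms(1,4) smooth_on_const], rule assms(3))
  from smooth_on_cong[OF assms(1) eq this] show ?thesis .
qed

lemma smooth_on_frechet_derivative_apply:
  fixes f :: "'e::euclidean_space \<Rightarrow> 'e" and g :: "'e \<Rightarrow> 'g::real_normed_vector"
  assumes "open S" "smooth_on S g" "smooth_on S f"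
  shows "smooth_on S (\<lambda>x. frechet_derivative g (at x) (f x))"
  by (rule smooth_on_apply_linear[OF assms(1)
      has_derivative_linear[OF smooth_on_has_derivative[OF assms(2,1)]]
      smooth_on_frechet_derivative[OF assms(2)] assms(3)])

lemma Ck_on_inverse:
  fixes f :: "'e::real_normed_vector \<Rightarrow> real"
  assumes "open S" "\<And>x. x \<in> S \<Longrightarrow> f x \<noteq> 0" "Ck_on k S f"
  shows "Ck_on k S (\<lambda>x. inverse (f x))"
  using assms(3)
proof (induction k)
  case 0
  then show ?case using assms(2) by (auto intro: continuous_on_inverse)
next
  case (Suc k)
  \<comment> \<open>The derivative of 1/f is a polynomial in 1/f and Df, so the induction needs
    nothing but 1/f itself one order lower.\<close>
  have inv: "Ck_on k S (\<lambda>x. inverse (f x))"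
    by (rule Suc.IH[OF Ck_on_SucD[OF assms(1) Suc.prems]])
  show ?case
  proof (rule Ck_on_Suc_I[OF assms(1)])
    show "((\<lambda>x. inverse (f x)) has_derivative
        (\<lambda>h. - (inverse (f x) * frechet_derivative f (at x) h * inverse (f x)))) (at x)" if "x \<in> S" for x
      by (rule Deriv.has_derivative_inverse[OF assms(2)[OF that] Ck_on_has_derivative[OF Suc.prems assms(1) that]])
    show "Ck_on k S (\<lambda>x. - (inverse (f x) * frechet_derivative f (at x) h * inverse (f x)))" for h
      by (rule Ck_on_bounded_linear[OF bounded_linear_minus[OF bounded_linear_ident] assms(1)],
        rule Ck_on_bilinear[OF bounded_bilinear_mult assms(1) _ inv],
        rule Ck_on_bilinear[OF bounded_bilinear_mult assms(1) inv Ck_on_frechet_derivative[OF Suc.prems]])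
  qed
qed

definition flat_exp :: "nat \<Rightarrow> real \<Rightarrow> real" where
  "flat_exp n t = (if t > 0 then exp (- inverse t) * inverse t ^ n else 0)"

text \<open>Substitute s = 1/t: the exponential beats every power as s tends to infinity.\<close>

lemma flat_exp_tendsto: "(flat_exp n \<longlongrightarrow> 0) (at_right 0)"
proof -
  have "((\<lambda>t. inverse t ^ n / exp (inverse t)) \<longlongrightarrow> (0::real)) (at_right 0)"
    by (rule filterlim_compose[OF tendsto_power_div_exp_0 filterlim_inverse_at_top_right])
  moreover have "\<forall>\<^sub>F t in at_right 0. inverse t ^ n / exp (inverse t) = flat_exp n (t::real)"
    using eventually_at_right_less[of "0::real"]
    by eventually_elim (simp add: flat_exp_def exp_minus field_simps)
  ultimately show ?thesis by (rule Lim_transform_eventually)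
qed

lemma has_derivative_flat_exp:
  "(flat_exp n has_derivative (\<lambda>h. h * (flat_exp (n + 2) t - real n * flat_exp (n + 1) t))) (at t)"
proof -
  have "(flat_exp n has_real_derivative (flat_exp (n + 2) t - real n * flat_exp (n + 1) t)) (at t)"
  proof (cases "t > 0")
    case True
    have "((\<lambda>t. exp (- inverse t) * inverse t ^ n) has_real_derivative
        (flat_exp (n + 2) t - real n * flat_exp (n + 1) t)) (at t)"
    proof -
      \<comment> \<open>The derivative of a power has the exponent n - 1, a truncated difference;
        separating n = 0, n = 1 and n \<ge> 2 resolves it.\<close>
      have "n = 0 \<or> n = 1 \<or> (\<exists>m. n = Suc (Suc m))"
        by (metis One_nat_def not0_implies_Suc)
      have "t * t ^ (m - Suc 0) = t ^ m" if "m \<noteq> 0" for m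
        using that by (cases m) auto
      then show ?thesis
        using True \<open>n = 0 \<or> n = 1 \<or> (\<exists>m. n = Suc (Suc m))\<close>
        by (auto intro!: derivative_eq_intros simp: flat_exp_def field_simps power2_eq_square)
    qed
    then show ?thesis
      by (rule has_field_derivative_transform_within_open[where S="{0<..}"])
        (use True in \<open>auto simp: flat_exp_def\<close>)
  next
    case False
    then consider "t < 0" | "t = 0" by linarith
    then show ?thesis
    proof cases
      case 1
      have "((\<lambda>t. 0) has_real_derivative (flat_exp (n + 2) t - real n * flat_exp (n + 1) t)) (at t)"
        using 1 by (simp add: flat_exp_def)
      then show ?thesis
        by (rule has_field_derivative_transform_within_open[where S="{..<0}"])
          (use 1 in \<open>auto simp: flat_exp_def\<close>)
    next
      case 2
      \<comment> \<open>At 0 the difference quotient vanishes on the left, and on the right it is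
        \<open>flat_exp (n + 1)\<close>, which tends to 0.\<close>
      have "((\<lambda>y. (flat_exp n y - flat_exp n 0) / (y - 0)) \<longlongrightarrow> 0) (at 0)"
      proof (rule filterlim_split_at)
        show "((\<lambda>y. (flat_exp n y - flat_exp n 0) / (y - 0)) \<longlongrightarrow> 0) (at_left 0)"
          by (rule Lim_transform_eventually[OF tendsto_const])
            (auto simp: flat_exp_def eventually_at_filter)
        have "\<forall>\<^sub>F y in at_right 0. flat_exp (n + 1) y = (flat_exp n y - flat_exp n 0) / (y - 0)"
          by (auto simp: flat_exp_def eventually_at_filter field_simps)
        then show "((\<lambda>y. (flat_exp n y - flat_exp n 0) / (y - 0)) \<longlongrightarrow> 0) (at_right 0)"
          by (rule Lim_transform_eventually[OF flat_exp_tendsto])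
      qed
      then show ?thesis
        using 2 by (simp add: has_field_derivative_iff flat_exp_def)
    qed
  qed
  then show ?thesis
    by (rule has_derivative_eq_rhs[OF has_field_derivative_imp_has_derivative]) (auto simp: mult.commute)
qed

lemma smooth_on_flat_exp: "smooth_on UNIV (flat_exp n)"
proof -
  have "Ck_on k UNIV (flat_exp n)" for k
  proof (induction k arbitrary: n)
    case 0
    show ?case
      using has_derivative_continuous[OF has_derivative_flat_exp]
      by (simp add: continuous_on_eq_continuous_at)
  next
    case (Suc k)
    have "Ck_on k UNIV (\<lambda>t. h * (flat_exp (n + 2) t + (- real n) * flat_exp (n + 1) t))" for h
      by (intro Ck_on_bilinear[OF bounded_bilinear_mult] Ck_on_add Ck_on_const Suc open_UNIV)
    then show ?case
      by (intro Ck_on_Suc_I[OF open_UNIV has_derivative_flat_exp]) simp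
  qed
  then show ?thesis by (simp add: smooth_on_def)
qed

lemma bump_function_exists:
  fixes a :: "'e::euclidean_space"
  assumes "r > 0"
  obtains \<beta> :: "'e \<Rightarrow> real" where "smooth_on UNIV \<beta>" "\<And>y. y \<in> ball a (r / 2) \<Longrightarrow> \<beta> y = 1"
    "\<And>y. y \<notin> cball a r \<Longrightarrow> \<beta> y = 0"
proof
  \<comment> \<open>Quadratic in \<open>y\<close>, hence smooth at the centre too. It is at least 1
    once 2|y - a|^2 \<le> r^2 and at most 0 outside the ball of radius \<open>r\<close>, so the
    quotient below is 1 and 0 there. Its denominator is positive since s and 1 - s are never both
    nonpositive.\<close>
  define s where "s y = 2 - 2 / r\<^sup>2 * ((y - a) \<bullet> (y - a))" for y
  define \<beta> where "\<beta> y = flat_exp 0 (s y) * inverse (flat_exp 0 (s y) + flat_exp 0 (1 - s y))" for y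
  have pos: "flat_exp 0 t + flat_exp 0 (1 - t) > 0" for t
    by (auto simp: flat_exp_def add_pos_nonneg add_nonneg_pos)
  have "smooth_on UNIV (\<lambda>y. y - a)"
    by (intro smooth_on_diff smooth_on_id smooth_on_const open_UNIV)
  then have s: "smooth_on UNIV s"
    unfolding s_def
    by (intro smooth_on_diff[OF open_UNIV smooth_on_const] smooth_on_mult[OF open_UNIV smooth_on_const]
      smooth_on_inner open_UNIV)
  have s1: "smooth_on UNIV (\<lambda>y. 1 - s y)"
    by (intro smooth_on_diff s smooth_on_const open_UNIV)
  have f: "smooth_on UNIV (\<lambda>y. flat_exp 0 (s y))" "smooth_on UNIV (\<lambda>y. flat_exp 0 (1 - s y))"
    by (rule smooth_on_compose[OF open_UNIV open_UNIV _ s smooth_on_flat_exp], simp,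
      rule smooth_on_compose[OF open_UNIV open_UNIV _ s1 smooth_on_flat_exp], simp)
  have "smooth_on UNIV (\<lambda>y. inverse (flat_exp 0 (s y) + flat_exp 0 (1 - s y)))"
    using smooth_on_add[OF open_UNIV f] pos unfolding smooth_on_def
    by (intro allI Ck_on_inverse[OF open_UNIV]) (auto simp: less_le)
  then show "smooth_on UNIV \<beta>"
    unfolding \<beta>_def by (intro smooth_on_mult f open_UNIV)
  show "\<beta> y = 1" if "y \<in> ball a (r / 2)" for y
  proof -
    have "(norm (y - a))\<^sup>2 \<le> (r / 2)\<^sup>2"
      using that by (intro power_mono) (auto simp: dist_norm norm_minus_commute)
    moreover have "(r / 2)\<^sup>2 = r\<^sup>2 / 4" "0 \<le> (norm (y - a))\<^sup>2"
      by (simp_all add: power_divide)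
    ultimately have "2 * (norm (y - a))\<^sup>2 \<le> r\<^sup>2" by linarith
    then have "1 - s y \<le> 0"
      using assms by (simp add: s_def dot_square_norm field_simps power2_eq_square)
    then have "flat_exp 0 (1 - s y) = 0" by (simp add: flat_exp_def)
    then show ?thesis using pos[of "s y"] by (simp add: \<beta>_def)
  qed
  show "\<beta> y = 0" if "y \<notin> cball a r" for y
  proof -
    have "r\<^sup>2 \<le> (norm (y - a))\<^sup>2"
      using that assms by (intro power_mono) (auto simp: dist_norm norm_minus_commute)
    then have "s y \<le> 0"
      using assms by (simp add: s_def dot_square_norm field_simps power2_eq_square)
    then show ?thesis by (simp add: \<beta>_def flat_exp_def)
  qed
qed

section \<open>Picard-Lindelof, Gronwall estimates and differentiability of the flow\<close>

section \<open>Ordinary differential equations\<close>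

lemma norm_linear_le_sum_Basis:
  fixes L :: "'e::euclidean_space \<Rightarrow> 'f::real_normed_vector"
  assumes "linear L"
  shows "norm (L w) \<le> (\<Sum>b\<in>Basis. norm (L b)) * norm w"
proof -
  have "norm (L w) \<le> (\<Sum>b\<in>Basis. norm ((w \<bullet> b) *\<^sub>R L b))"
    unfolding linear_euclidean_sum[OF assms, of w] by (rule norm_sum)
  also have "\<dots> \<le> (\<Sum>b\<in>Basis. norm (L b) * norm w)"
  proof (intro sum_mono)
    fix b :: 'e assume "b \<in> Basis"
    then have "\<bar>w \<bullet> b\<bar> * norm (L b) \<le> norm w * norm (L b)"
      by (intro mult_right_mono Basis_le_norm) auto
    then show "norm ((w \<bullet> b) *\<^sub>R L b) \<le> norm (L b) * norm w"
      by (simp add: mult.commute)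
  qed
  finally show ?thesis by (simp add: sum_distrib_right)
qed

lemma smooth_on_compact_bounded:
  assumes "smooth_on S f" "K \<subseteq> S" "compact K"
  obtains B where "B \<ge> 0" "\<And>x. x \<in> K \<Longrightarrow> norm (f x) \<le> B"
proof -
  have "compact (f ` K)"
    using continuous_on_subset[OF smooth_on_continuous_on[OF assms(1)] assms(2)] assms(3)
    by (rule compact_continuous_image)
  then obtain B where "\<forall>x\<in>f ` K. norm x \<le> B"
    using compact_imp_bounded bounded_iff by metis
  then show ?thesis using that[of "max 0 B"] by fastforce
qed

text \<open>Compactness bounds the derivatives in the basis directions, their sum bounds the
  operator norm, and the mean value inequality applies on the convex ball.\<close>

lemma smooth_on_lipschitz:
  fixes f :: "'e::euclidean_space \<Rightarrow> 'f::real_normed_vector"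
  assumes "smooth_on S f" "open S" "cball a R \<subseteq> S"
  obtains L where "L \<ge> 0" "\<And>x h. x \<in> cball a R \<Longrightarrow> norm (frechet_derivative f (at x) h) \<le> L * norm h"
    "\<And>x y. x \<in> cball a R \<Longrightarrow> y \<in> cball a R \<Longrightarrow> norm (f x - f y) \<le> L * norm (x - y)"
proof -
  have "\<exists>C. \<forall>b. C b \<ge> 0 \<and> (\<forall>x\<in>cball a R. norm (frechet_derivative f (at x) b) \<le> C b)"
    by (rule choice) (metis smooth_on_compact_bounded[OF smooth_on_frechet_derivative[OF assms(1)] assms(3) compact_cball])
  then obtain C where C: "\<And>b. C b \<ge> 0" "\<And>b x. x \<in> cball a R \<Longrightarrow> norm (frechet_derivative f (at x) b) \<le> C b"
    by blast
  define L where "L = (\<Sum>b\<in>(Basis :: 'e set). C b)"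
  have der: "(f has_derivative frechet_derivative f (at x)) (at x)" if "x \<in> cball a R" for x
    by (rule smooth_on_has_derivative[OF assms(1,2)]) (use that assms(3) in blast)
  have bd: "norm (frechet_derivative f (at x) h) \<le> L * norm h" if "x \<in> cball a R" for x h
  proof -
    have "norm (frechet_derivative f (at x) h) \<le> (\<Sum>b\<in>Basis. norm (frechet_derivative f (at x) b)) * norm h"
      by (rule norm_linear_le_sum_Basis[OF has_derivative_linear[OF der[OF that]]])
    also have "\<dots> \<le> L * norm h"
      unfolding L_def by (intro mult_right_mono sum_mono C(2)[OF that]) simp
    finally show ?thesis .
  qed
  show ?thesis
  proof (rule that)
    show "L \<ge> 0" unfolding L_def by (intro sum_nonneg C(1))
    show "norm (f x - f y) \<le> L * norm (x - y)" if "x \<in> cball a R" "y \<in> cball a R" for x y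
    proof (rule differentiable_bound[OF convex_cball _ _ that])
      show "(f has_derivative frechet_derivative f (at z)) (at z within cball a R)" if "z \<in> cball a R" for z
        by (rule has_derivative_at_withinI[OF der[OF that]])
      show "onorm (frechet_derivative f (at z)) \<le> L" if "z \<in> cball a R" for z
        by (rule onorm_le) (rule bd[OF that])
    qed
  qed (rule bd)
qed

text \<open>The Picard operator is a contraction by 1/2 on the complete space of bounded continuous
  functions on the whole line. To work in that type, time is clamped to [-T, T] by \<open>c\<close>
  and not restricted.\<close>

lemma picard_lindelof_global:
  fixes G :: "'e::euclidean_space \<Rightarrow> 'e"
  assumes lip: "\<And>x y. norm (G x - G y) \<le> L * norm (x - y)" and bd: "\<And>x. norm (G x) \<le> B"
    and T: "T > 0" "4 * T * L \<le> 1 / 2" "L \<ge> 0"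
  obtains \<gamma> where "\<gamma> 0 = y" "\<And>t. norm (\<gamma> t - y) \<le> 4 * T * B"
    "\<And>t. \<bar>t\<bar> < T \<Longrightarrow> (\<gamma> has_vector_derivative G (\<gamma> t)) (at t)"
proof -
  have contG: "continuous_on UNIV G"
  proof (rule lipschitz_on_continuous_on[of L])
    show "L-lipschitz_on UNIV G"
      using lip T(3) by (auto simp: lipschitz_on_def dist_norm)
  qed
  define c where "c t = max (- T) (min T t)" for t
  have c: "- T \<le> c t" "c t \<le> T" for t using T(1) by (auto simp: c_def)
  have contc: "continuous_on UNIV c" unfolding c_def by (intro continuous_intros)
  \<comment> \<open>The integral from 0 to the clamped time, for times of either sign, as a
    difference of two integrals that start at -T. Each runs over a length of at most 2T, which
    explains the factor 4T in all bounds.\<close>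
  define I where "I f t = integral {- T..c t} f - integral {- T..0} f" for f :: "real \<Rightarrow> 'e" and t
  have I_bound: "norm (I f t) \<le> 4 * T * K"
    if f: "continuous_on UNIV f" "\<And>s. norm (f s) \<le> K" for f K t
  proof -
    have K: "K \<ge> 0" using f(2)[of 0] norm_ge_zero[of "f 0"] by linarith
    have 1: "norm (integral {- T..s} f) \<le> K * (s - - T)" if "- T \<le> s" for s
      using that f continuous_on_subset[OF f(1)] by (intro integral_bound) auto
    have "norm (I f t) \<le> norm (integral {- T..c t} f) + norm (integral {- T..0} f)"
      unfolding I_def by (rule norm_triangle_ineq4)
    also have "\<dots> \<le> K * (c t - - T) + K * (0 - - T)"
      using 1[of "c t"] 1[of 0] c[of t] T(1) by simp
    also have "\<dots> \<le> K * (2 * T) + K * (2 * T)"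
      using K c[of t] T(1) by (intro add_mono mult_left_mono) auto
    finally show ?thesis by (simp add: algebra_simps)
  qed
  have I_diff: "I f t - I g t = I (\<lambda>s. f s - g s) t"
    if "continuous_on UNIV f" "continuous_on UNIV g" for f g t
  proof -
    have "integral {- T..s} (\<lambda>s. f s - g s) = integral {- T..s} f - integral {- T..s} g" for s
      by (intro integral_diff integrable_continuous_real continuous_on_subset[OF that(1)]
        continuous_on_subset[OF that(2)]) auto
    then show ?thesis by (simp add: I_def)
  qed
  have I_cont: "continuous_on UNIV (I f)" if "continuous_on UNIV f" for f
  proof -
    have "continuous_on {- T..T} (\<lambda>s. integral {- T..s} f)"
      using that by (intro indefinite_integral_continuous_1 integrable_continuous_real continuous_on_subset[OF that]) auto
    then have "continuous_on UNIV (\<lambda>t. integral {- T..c t} f)"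
      by (rule continuous_on_compose2[OF _ contc]) (use c in auto)
    then show ?thesis unfolding I_def by (intro continuous_intros)
  qed
  define P where "P g = Bcontfun (\<lambda>t. y + I (\<lambda>s. G (apply_bcontfun g s)) t)" for g :: "real \<Rightarrow>\<^sub>C 'e"
  have cont: "continuous_on UNIV (\<lambda>s. G (apply_bcontfun g s))" for g
    by (rule continuous_on_compose2[OF contG]) auto
  have P: "apply_bcontfun (P g) t = y + I (\<lambda>s. G (apply_bcontfun g s)) t" for g t
  proof -
    have "(\<lambda>t. y + I (\<lambda>s. G (apply_bcontfun g s)) t) \<in> bcontfun"
    proof (rule bcontfun_normI)
      show "continuous_on UNIV (\<lambda>t. y + I (\<lambda>s. G (apply_bcontfun g s)) t)"
        by (intro continuous_intros I_cont cont)
      show "norm (y + I (\<lambda>s. G (apply_bcontfun g s)) t) \<le> norm y + 4 * T * B" for t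
        using norm_triangle_ineq[of y "I (\<lambda>s. G (apply_bcontfun g s)) t"] I_bound[OF cont bd, of g t] by linarith
    qed
    then show ?thesis unfolding P_def by (simp add: Bcontfun_inverse)
  qed
  have contr: "dist (P f) (P g) \<le> 1 / 2 * dist f g" for f g
  proof (rule dist_bound)
    fix t
    have "dist (apply_bcontfun (P f) t) (apply_bcontfun (P g) t)
        = norm (I (\<lambda>s. G (apply_bcontfun f s) - G (apply_bcontfun g s)) t)"
      by (simp add: P dist_norm I_diff cont)
    also have "\<dots> \<le> 4 * T * (L * dist f g)"
    proof (rule I_bound)
      show "continuous_on UNIV (\<lambda>s. G (apply_bcontfun f s) - G (apply_bcontfun g s))"
        by (intro continuous_intros cont)
      fix s
      have "norm (G (apply_bcontfun f s) - G (apply_bcontfun g s)) \<le> L * norm (apply_bcontfun f s - apply_bcontfun g s)"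
        by (rule lip)
      also have "\<dots> \<le> L * dist f g"
        using dist_bounded[of f s g] T(3) by (intro mult_left_mono) (auto simp: dist_norm)
      finally show "norm (G (apply_bcontfun f s) - G (apply_bcontfun g s)) \<le> L * dist f g" .
    qed
    also have "\<dots> = (4 * T * L) * dist f g" by simp
    also have "\<dots> \<le> 1 / 2 * dist f g" by (intro mult_right_mono T(2)) simp
    finally show "dist (apply_bcontfun (P f) t) (apply_bcontfun (P g) t) \<le> 1 / 2 * dist f g" .
  qed
  obtain g where g: "P g = g"
    using banach_fix_type[of "1/2" P] contr by auto
  let ?f = "\<lambda>s. G (apply_bcontfun g s)"
  have eq: "apply_bcontfun g t = y + I ?f t" for t
    using P[of g t] g by simp
  show ?thesis
  proof (rule that[of "apply_bcontfun g"])
    show "apply_bcontfun g 0 = y" using T(1) by (simp add: eq[of 0] I_def c_def)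
    show "norm (apply_bcontfun g t - y) \<le> 4 * T * B" for t
      using I_bound[OF cont bd, of g t] by (simp add: eq[of t])
    show "(apply_bcontfun g has_vector_derivative G (apply_bcontfun g t)) (at t)" if t: "\<bar>t\<bar> < T" for t
    proof -
      have "((\<lambda>u. integral {- T..u} ?f) has_vector_derivative ?f t) (at t within {- T..T})"
        using t by (intro integral_has_vector_derivative continuous_on_subset[OF cont]) auto
      moreover have "at t within {- T..T} = at t"
        using t by (intro at_within_interior) auto
      ultimately have "((\<lambda>u. integral {- T..u} ?f) has_vector_derivative ?f t) (at t)"
        by (simp only:)
      then have h1: "((\<lambda>u. y + (integral {- T..u} ?f - integral {- T..0} ?f)) has_vector_derivative ?f t) (at t)"
        by (auto intro!: derivative_eq_intros)
      have h2: "y + (integral {- T..s} ?f - integral {- T..0} ?f) = apply_bcontfun g s"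
        if "s \<in> {- T<..<T}" for s
      proof -
        have "c s = s" using that by (simp add: c_def)
        from eq[of s, unfolded I_def this] show ?thesis by (rule sym)
      qed
      show ?thesis
        by (rule has_vector_derivative_transform_within_open[OF h1 open_greaterThanLessThan _ h2]) (use t in auto)
    qed
  qed
qed

text \<open>Composing \<open>F\<close> with the nearest-point projection onto the ball gives a
  bounded and globally Lipschitz field. A solution that starts in the half ball moves by at most
  R/2, so it never meets the modified region. The time \<open>T\<close> is the same for all starting
  points.\<close>

lemma picard_lindelof_local:
  fixes F :: "'e::euclidean_space \<Rightarrow> 'e"
  assumes "smooth_on S F" "open S" "cball a R \<subseteq> S" "R > 0"
  obtains T where "T > 0" "\<And>y. y \<in> ball a (R / 2) \<Longrightarrow> \<exists>\<gamma>. \<gamma> 0 = y \<and>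
    (\<forall>t. \<bar>t\<bar> < T \<longrightarrow> \<gamma> t \<in> cball a R \<and> (\<gamma> has_vector_derivative F (\<gamma> t)) (at t))"
proof -
  obtain L where L: "L \<ge> 0" "\<And>x y. x \<in> cball a R \<Longrightarrow> y \<in> cball a R \<Longrightarrow> norm (F x - F y) \<le> L * norm (x - y)"
    using smooth_on_lipschitz[OF assms(1-3)] by metis
  obtain B where B: "B \<ge> 0" "\<And>x. x \<in> cball a R \<Longrightarrow> norm (F x) \<le> B"
    using smooth_on_compact_bounded[OF assms(1,3) compact_cball] by metis
  let ?p = "closest_point (cball a R)"
  have ne: "cball a R \<noteq> {}" using assms(4) by simp
  have p: "?p x \<in> cball a R" for x
    by (rule closest_point_in_set[OF closed_cball ne])
  define G where "G x = F (?p x)" for x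
  have G: "norm (G x - G y) \<le> L * norm (x - y)" for x y
  proof -
    have "norm (G x - G y) \<le> L * norm (?p x - ?p y)"
      unfolding G_def by (rule L(2)[OF p p])
    also have "\<dots> \<le> L * norm (x - y)"
      using closest_point_lipschitz[OF convex_cball closed_cball ne, of x y] L(1)
      by (intro mult_left_mono) (auto simp: dist_norm)
    finally show ?thesis .
  qed
  have GB: "norm (G x) \<le> B" for x unfolding G_def by (rule B(2)[OF p])
  \<comment> \<open>Chosen for 4TL \<le> 1/2 (contraction) and 4TB \<le> R/2 (displacement); adding
    1 to \<open>L\<close> and \<open>B\<close> keeps the denominators positive.\<close>
  define T where "T = min (1 / (8 * (L + 1))) (R / (8 * (B + 1)))"
  have T: "T > 0" using L(1) B(1) assms(4) by (simp add: T_def)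
  have TL: "4 * T * L \<le> 1 / 2"
  proof -
    have "T * (8 * (L + 1)) \<le> 1" using L(1) by (simp add: T_def pos_le_divide_eq[symmetric])
    then show ?thesis using T by (simp add: algebra_simps)
  qed
  have TB: "4 * T * B \<le> R / 2"
  proof -
    have "T * (8 * (B + 1)) \<le> R" using B(1) by (simp add: T_def pos_le_divide_eq[symmetric])
    then show ?thesis using T by (simp add: algebra_simps)
  qed
  show ?thesis
  proof (rule that[OF T])
    fix y assume y: "y \<in> ball a (R / 2)"
    obtain \<gamma> where \<gamma>: "\<gamma> 0 = y" "\<And>t. norm (\<gamma> t - y) \<le> 4 * T * B"
      "\<And>t. \<bar>t\<bar> < T \<Longrightarrow> (\<gamma> has_vector_derivative G (\<gamma> t)) (at t)"
      using picard_lindelof_global[OF G GB T TL L(1)] by metis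
    have in_ball: "\<gamma> t \<in> cball a R" for t
    proof -
      have "dist a (\<gamma> t) \<le> dist a y + dist y (\<gamma> t)" by (rule dist_triangle)
      also have "\<dots> \<le> R / 2 + R / 2"
        using y \<gamma>(2)[of t] TB by (intro add_mono) (auto simp: dist_norm norm_minus_commute)
      finally show ?thesis by simp
    qed
    then have "G (\<gamma> t) = F (\<gamma> t)" for t
      by (simp add: G_def closest_point_self)
    then show "\<exists>\<gamma>. \<gamma> 0 = y \<and>
      (\<forall>t. \<bar>t\<bar> < T \<longrightarrow> \<gamma> t \<in> cball a R \<and> (\<gamma> has_vector_derivative F (\<gamma> t)) (at t))"
      using \<gamma> in_ball by (intro exI[of _ \<gamma>]) auto
  qed
qed

text \<open>Since \<open>2 \<epsilon> |z| \<le> |z|\<^sup>2 + \<epsilon>\<^sup>2\<close>, the function \<open>|z|\<^sup>2 + \<epsilon>\<^sup>2\<close> grows at most exponentially with rate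
  \<open>2 L + 1\<close>.\<close>

lemma gronwall_forward:
  fixes z :: "real \<Rightarrow> 'e::euclidean_space"
  assumes "a \<le> b" "L \<ge> 0"
    and der: "\<And>s. a \<le> s \<Longrightarrow> s \<le> b \<Longrightarrow> (z has_vector_derivative z' s) (at s)"
    and bd: "\<And>s. a \<le> s \<Longrightarrow> s \<le> b \<Longrightarrow> norm (z' s) \<le> L * norm (z s) + \<epsilon>"
  shows "(norm (z b))\<^sup>2 + \<epsilon>\<^sup>2 \<le> ((norm (z a))\<^sup>2 + \<epsilon>\<^sup>2) * exp ((2 * L + 1) * (b - a))"
proof -
  let ?K = "2 * L + 1"
  \<comment> \<open>The squared norm stays differentiable where \<open>z\<close> vanishes. Dividing
    by the expected growth leaves a nonincreasing function.\<close>
  define f where "f s = (z s \<bullet> z s + \<epsilon>\<^sup>2) * exp (- ?K * s)" for s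
  have "f b \<le> f a"
  proof (rule DERIV_nonpos_imp_nonincreasing[OF assms(1)])
    fix s assume s: "a \<le> s" "s \<le> b"
    have "((\<lambda>s. z s \<bullet> z s) has_real_derivative (z s \<bullet> z' s + z' s \<bullet> z s)) (at s)"
      using bounded_bilinear.has_vector_derivative[OF bounded_bilinear_inner der[OF s] der[OF s]]
      by (simp add: has_real_derivative_iff_has_vector_derivative)
    then have "(f has_real_derivative
        (z s \<bullet> z' s + z' s \<bullet> z s) * exp (- ?K * s) + (z s \<bullet> z s + \<epsilon>\<^sup>2) * (exp (- ?K * s) * (- ?K))) (at s)"
      unfolding f_def by (auto intro!: derivative_eq_intros)
    moreover have "(z s \<bullet> z' s + z' s \<bullet> z s) * exp (- ?K * s) + (z s \<bullet> z s + \<epsilon>\<^sup>2) * (exp (- ?K * s) * (- ?K)) \<le> 0"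
    proof -
      have "z s \<bullet> z' s \<le> norm (z s) * norm (z' s)" by (rule norm_cauchy_schwarz)
      also have "\<dots> \<le> norm (z s) * (L * norm (z s) + \<epsilon>)" by (intro mult_left_mono bd[OF s]) simp
      finally have 1: "2 * (z s \<bullet> z' s) \<le> 2 * L * (norm (z s))\<^sup>2 + 2 * (norm (z s) * \<epsilon>)"
        by (simp add: algebra_simps power2_eq_square)
      have "0 \<le> (norm (z s) - \<epsilon>)\<^sup>2" by simp
      then have 2: "2 * (norm (z s) * \<epsilon>) \<le> (norm (z s))\<^sup>2 + \<epsilon>\<^sup>2"
        by (simp add: power2_diff)
      have 3: "0 \<le> 2 * L * \<epsilon>\<^sup>2" using assms(2) by simp
      have "z s \<bullet> z' s + z' s \<bullet> z s \<le> (z s \<bullet> z s + \<epsilon>\<^sup>2) * ?K"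
        using 1 2 3 by (simp add: dot_square_norm inner_commute algebra_simps)
      then have "(z s \<bullet> z' s + z' s \<bullet> z s - (z s \<bullet> z s + \<epsilon>\<^sup>2) * ?K) * exp (- ?K * s) \<le> 0"
        by (intro mult_nonpos_nonneg) auto
      then show ?thesis by (simp add: algebra_simps)
    qed
    ultimately show "\<exists>y. (f has_real_derivative y) (at s) \<and> y \<le> 0" by blast
  qed
  then have "f b * exp (?K * b) \<le> f a * exp (?K * b)" by (intro mult_right_mono) auto
  moreover have "f s * exp (?K * b) = ((norm (z s))\<^sup>2 + \<epsilon>\<^sup>2) * exp (?K * (b - s))" for s
  proof -
    have "exp (- ?K * s) * exp (?K * b) = exp (?K * (b - s))"
      unfolding exp_add[symmetric] by (simp add: algebra_simps)
    then show ?thesis unfolding f_def by (simp only: mult.assoc dot_square_norm)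
  qed
  ultimately show ?thesis by simp
qed

text \<open>For times before \<open>t0\<close> the forward estimate is applied to the time-reversed
  curve.\<close>

lemma gronwall:
  fixes z :: "real \<Rightarrow> 'e::euclidean_space"
  assumes "L \<ge> 0"
    and der: "\<And>s. \<bar>s - t0\<bar> \<le> \<bar>t - t0\<bar> \<Longrightarrow> (z has_vector_derivative z' s) (at s)"
    and bd: "\<And>s. \<bar>s - t0\<bar> \<le> \<bar>t - t0\<bar> \<Longrightarrow> norm (z' s) \<le> L * norm (z s) + \<epsilon>"
  shows "(norm (z t))\<^sup>2 + \<epsilon>\<^sup>2 \<le> ((norm (z t0))\<^sup>2 + \<epsilon>\<^sup>2) * exp ((2 * L + 1) * \<bar>t - t0\<bar>)"
proof (cases "t0 \<le> t")
  case True
  have "(norm (z t))\<^sup>2 + \<epsilon>\<^sup>2 \<le> ((norm (z t0))\<^sup>2 + \<epsilon>\<^sup>2) * exp ((2 * L + 1) * (t - t0))"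
    by (rule gronwall_forward[where z' = z']) (use True assms in auto)
  then show ?thesis using True by simp
next
  case False
  define y where "y s = z (- s)" for s
  have "(norm (y (- t)))\<^sup>2 + \<epsilon>\<^sup>2 \<le> ((norm (y (- t0)))\<^sup>2 + \<epsilon>\<^sup>2) * exp ((2 * L + 1) * (- t - - t0))"
  proof (rule gronwall_forward[where z' = "\<lambda>s. - z' (- s)"])
    fix s assume s: "- t0 \<le> s" "s \<le> - t"
    have "(z has_vector_derivative z' (- s)) (at (- s))"
      by (rule der) (use s False in auto)
    then have "((z \<circ> uminus) has_vector_derivative (- 1) *\<^sub>R z' (- s)) (at s)"
      by (intro vector_diff_chain_at) (auto intro!: derivative_eq_intros)
    moreover have "y = z \<circ> uminus" by (rule ext) (simp add: y_def)
    ultimately show "(y has_vector_derivative - z' (- s)) (at s)" by simp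
    show "norm (- z' (- s)) \<le> L * norm (y s) + \<epsilon>"
      unfolding y_def norm_minus_cancel by (rule bd) (use s False in auto)
  qed (use False assms in auto)
  then show ?thesis using False by (simp add: y_def)
qed

lemma ode_difference_bound:
  fixes F :: "'e::euclidean_space \<Rightarrow> 'e"
  assumes "L \<ge> 0" and lip: "\<And>x y. x \<in> K \<Longrightarrow> y \<in> K \<Longrightarrow> norm (F x - F y) \<le> L * norm (x - y)"
    and d1: "\<And>s. \<bar>s - t0\<bar> < d \<Longrightarrow> \<gamma>\<^sub>1 s \<in> K \<and> (\<gamma>\<^sub>1 has_vector_derivative F (\<gamma>\<^sub>1 s)) (at s)"
    and d2: "\<And>s. \<bar>s - t0\<bar> < d \<Longrightarrow> \<gamma>\<^sub>2 s \<in> K \<and> (\<gamma>\<^sub>2 has_vector_derivative F (\<gamma>\<^sub>2 s)) (at s)"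
    and t: "\<bar>t - t0\<bar> < d"
  shows "norm (\<gamma>\<^sub>1 t - \<gamma>\<^sub>2 t) \<le> norm (\<gamma>\<^sub>1 t0 - \<gamma>\<^sub>2 t0) * exp ((2 * L + 1) * d)"
proof -
  have "(norm (\<gamma>\<^sub>1 t - \<gamma>\<^sub>2 t))\<^sup>2 + 0\<^sup>2 \<le> ((norm (\<gamma>\<^sub>1 t0 - \<gamma>\<^sub>2 t0))\<^sup>2 + 0\<^sup>2) * exp ((2 * L + 1) * \<bar>t - t0\<bar>)"
  proof (rule gronwall[OF assms(1)])
    fix s assume "\<bar>s - t0\<bar> \<le> \<bar>t - t0\<bar>"
    then have s: "\<bar>s - t0\<bar> < d" using t by linarith
    show "((\<lambda>s. \<gamma>\<^sub>1 s - \<gamma>\<^sub>2 s) has_vector_derivative F (\<gamma>\<^sub>1 s) - F (\<gamma>\<^sub>2 s)) (at s)"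
      using d1[OF s] d2[OF s] by (intro has_vector_derivative_diff) auto
    show "norm (F (\<gamma>\<^sub>1 s) - F (\<gamma>\<^sub>2 s)) \<le> L * norm (\<gamma>\<^sub>1 s - \<gamma>\<^sub>2 s) + 0"
      using lip d1[OF s] d2[OF s] by simp
  qed
  also have "\<dots> \<le> (norm (\<gamma>\<^sub>1 t0 - \<gamma>\<^sub>2 t0))\<^sup>2 * (exp ((2 * L + 1) * d))\<^sup>2"
  proof -
    have "exp ((2 * L + 1) * \<bar>t - t0\<bar>) \<le> exp ((2 * L + 1) * d)"
      using assms(1) t by (simp add: mult_left_mono)
    \<comment> \<open>exp E \<le> (exp E)^2 for E \<ge> 0 gives up sharpness to obtain a perfect
      square, whose root can be taken.\<close>
    also have "\<dots> \<le> (exp ((2 * L + 1) * d))\<^sup>2"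
      using assms(1) t by (simp add: power2_eq_square)
    finally show ?thesis by (simp add: mult_left_mono)
  qed
  finally have "(norm (\<gamma>\<^sub>1 t - \<gamma>\<^sub>2 t))\<^sup>2 \<le> (norm (\<gamma>\<^sub>1 t0 - \<gamma>\<^sub>2 t0) * exp ((2 * L + 1) * d))\<^sup>2"
    by (simp only: power_mult_distrib zero_power2 add_0_right)
  then show ?thesis by (rule power2_le_imp_le) simp
qed

text \<open>By continuity both curves stay for a while in a ball on which \<open>F\<close> is
  Lipschitz, and there their distance is bounded by a multiple of the initial distance, which is
  0.\<close>

lemma ode_unique_local:
  fixes F :: "'e::euclidean_space \<Rightarrow> 'e"
  assumes "smooth_on S F" "open S" "\<gamma>\<^sub>1 t0 \<in> S" "\<gamma>\<^sub>1 t0 = \<gamma>\<^sub>2 t0"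
    and d1: "\<forall>\<^sub>F s in nhds t0. (\<gamma>\<^sub>1 has_vector_derivative F (\<gamma>\<^sub>1 s)) (at s)"
    and d2: "\<forall>\<^sub>F s in nhds t0. (\<gamma>\<^sub>2 has_vector_derivative F (\<gamma>\<^sub>2 s)) (at s)"
  shows "\<forall>\<^sub>F s in nhds t0. \<gamma>\<^sub>1 s = \<gamma>\<^sub>2 s"
proof -
  obtain R where R: "R > 0" "cball (\<gamma>\<^sub>1 t0) R \<subseteq> S"
    using bspec[OF open_contains_cball[THEN iffD1, OF assms(2)] assms(3)] by blast
  obtain L where L: "L \<ge> 0" "\<And>x y. x \<in> cball (\<gamma>\<^sub>1 t0) R \<Longrightarrow> y \<in> cball (\<gamma>\<^sub>1 t0) R
      \<Longrightarrow> norm (F x - F y) \<le> L * norm (x - y)"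
    using smooth_on_lipschitz[OF assms(1,2) R(2)] by metis
  have ev: "\<forall>\<^sub>F s in nhds t0. \<gamma> s \<in> cball (\<gamma>\<^sub>1 t0) R"
    if "\<forall>\<^sub>F s in nhds t0. (\<gamma> has_vector_derivative F (\<gamma> s)) (at s)" "\<gamma> t0 = \<gamma>\<^sub>1 t0" for \<gamma>
  proof -
    have "isCont \<gamma> t0"
      using eventually_nhds_x_imp_x[OF that(1)] by (rule has_vector_derivative_continuous)
    then have "(\<gamma> \<longlongrightarrow> \<gamma> t0) (nhds t0)"
      by (simp only: isCont_def tendsto_at_iff_tendsto_nhds)
    then have "\<forall>\<^sub>F s in nhds t0. \<gamma> s \<in> ball (\<gamma>\<^sub>1 t0) R"
      using R(1) that(2) by (intro topological_tendstoD) auto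
    then show ?thesis by (rule eventually_mono) auto
  qed
  have "\<forall>\<^sub>F s in nhds t0. (\<gamma>\<^sub>1 s \<in> cball (\<gamma>\<^sub>1 t0) R \<and> (\<gamma>\<^sub>1 has_vector_derivative F (\<gamma>\<^sub>1 s)) (at s)) \<and>
      (\<gamma>\<^sub>2 s \<in> cball (\<gamma>\<^sub>1 t0) R \<and> (\<gamma>\<^sub>2 has_vector_derivative F (\<gamma>\<^sub>2 s)) (at s))"
    by (intro eventually_conj ev[OF d1 refl] ev[OF d2 assms(4)[symmetric]] d1 d2)
  then obtain d where "d > 0" and d: "\<And>s. \<bar>s - t0\<bar> < d \<Longrightarrow>
      (\<gamma>\<^sub>1 s \<in> cball (\<gamma>\<^sub>1 t0) R \<and> (\<gamma>\<^sub>1 has_vector_derivative F (\<gamma>\<^sub>1 s)) (at s)) \<and>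
      (\<gamma>\<^sub>2 s \<in> cball (\<gamma>\<^sub>1 t0) R \<and> (\<gamma>\<^sub>2 has_vector_derivative F (\<gamma>\<^sub>2 s)) (at s))"
    unfolding eventually_nhds_metric dist_real_def by blast
  have "\<gamma>\<^sub>1 s = \<gamma>\<^sub>2 s" if "\<bar>s - t0\<bar> < d" for s
  proof -
    have "norm (\<gamma>\<^sub>1 s - \<gamma>\<^sub>2 s) \<le> norm (\<gamma>\<^sub>1 t0 - \<gamma>\<^sub>2 t0) * exp ((2 * L + 1) * d)"
      by (rule ode_difference_bound[where F=F and K="cball (\<gamma>\<^sub>1 t0) R"])
        ((rule L conjunct1[OF d] conjunct2[OF d] that; assumption?)+)
    then show ?thesis using assms(4) by simp
  qed
  then show ?thesis
    unfolding eventually_nhds_metric using \<open>d > 0\<close> by (intro exI[of _ d]) (simp add: dist_real_def)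
qed

text \<open>The derivatives in the basis directions are Lipschitz on the ball, so along the segment
  from \<open>x\<close> to \<open>y\<close> the derivative deviates from that at \<open>x\<close> by
  a multiple of |y - x|; integrating the deviation costs a second factor.\<close>

lemma smooth_on_second_order:
  fixes f :: "'e::euclidean_space \<Rightarrow> 'f::real_normed_vector"
  assumes "smooth_on S f" "open S" "cball a R \<subseteq> S"
  obtains K where "K \<ge> 0" "\<And>x y. x \<in> cball a R \<Longrightarrow> y \<in> cball a R \<Longrightarrow>
    norm (f y - f x - frechet_derivative f (at x) (y - x)) \<le> K * (norm (y - x))\<^sup>2"
proof -
  let ?D = "\<lambda>x. frechet_derivative f (at x)"
  have "\<exists>C. \<forall>b. C b \<ge> 0 \<and> (\<forall>x\<in>cball a R. \<forall>y\<in>cball a R. norm (?D x b - ?D y b) \<le> C b * norm (x - y))"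
    by (rule choice) (metis smooth_on_lipschitz[OF smooth_on_frechet_derivative[OF assms(1)] assms(2,3)])
  then obtain C where C: "\<And>b. C b \<ge> 0"
    "\<And>b x y. x \<in> cball a R \<Longrightarrow> y \<in> cball a R \<Longrightarrow> norm (?D x b - ?D y b) \<le> C b * norm (x - y)"
    by blast
  define K where "K = (\<Sum>b\<in>(Basis :: 'e set). C b)"
  have K: "K \<ge> 0" unfolding K_def by (intro sum_nonneg C(1))
  have der: "(f has_derivative ?D x) (at x)" if "x \<in> cball a R" for x
    by (rule smooth_on_has_derivative[OF assms(1,2)]) (use that assms(3) in blast)
  show ?thesis
  proof (rule that[OF K])
    fix x y assume xy: "x \<in> cball a R" "y \<in> cball a R"
    let ?S = "closed_segment x y"
    have S: "?S \<subseteq> cball a R" using xy by (simp add: closed_segment_subset)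
    have "norm (f y - f x - ?D x (y - x)) \<le> norm (y - x) * (K * norm (y - x))"
    proof (rule differentiable_bound_linearization[where S="?S"])
      show "x + t *\<^sub>R (y - x) \<in> ?S" if "t \<in> {0..1}" for t
        using that unfolding closed_segment_def by (auto intro!: exI[of _ t] simp: algebra_simps)
      show "(f has_derivative ?D z) (at z within ?S)" if "z \<in> ?S" for z
        by (rule has_derivative_at_withinI[OF der]) (use that S in blast)
      show "onorm (?D z - ?D x) \<le> K * norm (y - x)" if z: "z \<in> ?S" for z
      proof (rule onorm_le)
        fix h
        have zb: "z \<in> cball a R" using z S by blast
        have "linear (\<lambda>h. ?D z h - ?D x h)"
          using has_derivative_linear[OF der[OF zb]] has_derivative_linear[OF der[OF xy(1)]]
          by (rule linear_compose_sub)
        then have "norm (?D z h - ?D x h) \<le> (\<Sum>b\<in>Basis. norm (?D z b - ?D x b)) * norm h"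
          by (rule norm_linear_le_sum_Basis)
        also have "\<dots> \<le> (\<Sum>b\<in>Basis. C b * norm (y - x)) * norm h"
        proof (intro mult_right_mono sum_mono)
          fix b :: 'e
          have "norm (?D z b - ?D x b) \<le> C b * norm (z - x)" by (rule C(2)[OF zb xy(1)])
          also have "\<dots> \<le> C b * norm (y - x)"
            using segment_bound(1)[OF z] C(1)[of b] by (intro mult_left_mono) auto
          finally show "norm (?D z b - ?D x b) \<le> C b * norm (y - x)" .
        qed simp
        finally show "norm ((?D z - ?D x) h) \<le> K * norm (y - x) * norm h"
          by (simp add: K_def sum_distrib_right)
      qed
      show "x \<in> ?S" by simp
    qed
    then show "norm (f y - f x - ?D x (y - x)) \<le> K * (norm (y - x))\<^sup>2"
      by (simp add: power2_eq_square mult.assoc mult.left_commute)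
  qed
qed

lemma has_derivative_quadratic_bound:
  assumes "bounded_linear D" "r > 0" "K \<ge> 0"
    and "\<And>h. norm h < r \<Longrightarrow> norm (f (x + h) - f x - D h) \<le> K * (norm h)\<^sup>2"
  shows "(f has_derivative D) (at x)"
  unfolding has_derivative_at_alt
proof (intro conjI assms(1) allI impI)
  fix e :: real assume e: "e > 0"
  show "\<exists>d>0. \<forall>y. norm (y - x) < d \<longrightarrow> norm (f y - f x - D (y - x)) \<le> e * norm (y - x)"
  \<comment> \<open>Within this radius K|y - x| \<le> e; the summand 1 covers
    \<open>K = 0\<close>.\<close>
  proof (intro exI[of _ "min r (e / (K + 1))"] conjI allI impI)
    show "0 < min r (e / (K + 1))" using e assms(2,3) by simp
    fix y assume y: "norm (y - x) < min r (e / (K + 1))"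
    have "norm (f y - f x - D (y - x)) \<le> K * (norm (y - x))\<^sup>2"
      using assms(4)[of "y - x"] y by simp
    also have "\<dots> = (K * norm (y - x)) * norm (y - x)" by (simp add: power2_eq_square)
    also have "\<dots> \<le> e * norm (y - x)"
    proof (rule mult_right_mono)
      have "norm (y - x) * (K + 1) \<le> e" using y assms(3) by (simp add: pos_less_divide_eq)
      moreover have "norm (y - x) * (K + 1) = K * norm (y - x) + norm (y - x)" by (simp add: algebra_simps)
      ultimately show "K * norm (y - x) \<le> e" using norm_ge_zero[of "y - x"] by linarith
    qed simp
    finally show "norm (f y - f x - D (y - x)) \<le> e * norm (y - x)" .
  qed
qed

text \<open>The derivative of the flow solves the linearised equation. Its solutions come from applying
  the local existence theorem to the field \<open>(y, w) \<mapsto> (F y, DF(y) w)\<close> near \<open>(a, 0)\<close>, and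
  rescaling.\<close>

lemma linearised_ode:
  fixes F :: "'e::euclidean_space \<Rightarrow> 'e"
  assumes "smooth_on S F" "open S" "a \<in> S"
    and \<phi>: "\<phi> 0 = a" "\<And>t. \<bar>t\<bar> < T \<Longrightarrow> \<phi> t \<in> S \<and> (\<phi> has_vector_derivative F (\<phi> t)) (at t)" and "T > 0"
  obtains T' W where "0 < T'" "T' \<le> T" "\<And>t. bounded_linear (W t)" "\<And>h. W 0 h = h"
    "\<And>t h. \<bar>t\<bar> < T' \<Longrightarrow> ((\<lambda>t. W t h) has_vector_derivative frechet_derivative F (at (\<phi> t)) (W t h)) (at t)"
proof -
  let ?D = "\<lambda>y. frechet_derivative F (at y)"
  obtain R where R: "R > 0" "cball a R \<subseteq> S"
    using bspec[OF open_contains_cball[THEN iffD1, OF assms(2)] assms(3)] by blast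
  have op: "open (S \<times> (UNIV :: 'e set))" by (intro open_Times assms(2) open_UNIV)
  have lin: "linear (?D y)" if "y \<in> S" for y
    by (rule has_derivative_linear[OF smooth_on_has_derivative[OF assms(1,2) that]])
  define F2 where "F2 p = (F (fst p), ?D (fst p) (snd p))" for p :: "'e \<times> 'e"
  have fst: "smooth_on (S \<times> UNIV) (fst :: 'e \<times> 'e \<Rightarrow> 'e)" and snd: "smooth_on (S \<times> UNIV) (snd :: 'e \<times> 'e \<Rightarrow> 'e)"
    using smooth_on_linear[OF bounded_linear_fst op] smooth_on_linear[OF bounded_linear_snd op] .
  have compose: "smooth_on (S \<times> UNIV) (\<lambda>p :: 'e \<times> 'e. g (fst p))" if "smooth_on S g" for g :: "'e \<Rightarrow> 'e"
    by (rule smooth_on_compose[OF op assms(2) _ fst that]) auto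
  have F2: "smooth_on (S \<times> UNIV) F2"
    unfolding F2_def
    by (rule smooth_on_Pair[OF op compose[OF assms(1)]], rule smooth_on_apply_linear[OF op _ _ snd],
      use lin in force, rule compose[OF smooth_on_frechet_derivative[OF assms(1)]])
  have cb: "cball (a, 0 :: 'e) R \<subseteq> S \<times> UNIV"
  proof
    fix p assume "p \<in> cball (a, 0 :: 'e) R"
    then have "dist a (fst p) \<le> R" using dist_fst_le[of "(a, 0)" p] by simp
    then have "fst p \<in> S" using R(2) by auto
    then show "p \<in> S \<times> UNIV" by (simp add: mem_Times_iff)
  qed
  obtain T2 where T2: "T2 > 0" "\<And>y. y \<in> ball (a, 0) (R / 2) \<Longrightarrow> \<exists>\<gamma>. \<gamma> 0 = y \<and>
    (\<forall>t. \<bar>t\<bar> < T2 \<longrightarrow> \<gamma> t \<in> cball (a, 0) R \<and> (\<gamma> has_vector_derivative F2 (\<gamma> t)) (at t))"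
    using picard_lindelof_local[OF F2 op cb R(1)] by blast
  \<comment> \<open>Small enough that the initial points (a, c b), with b in the basis, lie in the
    half ball where solutions exist for a common time. The lifted field is linear in its second
    component, so dividing by \<open>c\<close> in \<open>W\<close> restores the initial values
    b.\<close>
  define c where "c = R / 4"
  have c: "c > 0" using R(1) by (simp add: c_def)
  have "\<exists>\<gamma>. \<forall>b::'e. b \<in> Basis \<longrightarrow> \<gamma> b 0 = (a, c *\<^sub>R b) \<and>
    (\<forall>t. \<bar>t\<bar> < T2 \<longrightarrow> \<gamma> b t \<in> cball (a, 0) R \<and> (\<gamma> b has_vector_derivative F2 (\<gamma> b t)) (at t))"
  proof (rule choice, rule allI)
    fix b :: 'e
    have "(a, c *\<^sub>R b) \<in> ball (a, 0) (R / 2)" if "b \<in> Basis"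
      using that R(1) by (simp add: dist_Pair_Pair c_def)
    then show "\<exists>\<gamma>. b \<in> Basis \<longrightarrow> \<gamma> 0 = (a, c *\<^sub>R b) \<and>
      (\<forall>t. \<bar>t\<bar> < T2 \<longrightarrow> \<gamma> t \<in> cball (a, 0) R \<and> (\<gamma> has_vector_derivative F2 (\<gamma> t)) (at t))"
      using T2(2) by blast
  qed
  then obtain \<gamma> where \<gamma>: "\<And>b::'e. b \<in> Basis \<Longrightarrow> \<gamma> b 0 = (a, c *\<^sub>R b)"
    "\<And>b t. b \<in> Basis \<Longrightarrow> \<bar>t\<bar> < T2 \<Longrightarrow> \<gamma> b t \<in> cball (a, 0) R"
    "\<And>b t. b \<in> Basis \<Longrightarrow> \<bar>t\<bar> < T2 \<Longrightarrow> (\<gamma> b has_vector_derivative F2 (\<gamma> b t)) (at t)"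
    by blast
  obtain L where L: "L \<ge> 0" "\<And>x y. x \<in> cball a R \<Longrightarrow> y \<in> cball a R \<Longrightarrow> norm (F x - F y) \<le> L * norm (x - y)"
    using smooth_on_lipschitz[OF assms(1,2) R(2)] by metis
  have "isCont \<phi> 0"
    using \<phi>(2)[of 0] \<open>T > 0\<close> by (auto intro: has_vector_derivative_continuous)
  then obtain T3 where T3: "T3 > 0" "\<And>t. \<bar>t\<bar> < T3 \<Longrightarrow> dist (\<phi> t) (\<phi> 0) < R"
    unfolding continuous_at_eps_delta using R(1) by (metis dist_real_def diff_0_right)
  \<comment> \<open>Up to this time \<open>\<phi>\<close> is a solution (\<open>T\<close>), the
    lifted solutions exist (\<open>T2\<close>), and \<open>\<phi>\<close> stays in the ball with the
    Lipschitz bound (\<open>T3\<close>).\<close>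
  define T' where "T' = min T (min T2 T3)"
  have T': "0 < T'" "T' \<le> T" "T' \<le> T2" "T' \<le> T3" using \<open>T > 0\<close> T2(1) T3(1) by (auto simp: T'_def)
  \<comment> \<open>The first component solves the original equation from the same point
    \<open>a\<close>. By uniqueness it is \<open>\<phi>\<close>, so the second component solves the
    equation linearised along \<open>\<phi>\<close>.\<close>
  have fst_eq: "fst (\<gamma> b t) = \<phi> t" if b: "b \<in> Basis" and t: "\<bar>t\<bar> < T'" for b t
  proof -
    have "norm (fst (\<gamma> b t) - \<phi> t) \<le> norm (fst (\<gamma> b 0) - \<phi> 0) * exp ((2 * L + 1) * T')"
    proof (rule ode_difference_bound[where F = F and K = "cball a R"])
      fix s assume s: "\<bar>s - 0\<bar> < T'"
      have "dist a (fst (\<gamma> b s)) \<le> dist (a, 0) (\<gamma> b s)" using dist_fst_le[of "(a, 0)" "\<gamma> b s"] by simp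
      also have "\<dots> \<le> R" using \<gamma>(2)[OF b, of s] s T' by simp
      finally have "fst (\<gamma> b s) \<in> cball a R" by simp
      moreover have "((\<lambda>s. fst (\<gamma> b s)) has_vector_derivative fst (F2 (\<gamma> b s))) (at s)"
        by (rule bounded_linear.has_vector_derivative[OF bounded_linear_fst \<gamma>(3)[OF b]]) (use s T' in simp)
      ultimately show "fst (\<gamma> b s) \<in> cball a R \<and> ((\<lambda>s. fst (\<gamma> b s)) has_vector_derivative F (fst (\<gamma> b s))) (at s)"
        by (simp add: F2_def)
      show "\<phi> s \<in> cball a R \<and> (\<phi> has_vector_derivative F (\<phi> s)) (at s)"
        using \<phi>(2)[of s] T3(2)[of s] s T' by (simp add: \<phi>(1) dist_commute)
    qed (use t L in simp_all)
    then show ?thesis by (simp add: \<gamma>(1)[OF b] \<phi>(1))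
  qed
  define W where "W t h = (\<Sum>b\<in>Basis. (h \<bullet> b) *\<^sub>R (inverse c *\<^sub>R snd (\<gamma> b t)))" for t h
  show ?thesis
  proof (rule that[OF T'(1,2)])
    show "bounded_linear (W t)" for t
      unfolding W_def
      by (intro bounded_linear_sum bounded_linear_scaleR_const bounded_linear_inner_left)
    show "W 0 h = h" for h
    proof -
      have "W 0 h = (\<Sum>b\<in>Basis. (h \<bullet> b) *\<^sub>R b)"
        unfolding W_def using \<gamma>(1) c by (intro sum.cong) auto
      then show ?thesis by (simp add: euclidean_representation)
    qed
    show "((\<lambda>t. W t h) has_vector_derivative ?D (\<phi> t) (W t h)) (at t)" if t: "\<bar>t\<bar> < T'" for t h
    proof -
      have "\<phi> t \<in> S" using \<phi>(2)[of t] t T' by simp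
      then interpret linear "?D (\<phi> t)" by (rule lin)
      have "((\<lambda>t. snd (\<gamma> b t)) has_vector_derivative ?D (\<phi> t) (snd (\<gamma> b t))) (at t)" if "b \<in> Basis" for b
        using bounded_linear.has_vector_derivative[OF bounded_linear_snd \<gamma>(3)[OF that, of t]] t T' fst_eq[OF that t]
        by (simp add: F2_def)
      then have "((\<lambda>t. W t h) has_vector_derivative
          (\<Sum>b\<in>Basis. (h \<bullet> b) *\<^sub>R (inverse c *\<^sub>R ?D (\<phi> t) (snd (\<gamma> b t))))) (at t)"
        unfolding W_def
        by (intro has_vector_derivative_sum bounded_linear.has_vector_derivative[OF bounded_linear_scaleR_right])
      then show ?thesis
        unfolding W_def by (simp only: sum scale)
    qed
  qed
qed

text \<open>Differentiability in the initial point is obtained at \<open>a\<close> only, which is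
  what a tangent map at one point requires. The deviation z of the flow from its linearisation
  satisfies |z'| \<le> L|z| + \<epsilon> with \<epsilon> of order |h|^2 and starts at 0, so Gronwall
  keeps it of that order.\<close>

lemma local_flow:
  fixes F :: "'e::euclidean_space \<Rightarrow> 'e"
  assumes "smooth_on S F" "open S" "a \<in> S"
  obtains r T \<Phi> W where "r > 0" "T > 0" "ball a r \<subseteq> S"
    "\<And>y t. y \<in> ball a r \<Longrightarrow> \<bar>t\<bar> < T \<Longrightarrow> \<Phi> t y \<in> S \<and> ((\<lambda>t. \<Phi> t y) has_vector_derivative F (\<Phi> t y)) (at t)"
    "\<And>y. y \<in> ball a r \<Longrightarrow> \<Phi> 0 y = y"
    "\<And>t. \<bar>t\<bar> < T \<Longrightarrow> (\<Phi> t has_derivative W t) (at a)"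
    "\<And>h. W 0 h = h"
    "\<And>h. ((\<lambda>t. W t h) has_vector_derivative frechet_derivative F (at a) h) (at 0)"
proof -
  let ?D = "\<lambda>y. frechet_derivative F (at y)"
  obtain R where R: "R > 0" "cball a R \<subseteq> S"
    using bspec[OF open_contains_cball[THEN iffD1, OF assms(2)] assms(3)] by blast
  obtain T1 where T1: "T1 > 0" "\<And>y. y \<in> ball a (R / 2) \<Longrightarrow> \<exists>\<gamma>. \<gamma> 0 = y \<and>
    (\<forall>t. \<bar>t\<bar> < T1 \<longrightarrow> \<gamma> t \<in> cball a R \<and> (\<gamma> has_vector_derivative F (\<gamma> t)) (at t))"
    using picard_lindelof_local[OF assms(1,2) R(2,1)] by blast
  have "\<exists>\<gamma>. \<forall>y. y \<in> ball a (R / 2) \<longrightarrow> \<gamma> y 0 = y \<and>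
    (\<forall>t. \<bar>t\<bar> < T1 \<longrightarrow> \<gamma> y t \<in> cball a R \<and> (\<gamma> y has_vector_derivative F (\<gamma> y t)) (at t))"
    by (rule choice) (use T1(2) in blast)
  then obtain \<gamma> where \<gamma>: "\<And>y. y \<in> ball a (R / 2) \<Longrightarrow> \<gamma> y 0 = y"
    "\<And>y t. y \<in> ball a (R / 2) \<Longrightarrow> \<bar>t\<bar> < T1 \<Longrightarrow> \<gamma> y t \<in> cball a R"
    "\<And>y t. y \<in> ball a (R / 2) \<Longrightarrow> \<bar>t\<bar> < T1 \<Longrightarrow> (\<gamma> y has_vector_derivative F (\<gamma> y t)) (at t)"
    by blast
  have a: "a \<in> ball a (R / 2)" using R(1) by simp
  obtain T W where T: "0 < T" "T \<le> T1" and W: "\<And>t. bounded_linear (W t)" "\<And>h. W 0 h = h"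
    "\<And>t h. \<bar>t\<bar> < T \<Longrightarrow> ((\<lambda>t. W t h) has_vector_derivative ?D (\<gamma> a t) (W t h)) (at t)"
  proof -
    have sol: "\<gamma> a t \<in> S \<and> (\<gamma> a has_vector_derivative F (\<gamma> a t)) (at t)" if "\<bar>t\<bar> < T1" for t
      using \<gamma>(2,3)[OF a that] R(2) by blast
    show ?thesis
      by (rule linearised_ode[where \<phi> = "\<gamma> a", OF assms \<gamma>(1)[OF a] sol T1(1)]) (assumption, rule that)
  qed
  obtain L where L: "L \<ge> 0" "\<And>x h. x \<in> cball a R \<Longrightarrow> norm (?D x h) \<le> L * norm h"
    "\<And>x y. x \<in> cball a R \<Longrightarrow> y \<in> cball a R \<Longrightarrow> norm (F x - F y) \<le> L * norm (x - y)"
    by (rule smooth_on_lipschitz[OF assms(1,2) R(2)]) (rule that; assumption)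
  obtain K where K: "K \<ge> 0" "\<And>x y. x \<in> cball a R \<Longrightarrow> y \<in> cball a R \<Longrightarrow>
    norm (F y - F x - ?D x (y - x)) \<le> K * (norm (y - x))\<^sup>2"
    by (rule smooth_on_second_order[OF assms(1,2) R(2)]) (rule that; assumption)
  define C where "C = exp ((2 * L + 1) * T)"
  have C: "C > 0" by (simp add: C_def)
  \<comment> \<open>The Lipschitz bound comes first: it makes the Taylor remainder of
    \<open>F\<close> between the two curves quadratic in \<open>h\<close>.\<close>
  have dist_flow: "norm (\<gamma> (a + h) t - \<gamma> a t) \<le> C * norm h" if h: "norm h < R / 2" and t: "\<bar>t\<bar> < T" for h t
  proof -
    have ah: "a + h \<in> ball a (R / 2)" using h by (simp add: dist_norm)
    have curve: "\<gamma> y s \<in> cball a R \<and> (\<gamma> y has_vector_derivative F (\<gamma> y s)) (at s)"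
      if "y \<in> ball a (R / 2)" "\<bar>s - 0\<bar> < T" for y s
      using \<gamma>(2,3)[OF that(1), of s] that(2) T(2) by simp
    have "norm (\<gamma> (a + h) t - \<gamma> a t) \<le> norm (\<gamma> (a + h) 0 - \<gamma> a 0) * exp ((2 * L + 1) * T)"
      by (rule ode_difference_bound[where F = F and K = "cball a R", OF L(1) L(3) curve[OF ah] curve[OF a]])
        (use t in simp_all)
    then show ?thesis by (simp add: \<gamma>(1)[OF ah] \<gamma>(1)[OF a] C_def mult.commute)
  qed
  have quad: "norm (\<gamma> (a + h) t - \<gamma> a t - W t h) \<le> (K * C\<^sup>2 * C) * (norm h)\<^sup>2"
    if h: "norm h < R / 2" and t: "\<bar>t\<bar> < T" for h t
  proof -
    have ah: "a + h \<in> ball a (R / 2)" using h by (simp add: dist_norm)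
    \<comment> \<open>Bounds the Taylor remainder at every time, since the curves are at most
      \<open>C * norm h\<close> apart.\<close>
    define \<epsilon> where "\<epsilon> = K * (C * norm h)\<^sup>2"
    have \<epsilon>: "\<epsilon> \<ge> 0" using K(1) by (simp add: \<epsilon>_def)
    let ?z = "\<lambda>s. \<gamma> (a + h) s - \<gamma> a s - W s h"
    have "(norm (?z t))\<^sup>2 + \<epsilon>\<^sup>2 \<le> ((norm (?z 0))\<^sup>2 + \<epsilon>\<^sup>2) * exp ((2 * L + 1) * \<bar>t - 0\<bar>)"
    proof (rule gronwall[OF L(1)])
      fix s assume "\<bar>s - 0\<bar> \<le> \<bar>t - 0\<bar>"
      then have s: "\<bar>s\<bar> < T" "\<bar>s\<bar> < T1" using t T(2) by linarith+
      note ball = \<gamma>(2)[OF a s(2)] \<gamma>(2)[OF ah s(2)]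
      have S: "\<gamma> a s \<in> S" using ball(1) R(2) by blast
      interpret linear "?D (\<gamma> a s)"
        by (rule has_derivative_linear[OF smooth_on_has_derivative[OF assms(1,2) S]])
      show "(?z has_vector_derivative F (\<gamma> (a + h) s) - F (\<gamma> a s) - ?D (\<gamma> a s) (W s h)) (at s)"
        by (intro has_vector_derivative_diff \<gamma>(3)[OF a s(2)] \<gamma>(3)[OF ah s(2)] W(3)[OF s(1)])
      have "F (\<gamma> (a + h) s) - F (\<gamma> a s) - ?D (\<gamma> a s) (W s h)
          = ?D (\<gamma> a s) (?z s) + (F (\<gamma> (a + h) s) - F (\<gamma> a s) - ?D (\<gamma> a s) (\<gamma> (a + h) s - \<gamma> a s))"
        by (simp add: diff)
      also have "norm \<dots> \<le> L * norm (?z s) + K * (norm (\<gamma> (a + h) s - \<gamma> a s))\<^sup>2"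
        by (rule norm_triangle_mono[OF L(2)[OF ball(1)] K(2)[OF ball]])
      also have "\<dots> \<le> L * norm (?z s) + \<epsilon>"
        unfolding \<epsilon>_def using dist_flow[OF h s(1)] K(1)
        by (intro add_left_mono mult_left_mono power_mono) auto
      finally show "norm (F (\<gamma> (a + h) s) - F (\<gamma> a s) - ?D (\<gamma> a s) (W s h)) \<le> L * norm (?z s) + \<epsilon>" .
    qed
    also have "\<dots> = \<epsilon>\<^sup>2 * exp ((2 * L + 1) * \<bar>t\<bar>)"
      by (simp add: \<gamma>(1)[OF a] \<gamma>(1)[OF ah] W(2))
    also have "\<dots> \<le> \<epsilon>\<^sup>2 * C\<^sup>2"
    proof (rule mult_left_mono)
      have "exp ((2 * L + 1) * \<bar>t\<bar>) \<le> C" "1 \<le> C"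
        unfolding C_def using L(1) t T(1) by (simp_all add: mult_left_mono)
      then show "exp ((2 * L + 1) * \<bar>t\<bar>) \<le> C\<^sup>2"
        using self_le_power[of C 2] by simp
    qed simp
    finally have "(norm (?z t))\<^sup>2 \<le> (\<epsilon> * C)\<^sup>2"
      unfolding power_mult_distrib using zero_le_power2[of \<epsilon>] by linarith
    then have "norm (?z t) \<le> \<epsilon> * C"
      by (rule power2_le_imp_le) (use \<epsilon> C in simp)
    then show ?thesis by (simp add: \<epsilon>_def power_mult_distrib mult.assoc mult.left_commute mult.commute)
  qed
  show ?thesis
  proof (rule that[where r = "R / 2" and T = T and \<Phi> = "\<lambda>t y. \<gamma> y t" and W = W])
    have "ball a (R / 2) \<subseteq> cball a R" using R(1) by (intro ball_subset_cball[THEN order_trans] subset_cball) auto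
    then show "ball a (R / 2) \<subseteq> S" using R(2) by (rule order_trans)
    show "\<gamma> y t \<in> S \<and> ((\<lambda>t. \<gamma> y t) has_vector_derivative F (\<gamma> y t)) (at t)"
      if "y \<in> ball a (R / 2)" "\<bar>t\<bar> < T" for y t
      using \<gamma>(2,3)[OF that(1), of t] that(2) T(2) R(2) by auto
    show "((\<lambda>y. \<gamma> y t) has_derivative W t) (at a)" if "\<bar>t\<bar> < T" for t
      by (rule has_derivative_quadratic_bound[where r = "R / 2", OF W(1) _ _ quad[OF _ that]]) (use R(1) K(1) C in auto)
    show "((\<lambda>t. W t h) has_vector_derivative ?D a h) (at 0)" for h
      using W(3)[of 0 h] T(1) by (simp add: \<gamma>(1)[OF a] W(2))
  qed (use R(1) T(1) \<gamma>(1) W(2) in auto)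
qed

section \<open>Independence of charts for tangent vectors, directional derivatives, velocities and
  tangent maps\<close>

section \<open>Tangent vectors in charts\<close>

declare split_paired_All [simp del] split_paired_Ex [simp del]

lemma isCont_tendsto_nhds: "isCont f x \<Longrightarrow> (f \<longlongrightarrow> f x) (nhds x)"
  by (simp only: isCont_def tendsto_at_iff_tendsto_nhds)

lemma has_derivative_eventually_eq:
  assumes "(f has_derivative D) (at x)" "\<forall>\<^sub>F y in nhds x. f y = g y"
  shows "(g has_derivative D) (at x)"
proof -
  obtain S where S: "open S" "x \<in> S" "\<And>y. y \<in> S \<Longrightarrow> f y = g y"
    using assms(2) unfolding eventually_nhds by blast
  show ?thesis by (rule has_derivative_transform_within_open[OF assms(1) S])
qed

lemma chart_inv_right:
  assumes "y \<in> snd c ` fst c"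
  shows "snd c (chart_inv c y) = y" "chart_inv c y \<in> fst c"
  using assms by (simp_all add: chart_inv_def f_inv_into_f inv_into_into)

definition dtrans :: "('a, 'e::euclidean_space) chart \<Rightarrow> ('a, 'e) chart \<Rightarrow> 'a \<Rightarrow> 'e \<Rightarrow> 'e" where
  "dtrans c d p = frechet_derivative (snd d \<circ> chart_inv c) (at (snd c p))"

text \<open>Inverse to reading off coordinates in \<open>c\<close>: the coordinate vector is spread
  to all charts at \<open>p\<close>, with the zeros elsewhere that \<open>tangent_space\<close>
  demands.\<close>

definition tvec_of ::
    "('a, 'e::euclidean_space) atlas \<Rightarrow> ('a, 'e) chart \<Rightarrow> 'a \<Rightarrow> 'e \<Rightarrow> ('a, 'e) tvec" where
  "tvec_of A c p \<xi> = (p, \<lambda>d. if d \<in> charts_at A p then dtrans c d p \<xi> else 0)"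

lemma charts_atD: "c \<in> charts_at A p \<Longrightarrow> c \<in> A" "c \<in> charts_at A p \<Longrightarrow> p \<in> fst c"
  by (simp_all add: charts_at_def)

lemma charts_atI: "c \<in> A \<Longrightarrow> p \<in> fst c \<Longrightarrow> c \<in> charts_at A p"
  by (simp add: charts_at_def)

lemma chart_at_in: "p \<in> mcarrier A \<Longrightarrow> chart_at A p \<in> charts_at A p"
  unfolding chart_at_def by (rule someI_ex) (auto simp: mcarrier_def charts_at_def)

lemma chart_at_in': "c \<in> charts_at A p \<Longrightarrow> chart_at A p \<in> charts_at A p"
  unfolding chart_at_def by (rule someI)

lemma charts_at_mcarrier: "c \<in> charts_at A p \<Longrightarrow> p \<in> mcarrier A"
  by (auto simp: mcarrier_def charts_at_def)

lemma tangent_space_fst: "v \<in> tangent_space A p \<Longrightarrow> fst v = p"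
  unfolding tangent_space_def by blast

lemma tangent_space_zero_outside: "v \<in> tangent_space A p \<Longrightarrow> c \<notin> charts_at A p \<Longrightarrow> snd v c = 0"
  unfolding tangent_space_def by blast

lemma tangent_space_trans:
  "v \<in> tangent_space A p \<Longrightarrow> c \<in> charts_at A p \<Longrightarrow> d \<in> charts_at A p \<Longrightarrow> snd v d = dtrans c d p (snd v c)"
  unfolding tangent_space_def dtrans_def by blast

text \<open>The coordinates in one chart determine those in all others. Identities between tangent
  vectors are later checked in a single convenient chart.\<close>

lemma tangent_eqI:
  assumes "v \<in> tangent_space A p" "w \<in> tangent_space A p" "c \<in> charts_at A p" "snd v c = snd w c"
  shows "v = w"
proof (rule prod_eqI)
  show "fst v = fst w" using tangent_space_fst[OF assms(1)] tangent_space_fst[OF assms(2)] by simp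
  show "snd v = snd w"
  proof
    fix d
    show "snd v d = snd w d"
    proof (cases "d \<in> charts_at A p")
      case True
      then show ?thesis
        using tangent_space_trans[OF assms(1,3)] tangent_space_trans[OF assms(2,3)] assms(4) by metis
    next
      case False
      then show ?thesis
        using tangent_space_zero_outside[OF assms(1)] tangent_space_zero_outside[OF assms(2)] by metis
    qed
  qed
qed

locale atlas =
  fixes A :: "('a, 'e::euclidean_space) atlas"
  assumes atlas: "smooth_atlas A"
begin

lemma chart_inv_left: "c \<in> A \<Longrightarrow> p \<in> fst c \<Longrightarrow> chart_inv c (snd c p) = p"
  using atlas by (simp add: smooth_atlas_def chart_inv_def)

lemma open_chart: "c \<in> A \<Longrightarrow> open (snd c ` fst c)"
  using atlas by (simp add: smooth_atlas_def)

lemma open_overlap: "c \<in> A \<Longrightarrow> d \<in> A \<Longrightarrow> open (snd c ` (fst c \<inter> fst d))"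
  using atlas by (simp add: smooth_atlas_def)

lemma smooth_transition:
  "c \<in> A \<Longrightarrow> d \<in> A \<Longrightarrow> smooth_on (snd c ` (fst c \<inter> fst d)) (\<lambda>y. snd d (chart_inv c y))"
  using atlas by (simp add: smooth_atlas_def comp_def)

lemma overlapD:
  assumes "c \<in> A" "y \<in> snd c ` (fst c \<inter> fst d)"
  shows "snd c (chart_inv c y) = y" "chart_inv c y \<in> fst c" "chart_inv c y \<in> fst d"
  using assms chart_inv_left[OF assms(1)] by auto

lemma overlapI: "y \<in> snd c ` fst c \<Longrightarrow> chart_inv c y \<in> fst d \<Longrightarrow> y \<in> snd c ` (fst c \<inter> fst d)"
  using chart_inv_right[of y c] by (metis IntI imageI)

lemma dtrans_has_derivative:
  assumes "c \<in> charts_at A p" "d \<in> charts_at A p"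
  shows "((\<lambda>y. snd d (chart_inv c y)) has_derivative dtrans c d p) (at (snd c p))"
  unfolding dtrans_def comp_def
  using assms
  by (intro smooth_on_has_derivative[OF smooth_transition open_overlap]) (auto simp: charts_at_def)

lemma dtrans_linear: "c \<in> charts_at A p \<Longrightarrow> d \<in> charts_at A p \<Longrightarrow> linear (dtrans c d p)"
  using has_derivative_linear[OF dtrans_has_derivative] .

lemma eventually_overlap:
  assumes "c \<in> charts_at A p" "d \<in> charts_at A p"
  shows "\<forall>\<^sub>F y in nhds (snd c p). y \<in> snd c ` (fst c \<inter> fst d)"
  using assms by (intro eventually_nhds_in_open open_overlap) (auto simp: charts_at_def)

lemma tendsto_transition:
  assumes "c \<in> charts_at A p" "d \<in> charts_at A p"
  shows "((\<lambda>y. snd d (chart_inv c y)) \<longlongrightarrow> snd d p) (nhds (snd c p))"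
proof -
  have "isCont (\<lambda>y. snd d (chart_inv c y)) (snd c p)"
    by (rule has_derivative_continuous[OF dtrans_has_derivative[OF assms]])
  from isCont_tendsto_nhds[OF this] show ?thesis
    by (simp only: chart_inv_left[OF charts_atD[OF assms(1)]])
qed

lemma dtrans_self: "c \<in> charts_at A p \<Longrightarrow> dtrans c c p \<xi> = \<xi>"
proof -
  assume c: "c \<in> charts_at A p"
  have "frechet_derivative (snd c \<circ> chart_inv c) (at (snd c p)) = frechet_derivative (\<lambda>y. y) (at (snd c p))"
  proof (rule frechet_derivative_cong_open)
    show "open (snd c ` fst c)" using c by (simp add: charts_at_def open_chart)
    show "snd c p \<in> snd c ` fst c" using c by (simp add: charts_at_def)
  qed (simp add: chart_inv_right)
  then show ?thesis by (simp add: dtrans_def)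
qed

text \<open>The chain rule for coordinate changes. This cocycle property is what makes the family in
  \<open>tvec_of\<close> compatible.\<close>

lemma dtrans_compose:
  assumes "c \<in> charts_at A p" "d \<in> charts_at A p" "e \<in> charts_at A p"
  shows "dtrans d e p (dtrans c d p \<xi>) = dtrans c e p \<xi>"
proof -
  have "((\<lambda>y. snd e (chart_inv d (snd d (chart_inv c y)))) has_derivative
      (\<lambda>h. dtrans d e p (dtrans c d p h))) (at (snd c p))"
  proof (rule has_derivative_compose[OF dtrans_has_derivative[OF assms(1,2)]])
    show "((\<lambda>y. snd e (chart_inv d y)) has_derivative dtrans d e p) (at (snd d (chart_inv c (snd c p))))"
      using dtrans_has_derivative[OF assms(2,3)] chart_inv_left[of c p] assms(1) by (simp add: charts_at_def)
  qed
  then have "((\<lambda>y. snd e (chart_inv c y)) has_derivative (\<lambda>h. dtrans d e p (dtrans c d p h))) (at (snd c p))"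
  proof (rule has_derivative_transform_within_open)
    show "open (snd c ` (fst c \<inter> fst d))" "snd c p \<in> snd c ` (fst c \<inter> fst d)"
      using assms open_overlap by (auto simp: charts_at_def)
    show "snd e (chart_inv d (snd d (chart_inv c y))) = snd e (chart_inv c y)"
      if "y \<in> snd c ` (fst c \<inter> fst d)" for y
      using overlapD[OF charts_atD(1)[OF assms(1)] that] chart_inv_left[OF charts_atD(1)[OF assms(2)]] by simp
  qed
  from fun_cong[OF has_derivative_unique[OF this dtrans_has_derivative[OF assms(1,3)]]]
  show ?thesis .
qed

lemma tvec_of_in: "c \<in> charts_at A p \<Longrightarrow> tvec_of A c p \<xi> \<in> tangent_space A p"
  by (auto simp: tvec_of_def tangent_space_def dtrans_compose simp flip: dtrans_def)

lemma fst_tvec_of [simp]: "fst (tvec_of A c p \<xi>) = p"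
  by (simp add: tvec_of_def)

lemma tvec_of_same: "c \<in> charts_at A p \<Longrightarrow> snd (tvec_of A c p \<xi>) c = \<xi>"
  by (simp add: tvec_of_def dtrans_self)

lemma tvec_of_chart: "c \<in> charts_at A p \<Longrightarrow> d \<in> charts_at A p \<Longrightarrow> snd (tvec_of A c p \<xi>) d = dtrans c d p \<xi>"
  by (simp add: tvec_of_def)

lemma tvec_of_snd: "v \<in> tangent_space A p \<Longrightarrow> c \<in> charts_at A p \<Longrightarrow> tvec_of A c p (snd v c) = v"
  using tangent_eqI[OF tvec_of_in] tvec_of_same by metis

lemma tangent_space_tadd:
  assumes "v \<in> tangent_space A p" "w \<in> tangent_space A p"
  shows "tadd v w \<in> tangent_space A p"
  unfolding tangent_space_def
proof (intro CollectI conjI allI ballI impI)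
  show "fst (tadd v w) = p" using tangent_space_fst[OF assms(1)] by (simp add: tadd_def)
  show "snd (tadd v w) c = 0" if "c \<notin> charts_at A p" for c
    using tangent_space_zero_outside[OF assms(1) that] tangent_space_zero_outside[OF assms(2) that]
    by (simp add: tadd_def)
  show "snd (tadd v w) d = frechet_derivative (snd d \<circ> chart_inv c) (at (snd c p)) (snd (tadd v w) c)"
    if "c \<in> charts_at A p" "d \<in> charts_at A p" for c d
    using tangent_space_trans[OF assms(1) that] tangent_space_trans[OF assms(2) that]
      linear_add[OF dtrans_linear[OF that]] by (simp add: tadd_def dtrans_def)
qed

lemma tangent_space_tscale:
  assumes "v \<in> tangent_space A p"
  shows "tscale r v \<in> tangent_space A p"
  unfolding tangent_space_def
proof (intro CollectI conjI allI ballI impI)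
  show "fst (tscale r v) = p" using tangent_space_fst[OF assms] by (simp add: tscale_def)
  show "snd (tscale r v) c = 0" if "c \<notin> charts_at A p" for c
    using tangent_space_zero_outside[OF assms that] by (simp add: tscale_def)
  show "snd (tscale r v) d = frechet_derivative (snd d \<circ> chart_inv c) (at (snd c p)) (snd (tscale r v) c)"
    if "c \<in> charts_at A p" "d \<in> charts_at A p" for c d
    using tangent_space_trans[OF assms(1) that] linear_scale[OF dtrans_linear[OF that]]
    by (simp add: tscale_def dtrans_def)
qed

text \<open>\<open>dirder\<close> is computed in the unspecified chart \<open>chart_at A p\<close>;
  the chain rule for the coordinate change moves the computation to a chart of choice.\<close>

lemma dirder_eq:
  assumes "v \<in> tangent_space A p" "c \<in> charts_at A p"
    and "((\<lambda>y. f (chart_inv c y)) has_derivative D) (at (snd c p))"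
  shows "dirder A f v = D (snd v c)"
proof -
  let ?c = "chart_at A p"
  have c0: "?c \<in> charts_at A p" by (rule chart_at_in'[OF assms(2)])
  have "((\<lambda>y. f (chart_inv c (snd c (chart_inv ?c y)))) has_derivative (\<lambda>h. D (dtrans ?c c p h))) (at (snd ?c p))"
  proof (rule has_derivative_compose[OF dtrans_has_derivative[OF c0 assms(2)]])
    show "((\<lambda>y. f (chart_inv c y)) has_derivative D) (at (snd c (chart_inv ?c (snd ?c p))))"
      using assms(3) chart_inv_left[OF charts_atD[OF c0]] by simp
  qed
  then have "((f \<circ> chart_inv ?c) has_derivative (\<lambda>h. D (dtrans ?c c p h))) (at (snd ?c p))"
  proof (rule has_derivative_transform_within_open)
    show "open (snd ?c ` (fst ?c \<inter> fst c))" "snd ?c p \<in> snd ?c ` (fst ?c \<inter> fst c)"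
      using assms(2) c0 open_overlap by (auto simp: charts_at_def)
    show "f (chart_inv c (snd c (chart_inv ?c y))) = (f \<circ> chart_inv ?c) y"
      if "y \<in> snd ?c ` (fst ?c \<inter> fst c)" for y
      using overlapD[OF charts_atD(1)[OF c0] that] chart_inv_left[OF charts_atD(1)[OF assms(2)]] by simp
  qed
  from fun_cong[OF frechet_derivative_at[OF this]] show ?thesis
    using tangent_space_trans[OF assms(1) c0 assms(2)] tangent_space_fst[OF assms(1)]
    by (simp add: dirder_def Let_def)
qed

text \<open>\<open>has_velocity\<close> quantifies over all charts at the point, but one is enough:
  continuity brings the curve into the overlap with any other chart, and the transition map carries
  the derivative over.\<close>

lemma has_velocityI:
  assumes c: "c \<in> charts_at A (\<gamma> t)" and ev: "\<forall>\<^sub>F s in nhds t. \<gamma> s \<in> fst c"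
    and der: "((\<lambda>s. snd c (\<gamma> s)) has_vector_derivative \<xi>) (at t)"
  shows "has_velocity A \<gamma> t (tvec_of A c (\<gamma> t) \<xi>)"
  unfolding has_velocity_def
proof (intro conjI ballI)
  show "\<gamma> t \<in> mcarrier A" by (rule charts_at_mcarrier[OF c])
  show "tvec_of A c (\<gamma> t) \<xi> \<in> tangent_space A (\<gamma> t)" by (rule tvec_of_in[OF c])
  fix d assume d: "d \<in> charts_at A (\<gamma> t)"
  have "isCont (\<lambda>s. snd c (\<gamma> s)) t" by (rule has_vector_derivative_continuous[OF der])
  from eventually_compose_filterlim[OF eventually_overlap[OF c d] isCont_tendsto_nhds[OF this]]
  have ev2: "\<forall>\<^sub>F s in nhds t. \<gamma> s \<in> fst c \<and> \<gamma> s \<in> fst d"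
    using ev
  proof eventually_elim
    case (elim s)
    then show ?case
      using overlapD(3)[OF charts_atD(1)[OF c] elim(1)] chart_inv_left[OF charts_atD(1)[OF c] elim(2)] by simp
  qed
  then show "\<forall>\<^sub>F s in nhds t. \<gamma> s \<in> fst d" by (rule eventually_mono) simp
  have "((\<lambda>s. snd d (chart_inv c (snd c (\<gamma> s)))) has_vector_derivative dtrans c d (\<gamma> t) \<xi>) (at t)"
    using has_derivative_compose[OF der[unfolded has_vector_derivative_def] dtrans_has_derivative[OF c d]]
    by (simp add: has_vector_derivative_def linear_scale[OF dtrans_linear[OF c d]])
  moreover have "\<forall>\<^sub>F s in nhds t. snd d (chart_inv c (snd c (\<gamma> s))) = (snd d \<circ> \<gamma>) s"
    using ev2 by eventually_elim (simp add: chart_inv_left[OF charts_atD(1)[OF c]])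
  ultimately have "((snd d \<circ> \<gamma>) has_vector_derivative dtrans c d (\<gamma> t) \<xi>) (at t)"
    unfolding has_vector_derivative_def by (rule has_derivative_eventually_eq)
  then show "((snd d \<circ> \<gamma>) has_vector_derivative snd (tvec_of A c (\<gamma> t) \<xi>) d) (at t)"
    by (simp add: tvec_of_chart[OF c d])
qed

end

lemma has_velocity_unique:
  assumes "has_velocity A \<gamma> t v" "has_velocity A \<gamma> t w"
  shows "v = w"
proof -
  obtain c where c: "c \<in> charts_at A (\<gamma> t)"
    using assms(1) by (auto simp: has_velocity_def mcarrier_def charts_at_def)
  have "v \<in> tangent_space A (\<gamma> t)" "w \<in> tangent_space A (\<gamma> t)"
    using assms by (simp_all add: has_velocity_def)
  moreover have "snd v c = snd w c"
    by (rule vector_derivative_unique_at[of "snd c \<circ> \<gamma>" _ t]) (use assms c in \<open>auto simp: has_velocity_def\<close>)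
  ultimately show ?thesis by (rule tangent_eqI[OF _ _ c])
qed

lemma velocity_eq: "has_velocity A \<gamma> t w \<Longrightarrow> velocity A \<gamma> t = w"
  unfolding velocity_def by (rule the_equality) (auto intro: has_velocity_unique)

text \<open>Frees \<open>tmap\<close> from its chosen source chart and expresses the result by one
  target chart. The last hypothesis plays the part of continuity: nearby points must land in the
  domain of \<open>d\<close> for \<open>f\<close> to be recovered from its coordinate
  expression.\<close>

lemma tmap_eq:
  assumes "smooth_atlas A" "smooth_atlas B" and v: "v \<in> tangent_space A p"
    and c: "c \<in> charts_at A p" and d: "d \<in> charts_at B (f p)"
    and der: "((\<lambda>y. snd d (f (chart_inv c y))) has_derivative D) (at (snd c p))"
    and ev: "\<forall>\<^sub>F y in nhds (snd c p). f (chart_inv c y) \<in> fst d"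
  shows "tmap A B f v = tvec_of B d (f p) (D (snd v c))"
proof -
  interpret A: atlas A by standard fact
  interpret B: atlas B by standard fact
  let ?c = "chart_at A p"
  have c0: "?c \<in> charts_at A p" by (rule chart_at_in'[OF c])
  have "frechet_derivative (snd e \<circ> f \<circ> chart_inv ?c) (at (snd ?c p)) (snd v ?c) = dtrans d e (f p) (D (snd v c))"
    if e: "e \<in> charts_at B (f p)" for e
  proof -
    have "((\<lambda>y. snd d (f (chart_inv c (snd c (chart_inv ?c y))))) has_derivative (\<lambda>h. D (dtrans ?c c p h)))
        (at (snd ?c p))"
    proof (rule has_derivative_compose[OF A.dtrans_has_derivative[OF c0 c]])
      show "((\<lambda>y. snd d (f (chart_inv c y))) has_derivative D) (at (snd c (chart_inv ?c (snd ?c p))))"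
        using der A.chart_inv_left[OF charts_atD[OF c0]] by simp
    qed
    then have "((\<lambda>y. snd e (chart_inv d (snd d (f (chart_inv c (snd c (chart_inv ?c y))))))) has_derivative
        (\<lambda>h. dtrans d e (f p) (D (dtrans ?c c p h)))) (at (snd ?c p))"
    proof (rule has_derivative_compose)
      show "((\<lambda>y. snd e (chart_inv d y)) has_derivative dtrans d e (f p))
        (at (snd d (f (chart_inv c (snd c (chart_inv ?c (snd ?c p)))))))"
        using B.dtrans_has_derivative[OF d e] A.chart_inv_left[OF charts_atD[OF c0]] A.chart_inv_left[OF charts_atD[OF c]]
        by simp
    qed
    moreover have "\<forall>\<^sub>F y in nhds (snd ?c p). snd e (chart_inv d (snd d (f (chart_inv c (snd c (chart_inv ?c y))))))
        = (snd e \<circ> f \<circ> chart_inv ?c) y"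
      using A.eventually_overlap[OF c0 c] eventually_compose_filterlim[OF ev A.tendsto_transition[OF c0 c]]
    proof eventually_elim
      case (elim y)
      note y = A.overlapD[OF charts_atD(1)[OF c0] elim(1)]
      have "chart_inv c (snd c (chart_inv ?c y)) = chart_inv ?c y"
        by (rule A.chart_inv_left[OF charts_atD(1)[OF c] y(3)])
      with elim(2) show ?case by (simp add: B.chart_inv_left[OF charts_atD(1)[OF d]])
    qed
    ultimately have "((snd e \<circ> f \<circ> chart_inv ?c) has_derivative (\<lambda>h. dtrans d e (f p) (D (dtrans ?c c p h)))) (at (snd ?c p))"
      by (rule has_derivative_eventually_eq)
    from fun_cong[OF frechet_derivative_at[OF this]] show ?thesis
      using tangent_space_trans[OF v c0 c] by simp
  qed
  then show ?thesis
    by (auto simp: tmap_def tvec_of_def Let_def tangent_space_fst[OF v])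
qed

section \<open>Smooth structures on the tangent bundle and on the frame bundle\<close>

section \<open>The atlases of the tangent bundle and the frame bundle\<close>

definition tchart :: "('a, 'e::euclidean_space) atlas \<Rightarrow> ('a, 'e) chart \<Rightarrow> (('a, 'e) tvec, 'e \<times> 'e) chart" where
  "tchart A c = ({v \<in> tangent_bundle A. fst v \<in> fst c}, \<lambda>v. (snd c (fst v), snd v c))"

lemma tangent_atlas_eq: "tangent_atlas A = tchart A ` A"
  by (simp add: tangent_atlas_def tchart_def)

lemma tangent_bundleI: "v \<in> tangent_space A p \<Longrightarrow> p \<in> mcarrier A \<Longrightarrow> v \<in> tangent_bundle A"
  by (auto simp: tangent_bundle_def)

lemma tangent_bundleD: "v \<in> tangent_bundle A \<Longrightarrow> v \<in> tangent_space A (fst v) \<and> fst v \<in> mcarrier A"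
proof -
  assume "v \<in> tangent_bundle A"
  then obtain p where p: "p \<in> mcarrier A" "v \<in> tangent_space A p" by (auto simp: tangent_bundle_def)
  with tangent_space_fst[OF p(2)] show ?thesis by simp
qed

lemma tchart_at: "v \<in> tangent_space A p \<Longrightarrow> c \<in> charts_at A p \<Longrightarrow> tchart A c \<in> charts_at (tangent_atlas A) v"
proof -
  assume v: "v \<in> tangent_space A p" and c: "c \<in> charts_at A p"
  have "v \<in> tangent_bundle A" by (rule tangent_bundleI[OF v charts_at_mcarrier[OF c]])
  then show ?thesis
    using charts_atD[OF c] tangent_space_fst[OF v] by (simp add: charts_at_def tangent_atlas_eq tchart_def)
qed

lemma mcarrier_tangent_atlas: "mcarrier (tangent_atlas A) = tangent_bundle A"
proof
  show "mcarrier (tangent_atlas A) \<subseteq> tangent_bundle A"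
    by (auto simp: mcarrier_def tangent_atlas_eq tchart_def)
  show "tangent_bundle A \<subseteq> mcarrier (tangent_atlas A)"
  proof
    fix v assume "v \<in> tangent_bundle A"
    then have "v \<in> tangent_space A (fst v)" "fst v \<in> mcarrier A" using tangent_bundleD by blast+
    from charts_at_mcarrier[OF tchart_at[OF this(1) chart_at_in[OF this(2)]]]
    show "v \<in> mcarrier (tangent_atlas A)" .
  qed
qed

context atlas
begin

text \<open>Every coordinate vector is realised by \<open>tvec_of\<close>, so the chart covers full
  fibres; openness of its image follows.\<close>

lemma tchart_image:
  assumes "c \<in> A" "d \<in> A"
  shows "snd (tchart A c) ` (fst (tchart A c) \<inter> fst (tchart A d)) = (snd c ` (fst c \<inter> fst d)) \<times> UNIV"
proof (intro equalityI subsetI)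
  fix z assume "z \<in> snd (tchart A c) ` (fst (tchart A c) \<inter> fst (tchart A d))"
  then show "z \<in> (snd c ` (fst c \<inter> fst d)) \<times> UNIV" by (auto simp: tchart_def)
next
  fix z assume "z \<in> (snd c ` (fst c \<inter> fst d)) \<times> (UNIV :: 'e set)"
  then obtain p where p: "p \<in> fst c" "p \<in> fst d" "fst z = snd c p" by (auto simp: mem_Times_iff)
  have c: "c \<in> charts_at A p" using assms p by (simp add: charts_at_def)
  let ?v = "tvec_of A c p (snd z)"
  have "?v \<in> tangent_bundle A" by (rule tangent_bundleI[OF tvec_of_in[OF c] charts_at_mcarrier[OF c]])
  moreover have "z = snd (tchart A c) ?v" using p by (simp add: tchart_def tvec_of_same[OF c] prod_eq_iff)
  moreover have "?v \<in> fst (tchart A c) \<inter> fst (tchart A d)"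
    using p calculation(1) by (simp add: tchart_def)
  ultimately show "z \<in> snd (tchart A c) ` (fst (tchart A c) \<inter> fst (tchart A d))"
    by blast
qed

lemma inj_on_tchart: "c \<in> A \<Longrightarrow> inj_on (snd (tchart A c)) (fst (tchart A c))"
proof (rule inj_onI)
  fix v w assume c: "c \<in> A" and vw: "v \<in> fst (tchart A c)" "w \<in> fst (tchart A c)" "snd (tchart A c) v = snd (tchart A c) w"
  have m: "v \<in> tangent_bundle A" "fst v \<in> fst c" "w \<in> tangent_bundle A" "fst w \<in> fst c"
    using vw(1,2) by (simp_all add: tchart_def)
  have eq: "snd c (fst v) = snd c (fst w)" "snd v c = snd w c"
    using vw(3) by (simp_all add: tchart_def)
  have "fst v = chart_inv c (snd c (fst v))" by (rule chart_inv_left[OF c m(2), symmetric])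
  also have "\<dots> = fst w" unfolding eq(1) by (rule chart_inv_left[OF c m(4)])
  finally have fst: "fst w = fst v" by (rule sym)
  have "w \<in> tangent_space A (fst v)"
    using conjunct1[OF tangent_bundleD[OF m(3)]] unfolding fst .
  from tangent_eqI[OF conjunct1[OF tangent_bundleD[OF m(1)]] this charts_atI[OF c m(2)] eq(2)]
  show "v = w" .
qed

lemma chart_inv_tchart:
  assumes "c \<in> A" "y \<in> snd c ` fst c"
  shows "chart_inv (tchart A c) (y, \<eta>) = tvec_of A c (chart_inv c y) \<eta>"
proof -
  let ?v = "tvec_of A c (chart_inv c y) \<eta>"
  have c: "c \<in> charts_at A (chart_inv c y)" using assms chart_inv_right by (simp add: charts_at_def)
  have "snd (tchart A c) ?v = (y, \<eta>)"
    by (simp add: tchart_def tvec_of_same[OF c] chart_inv_right[OF assms(2)])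
  moreover have "?v \<in> fst (tchart A c)"
    using tangent_bundleI[OF tvec_of_in[OF c] charts_at_mcarrier[OF c]] chart_inv_right[OF assms(2)]
    by (simp add: tchart_def)
  ultimately show ?thesis
    unfolding chart_inv_def using inv_into_f_f[OF inj_on_tchart[OF assms(1)]] by metis
qed

lemma dtrans_eq_frechet:
  "y \<in> snd c ` fst c \<Longrightarrow> dtrans c d (chart_inv c y) = frechet_derivative (\<lambda>y. snd d (chart_inv c y)) (at y)"
  by (simp add: dtrans_def chart_inv_right comp_def)

text \<open>The fibre part of the coordinate changes in both bundles, and the coordinate expression
  in \<open>d\<close> of a field given in \<open>c\<close>.\<close>

lemma smooth_dtrans_apply:
  fixes g h :: "'f::euclidean_space \<Rightarrow> 'e"
  assumes "c \<in> A" "d \<in> A" "open S" "smooth_on S g" "smooth_on S h" "g ` S \<subseteq> snd c ` (fst c \<inter> fst d)"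
  shows "smooth_on S (\<lambda>z. dtrans c d (chart_inv c (g z)) (h z))"
proof (rule smooth_on_apply_linear[OF assms(3) _ _ assms(5)])
  have y: "g z \<in> snd c ` (fst c \<inter> fst d)" if "z \<in> S" for z using that assms(6) by blast
  show "linear (dtrans c d (chart_inv c (g z)))" if "z \<in> S" for z
    using overlapD[OF assms(1) y[OF that]] assms(1,2) by (intro dtrans_linear) (auto simp: charts_at_def)
  show "smooth_on S (\<lambda>z. dtrans c d (chart_inv c (g z)) b)" for b
  proof (rule smooth_on_cong[OF assms(3)])
    show "smooth_on S (\<lambda>z. frechet_derivative (\<lambda>y. snd d (chart_inv c y)) (at (g z)) b)"
      by (rule smooth_on_compose[OF assms(3) open_overlap[OF assms(1,2)] assms(6,4)
        smooth_on_frechet_derivative[OF smooth_transition[OF assms(1,2)]]])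
    show "frechet_derivative (\<lambda>y. snd d (chart_inv c y)) (at (g z)) b = dtrans c d (chart_inv c (g z)) b"
      if "z \<in> S" for z
    proof -
      have "g z \<in> snd c ` fst c" using y[OF that] by blast
      then show ?thesis by (simp only: dtrans_eq_frechet)
    qed
  qed
qed

text \<open>If f is a coordinate change of the base, the one of the bundle sends (y, w) to (f y,
  Df(y) w).\<close>

lemma smooth_atlas_tangent: "smooth_atlas (tangent_atlas A)"
  unfolding smooth_atlas_def
proof (intro conjI ballI)
  fix e assume "e \<in> tangent_atlas A"
  then obtain c where c: "c \<in> A" "e = tchart A c" by (auto simp: tangent_atlas_eq)
  show "inj_on (snd e) (fst e)" using inj_on_tchart[OF c(1)] c(2) by simp
  show "open (snd e ` fst e)"
    using tchart_image[OF c(1,1)] open_chart[OF c(1)] c(2) by (simp add: open_Times)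
  fix e' assume "e' \<in> tangent_atlas A"
  then obtain d where d: "d \<in> A" "e' = tchart A d" by (auto simp: tangent_atlas_eq)
  let ?S = "snd c ` (fst c \<inter> fst d)"
  have im: "snd e ` (fst e \<inter> fst e') = ?S \<times> UNIV"
    using tchart_image[OF c(1) d(1)] c(2) d(2) by simp
  have op: "open (?S \<times> (UNIV :: 'e set))"
    by (intro open_Times open_overlap c(1) d(1) open_UNIV)
  then show "open (snd e ` (fst e \<inter> fst e'))" using im by simp
  have sm: "smooth_on (?S \<times> UNIV) (\<lambda>z. (snd d (chart_inv c (fst z)), dtrans c d (chart_inv c (fst z)) (snd z)))"
  proof (rule smooth_on_Pair[OF op])
    have fst: "smooth_on (?S \<times> (UNIV :: 'e set)) fst" by (rule smooth_on_linear[OF bounded_linear_fst op])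
    show "smooth_on (?S \<times> (UNIV :: 'e set)) (\<lambda>z. snd d (chart_inv c (fst z)))"
      by (rule smooth_on_compose[OF op open_overlap[OF c(1) d(1)] _ fst smooth_transition[OF c(1) d(1)]]) auto
    show "smooth_on (?S \<times> UNIV) (\<lambda>z. dtrans c d (chart_inv c (fst z)) (snd z))"
      by (rule smooth_dtrans_apply[OF c(1) d(1) op fst smooth_on_linear[OF bounded_linear_snd op]]) auto
  qed
  show "smooth_on (snd e ` (fst e \<inter> fst e')) (snd e' \<circ> chart_inv e)"
    unfolding im
  proof (rule smooth_on_cong[OF op _ sm])
    fix z assume z: "z \<in> ?S \<times> (UNIV :: 'e set)"
    then have y: "fst z \<in> ?S" by auto
    then have y': "fst z \<in> snd c ` fst c" by blast
    have ch: "c \<in> charts_at A (chart_inv c (fst z))" "d \<in> charts_at A (chart_inv c (fst z))"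
      using overlapD[OF c(1) y] c(1) d(1) by (auto simp: charts_at_def)
    have "chart_inv e z = tvec_of A c (chart_inv c (fst z)) (snd z)"
      using chart_inv_tchart[OF c(1) y', of "snd z"] c(2) by simp
    then show "(snd d (chart_inv c (fst z)), dtrans c d (chart_inv c (fst z)) (snd z)) = (snd e' \<circ> chart_inv e) z"
      by (simp add: d(2) tchart_def tvec_of_chart[OF ch])
  qed
qed

lemma vector_fieldD_tangent: "X \<in> vector_fields A \<Longrightarrow> p \<in> mcarrier A \<Longrightarrow> X p \<in> tangent_space A p"
  by (simp add: vector_fields_def)

lemma vector_field_preimage:
  assumes "\<And>p. p \<in> mcarrier A \<Longrightarrow> X p \<in> tangent_space A p" "c \<in> A" "d \<in> A"
  shows "fst c \<inter> X -` fst (tchart A d) = fst c \<inter> fst d"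
proof (rule set_eqI)
  fix p
  show "p \<in> fst c \<inter> X -` fst (tchart A d) \<longleftrightarrow> p \<in> fst c \<inter> fst d"
  proof (cases "p \<in> fst c")
    case True
    then have p: "p \<in> mcarrier A" using assms(2) by (auto simp: mcarrier_def)
    have "X p \<in> tangent_bundle A" "fst (X p) = p"
      by (rule tangent_bundleI[OF assms(1)[OF p] p], rule tangent_space_fst[OF assms(1)[OF p]])
    then show ?thesis by (simp add: tchart_def)
  qed simp
qed

lemma vector_fieldD_smooth:
  assumes "X \<in> vector_fields A" "c \<in> A"
  shows "smooth_on (snd c ` fst c) (\<lambda>y. snd (X (chart_inv c y)) c)"
proof -
  have "smooth_map A (tangent_atlas A) X" using assms(1) by (simp add: vector_fields_def)
  then have "smooth_on (snd c ` (fst c \<inter> X -` fst (tchart A c))) (snd (tchart A c) \<circ> X \<circ> chart_inv c)"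
    using assms(2) by (simp add: smooth_map_def tangent_atlas_eq)
  then have "smooth_on (snd c ` fst c) (snd (tchart A c) \<circ> X \<circ> chart_inv c)"
    using vector_field_preimage[OF vector_fieldD_tangent[OF assms(1)] assms(2,2)] by simp
  from smooth_on_snd[OF open_chart[OF assms(2)] this] show ?thesis
    by (simp add: tchart_def comp_def)
qed

text \<open>\<open>smooth_map\<close> asks for all pairs of a base chart and a bundle chart. The
  matching pairs suffice: for \<open>c\<close> and \<open>d\<close>, pass from \<open>c\<close> to
  \<open>d\<close> first and use the coordinates in \<open>d\<close>.\<close>

lemma vector_fieldI:
  assumes ext: "X \<in> extensional (mcarrier A)" and tan: "\<And>p. p \<in> mcarrier A \<Longrightarrow> X p \<in> tangent_space A p"
    and sm: "\<And>c. c \<in> A \<Longrightarrow> smooth_on (snd c ` fst c) (\<lambda>y. snd (X (chart_inv c y)) c)"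
  shows "X \<in> vector_fields A"
proof -
  have "smooth_map A (tangent_atlas A) X"
    unfolding smooth_map_def
  proof (intro conjI ballI)
    show "X ` mcarrier A \<subseteq> mcarrier (tangent_atlas A)"
      unfolding mcarrier_tangent_atlas using tangent_bundleI[OF tan] by blast
    fix c e assume c: "c \<in> A" and "e \<in> tangent_atlas A"
    then obtain d where d: "d \<in> A" "e = tchart A d" by (auto simp: tangent_atlas_eq)
    have pre: "fst c \<inter> X -` fst e = fst c \<inter> fst d"
      unfolding d(2) by (rule vector_field_preimage[OF tan c d(1)])
    show "open (snd c ` (fst c \<inter> X -` fst e))"
      unfolding pre by (rule open_overlap[OF c d(1)])
    note op = open_overlap[OF c d(1)]
    have im: "(\<lambda>y. snd d (chart_inv c y)) ` snd c ` (fst c \<inter> fst d) \<subseteq> snd d ` fst d"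
      using overlapD(3)[OF c] by blast
    have 1: "smooth_on (snd c ` (fst c \<inter> fst d)) (\<lambda>y. snd (X (chart_inv d (snd d (chart_inv c y)))) d)"
      by (rule smooth_on_compose[OF op open_chart[OF d(1)] im smooth_transition[OF c d(1)] sm[OF d(1)]])
    show "smooth_on (snd c ` (fst c \<inter> X -` fst e)) (snd e \<circ> X \<circ> chart_inv c)"
      unfolding pre
    proof (rule smooth_on_cong[OF op _ smooth_on_Pair[OF op smooth_transition[OF c d(1)] 1]])
      fix y assume y: "y \<in> snd c ` (fst c \<inter> fst d)"
      note o = overlapD[OF c y]
      have "chart_inv c y \<in> mcarrier A" using o(2) c by (auto simp: mcarrier_def)
      then have "fst (X (chart_inv c y)) = chart_inv c y" using tangent_space_fst[OF tan] by blast
      then show "(snd d (chart_inv c y), snd (X (chart_inv d (snd d (chart_inv c y)))) d) = (snd e \<circ> X \<circ> chart_inv c) y"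
        using chart_inv_left[OF d(1) o(3)] by (simp add: d(2) tchart_def)
    qed
  qed
  then show ?thesis using ext tan by (simp add: vector_fields_def)
qed

end

section \<open>Invertible matrices and frames in coordinates\<close>

lemma smooth_on_det:
  fixes f :: "'e::real_normed_vector \<Rightarrow> real^'n^'n"
  assumes "open S" "\<And>i j. smooth_on S (\<lambda>x. f x $ i $ j)"
  shows "smooth_on S (\<lambda>x. det (f x))"
  unfolding det_def
  by (intro smooth_on_sum[OF assms(1)] smooth_on_mult[OF assms(1)] smooth_on_const smooth_on_prod[OF assms(1)] assms(2))

lemma open_invertible: "open {G :: real^'n^'n. invertible G}"
proof -
  have "smooth_on UNIV (\<lambda>G :: real^'n^'n. det G)"
    by (intro smooth_on_det smooth_on_vec_nth open_UNIV smooth_on_id)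
  then have "open {G :: real^'n^'n. det G \<noteq> 0}"
    by (intro open_Collect_neq smooth_on_continuous_on continuous_on_const)
  then show ?thesis by (simp add: invertible_det_nz)
qed

lemma matrix_inv_works:
  fixes G :: "real^'n^'n"
  assumes "invertible G"
  shows "matrix_inv G *v (G *v x) = x" "G *v (matrix_inv G *v x) = x"
proof -
  have "G ** matrix_inv G = mat 1 \<and> matrix_inv G ** G = mat 1"
    unfolding matrix_inv_def by (rule someI_ex) (use assms in \<open>simp add: invertible_def\<close>)
  then show "matrix_inv G *v (G *v x) = x" "G *v (matrix_inv G *v x) = x"
    by (simp_all add: matrix_vector_mul_assoc)
qed

lemma invertible_injI: "invertible G" if "\<And>x. G *v x = 0 \<Longrightarrow> x = 0" for G :: "real^'n^'n"
  unfolding invertible_left_inverse matrix_left_invertible_ker using that by blast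

definition fmat :: "('a, real^'n::finite) chart \<Rightarrow> ('a, 'n) frame \<Rightarrow> real^'n^'n" where
  "fmat c u = matrix (\<lambda>\<xi>. snd (u \<xi>) c)"

definition frame_of ::
    "('a, real^'n::finite) atlas \<Rightarrow> ('a, real^'n) chart \<Rightarrow> 'a \<Rightarrow> real^'n^'n \<Rightarrow> ('a, 'n) frame" where
  "frame_of M c p G = (\<lambda>\<xi>. tvec_of M c p (G *v \<xi>))"

definition fchart ::
    "('a, real^'n::finite) atlas \<Rightarrow> ('a, real^'n) chart \<Rightarrow> (('a, 'n) frame, (real^'n) \<times> (real^'n^'n)) chart" where
  "fchart M c = ({u \<in> frames M. frame_proj u \<in> fst c}, \<lambda>u. (snd c (frame_proj u), fmat c u))"

lemma frame_atlas_eq: "frame_atlas M = fchart M ` M"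
  by (simp add: frame_atlas_def fchart_def fmat_def)

lemma frames_at_tangent: "u \<in> frames_at M p \<Longrightarrow> u \<xi> \<in> tangent_space M p"
  unfolding frames_at_def using bij_betwE by blast

lemma frames_at_proj: "u \<in> frames_at M p \<Longrightarrow> frame_proj u = p"
  unfolding frame_proj_def by (rule tangent_space_fst[OF frames_at_tangent])

lemma frames_at_frames: "u \<in> frames_at M p \<Longrightarrow> p \<in> mcarrier M \<Longrightarrow> u \<in> frames M"
  unfolding frames_def by blast

lemma framesD:
  assumes "u \<in> frames M"
  shows "u \<in> frames_at M (frame_proj u)" "frame_proj u \<in> mcarrier M"
  using assms frames_at_proj unfolding frames_def by fastforce+

lemma fmat_works:
  assumes "u \<in> frames_at M p"
  shows "fmat c u *v \<xi> = snd (u \<xi>) c"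
proof -
  have add: "u (\<xi> + \<eta>) = tadd (u \<xi>) (u \<eta>)" and scale: "u (r *\<^sub>R \<xi>) = tscale r (u \<xi>)" for \<xi> \<eta> r
    using assms unfolding frames_at_def by blast+
  have "linear (\<lambda>\<xi>. snd (u \<xi>) c)"
    by (rule linearI) (simp_all add: add scale tadd_def tscale_def)
  then show ?thesis unfolding fmat_def by (rule fun_cong[OF matrix_vector_mul(2)])
qed

lemma frames_at_eqI:
  assumes "u \<in> frames_at M p" "w \<in> frames_at M p" "c \<in> charts_at M p" "fmat c u = fmat c w"
  shows "u = w"
proof
  fix \<xi>
  have "snd (u \<xi>) c = snd (w \<xi>) c"
    using fmat_works[OF assms(1), of c \<xi>] fmat_works[OF assms(2), of c \<xi>] assms(4) by simp
  then show "u \<xi> = w \<xi>"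
    by (rule tangent_eqI[OF frames_at_tangent[OF assms(1)] frames_at_tangent[OF assms(2)] assms(3)])
qed

lemma fchart_at: "u \<in> frames_at M p \<Longrightarrow> c \<in> charts_at M p \<Longrightarrow> fchart M c \<in> charts_at (frame_atlas M) u"
proof -
  assume u: "u \<in> frames_at M p" and c: "c \<in> charts_at M p"
  have "u \<in> frames M" by (rule frames_at_frames[OF u charts_at_mcarrier[OF c]])
  then show ?thesis
    using charts_atD[OF c] frames_at_proj[OF u] by (simp add: charts_at_def frame_atlas_eq fchart_def)
qed

lemma mcarrier_frame_atlas: "mcarrier (frame_atlas M) = frames M"
proof
  show "mcarrier (frame_atlas M) \<subseteq> frames M"
    by (auto simp: mcarrier_def frame_atlas_eq fchart_def)
  show "frames M \<subseteq> mcarrier (frame_atlas M)"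
  proof
    fix u assume u: "u \<in> frames M"
    show "u \<in> mcarrier (frame_atlas M)"
      by (rule charts_at_mcarrier[OF fchart_at[OF framesD(1)[OF u] chart_at_in[OF framesD(2)[OF u]]]])
  qed
qed

locale euclidean_atlas = atlas M for M :: "('a, real^'n::finite) atlas"
begin

text \<open>A frame is injective, and a square matrix with trivial kernel is invertible.\<close>

lemma fmat_invertible:
  assumes "u \<in> frames_at M p" "c \<in> charts_at M p"
  shows "invertible (fmat c u)"
proof (rule invertible_injI)
  fix \<xi> assume "fmat c u *v \<xi> = 0"
  moreover have "fmat c u *v 0 = 0" by simp
  ultimately have "snd (u \<xi>) c = snd (u 0) c" unfolding fmat_works[OF assms(1)] by simp
  then have "u \<xi> = u 0"
    by (rule tangent_eqI[OF frames_at_tangent[OF assms(1)] frames_at_tangent[OF assms(1)] assms(2)])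
  moreover have "inj u" using assms(1) unfolding frames_at_def bij_betw_def by blast
  ultimately show "\<xi> = 0" by (simp add: inj_eq)
qed

lemma frame_of_in:
  assumes "c \<in> charts_at M p" "invertible G"
  shows "frame_of M c p G \<in> frames_at M p"
  unfolding frames_at_def
proof (intro CollectI conjI allI)
  have c: "snd (frame_of M c p G \<xi>) c = G *v \<xi>" for \<xi>
    by (simp add: frame_of_def tvec_of_same[OF assms(1)])
  have tan: "frame_of M c p G \<xi> \<in> tangent_space M p" for \<xi>
    unfolding frame_of_def by (rule tvec_of_in[OF assms(1)])
  show "bij_betw (frame_of M c p G) UNIV (tangent_space M p)"
  proof (rule bij_betw_byWitness[where f' = "\<lambda>v. matrix_inv G *v snd v c"])
    show "\<forall>\<xi>\<in>UNIV. matrix_inv G *v snd (frame_of M c p G \<xi>) c = \<xi>"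
      by (simp add: c matrix_inv_works[OF assms(2)])
    show "\<forall>v\<in>tangent_space M p. frame_of M c p G (matrix_inv G *v snd v c) = v"
      by (simp add: frame_of_def matrix_inv_works[OF assms(2)] tvec_of_snd[OF _ assms(1)])
  qed (use tan in auto)
  show "frame_of M c p G (\<xi> + \<eta>) = tadd (frame_of M c p G \<xi>) (frame_of M c p G \<eta>)" for \<xi> \<eta>
    by (rule tangent_eqI[OF tan tangent_space_tadd[OF tan tan] assms(1)])
      (simp add: c tadd_def matrix_vector_right_distrib)
  show "frame_of M c p G (r *\<^sub>R \<xi>) = tscale r (frame_of M c p G \<xi>)" for r \<xi>
    by (rule tangent_eqI[OF tan tangent_space_tscale[OF tan] assms(1)])
      (simp add: c tscale_def matrix_vector_mult_scaleR)
qed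

lemma fmat_frame_of:
  assumes "c \<in> charts_at M p" "d \<in> charts_at M p"
  shows "fmat d (frame_of M c p G) = matrix (\<lambda>\<xi>. dtrans c d p (G *v \<xi>))"
  unfolding fmat_def frame_of_def tvec_of_chart[OF assms] ..

lemma fmat_frame_of_same: "c \<in> charts_at M p \<Longrightarrow> fmat c (frame_of M c p G) = G"
  by (simp add: fmat_frame_of dtrans_self)

lemma frame_of_fmat: "u \<in> frames_at M p \<Longrightarrow> c \<in> charts_at M p \<Longrightarrow> frame_of M c p (fmat c u) = u"
  by (rule frames_at_eqI[OF frame_of_in[OF _ fmat_invertible] _ _ fmat_frame_of_same])

lemma inv_frame:
  assumes "u \<in> frames_at M p" "w \<in> tangent_space M p" "c \<in> charts_at M p"
  shows "inv u w = matrix_inv (fmat c u) *v snd w c" "u (inv u w) = w"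
proof -
  have "bij_betw u UNIV (tangent_space M p)" using assms(1) unfolding frames_at_def by blast
  then show eq: "u (inv u w) = w" using assms(2) by (simp add: bij_betw_inv_into_right)
  have "fmat c u *v inv u w = snd w c" unfolding fmat_works[OF assms(1)] eq ..
  then show "inv u w = matrix_inv (fmat c u) *v snd w c"
    using matrix_inv_works(1)[OF fmat_invertible[OF assms(1,3)]] by metis
qed

lemma fchart_image:
  assumes "c \<in> M" "d \<in> M"
  shows "snd (fchart M c) ` (fst (fchart M c) \<inter> fst (fchart M d)) = (snd c ` (fst c \<inter> fst d)) \<times> {G. invertible G}"
proof (intro equalityI subsetI)
  fix z assume "z \<in> snd (fchart M c) ` (fst (fchart M c) \<inter> fst (fchart M d))"
  then obtain u where u: "u \<in> frames M" "frame_proj u \<in> fst c" "frame_proj u \<in> fst d"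
    "z = (snd c (frame_proj u), fmat c u)"
    by (auto simp: fchart_def)
  have "invertible (fmat c u)"
    by (rule fmat_invertible[OF framesD(1)[OF u(1)] charts_atI[OF assms(1) u(2)]])
  then show "z \<in> (snd c ` (fst c \<inter> fst d)) \<times> {G. invertible G}"
    using u by simp
next
  fix z assume "z \<in> (snd c ` (fst c \<inter> fst d)) \<times> {G :: real^'n^'n. invertible G}"
  then obtain p where p: "p \<in> fst c" "p \<in> fst d" "fst z = snd c p" and G: "invertible (snd z)"
    by (auto simp: mem_Times_iff)
  have c: "c \<in> charts_at M p" using assms p by (simp add: charts_at_def)
  let ?u = "frame_of M c p (snd z)"
  have u: "?u \<in> frames_at M p" by (rule frame_of_in[OF c G])
  have "?u \<in> fst (fchart M c) \<inter> fst (fchart M d)"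
    using frames_at_frames[OF u charts_at_mcarrier[OF c]] frames_at_proj[OF u] p by (simp add: fchart_def)
  moreover have "z = snd (fchart M c) ?u"
    using p by (simp add: fchart_def fmat_frame_of_same[OF c] frames_at_proj[OF u] prod_eq_iff)
  ultimately show "z \<in> snd (fchart M c) ` (fst (fchart M c) \<inter> fst (fchart M d))" by blast
qed

lemma fchart_image_self: "c \<in> M \<Longrightarrow> snd (fchart M c) ` fst (fchart M c) = (snd c ` fst c) \<times> {G. invertible G}"
  using fchart_image[of c c] by simp

lemma open_fchart_image:
  assumes "c \<in> M" "d \<in> M"
  shows "open ((snd c ` (fst c \<inter> fst d)) \<times> {G :: real^'n^'n. invertible G})"
  by (intro open_Times open_overlap assms open_invertible)

lemma inj_on_fchart: "c \<in> M \<Longrightarrow> inj_on (snd (fchart M c)) (fst (fchart M c))"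
proof (rule inj_onI)
  fix u w assume c: "c \<in> M" and uw: "u \<in> fst (fchart M c)" "w \<in> fst (fchart M c)" "snd (fchart M c) u = snd (fchart M c) w"
  have m: "u \<in> frames M" "frame_proj u \<in> fst c" "w \<in> frames M" "frame_proj w \<in> fst c"
    using uw(1,2) by (simp_all add: fchart_def)
  have eq: "snd c (frame_proj u) = snd c (frame_proj w)" "fmat c u = fmat c w"
    using uw(3) by (simp_all add: fchart_def)
  have "frame_proj u = chart_inv c (snd c (frame_proj u))" by (rule chart_inv_left[OF c m(2), symmetric])
  also have "\<dots> = frame_proj w" unfolding eq(1) by (rule chart_inv_left[OF c m(4)])
  finally have proj: "frame_proj w = frame_proj u" by (rule sym)
  have "w \<in> frames_at M (frame_proj u)"
    using framesD(1)[OF m(3)] unfolding proj .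
  from frames_at_eqI[OF framesD(1)[OF m(1)] this charts_atI[OF c m(2)] eq(2)]
  show "u = w" .
qed

lemma chart_inv_fchart:
  assumes "c \<in> M" "y \<in> snd c ` fst c" "invertible G"
  shows "chart_inv (fchart M c) (y, G) = frame_of M c (chart_inv c y) G"
proof -
  let ?u = "frame_of M c (chart_inv c y) G"
  have c: "c \<in> charts_at M (chart_inv c y)" using assms chart_inv_right by (simp add: charts_at_def)
  have u: "?u \<in> frames_at M (chart_inv c y)" by (rule frame_of_in[OF c assms(3)])
  have "snd (fchart M c) ?u = (y, G)"
    by (simp add: fchart_def fmat_frame_of_same[OF c] frames_at_proj[OF u] chart_inv_right[OF assms(2)])
  moreover have "?u \<in> fst (fchart M c)"
    using frames_at_frames[OF u charts_at_mcarrier[OF c]] frames_at_proj[OF u] chart_inv_right[OF assms(2)]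
    by (simp add: fchart_def)
  ultimately show ?thesis
    unfolding chart_inv_def using inv_into_f_f[OF inj_on_fchart[OF assms(1)]] by metis
qed

text \<open>The coordinate changes send (y, G) to (f y, Df(y) G). Column by column this is the
  coordinate change of a tangent vector.\<close>

lemma smooth_atlas_frame: "smooth_atlas (frame_atlas M)"
  unfolding smooth_atlas_def
proof (intro conjI ballI)
  fix e assume "e \<in> frame_atlas M"
  then obtain c where c: "c \<in> M" "e = fchart M c" by (auto simp: frame_atlas_eq)
  show "inj_on (snd e) (fst e)" using inj_on_fchart[OF c(1)] c(2) by simp
  show "open (snd e ` fst e)"
    using open_fchart_image[OF c(1,1)] by (simp add: c(2) fchart_image_self[OF c(1)])
  fix e' assume "e' \<in> frame_atlas M"
  then obtain d where d: "d \<in> M" "e' = fchart M d" by (auto simp: frame_atlas_eq)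
  let ?S = "snd c ` (fst c \<inter> fst d)"
  let ?T = "?S \<times> {G :: real^'n^'n. invertible G}"
  have im: "snd e ` (fst e \<inter> fst e') = ?T"
    using fchart_image[OF c(1) d(1)] c(2) d(2) by simp
  have op: "open ?T" by (rule open_fchart_image[OF c(1) d(1)])
  then show "open (snd e ` (fst e \<inter> fst e'))" using im by simp
  have sm: "smooth_on ?T (\<lambda>z. (snd d (chart_inv c (fst z)), matrix (\<lambda>\<xi>. dtrans c d (chart_inv c (fst z)) (snd z *v \<xi>))))"
  proof (rule smooth_on_Pair[OF op])
    have fst: "smooth_on ?T fst" by (rule smooth_on_linear[OF bounded_linear_fst op])
    show "smooth_on ?T (\<lambda>z. snd d (chart_inv c (fst z)))"
      by (rule smooth_on_compose[OF op open_overlap[OF c(1) d(1)] _ fst smooth_transition[OF c(1) d(1)]]) auto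
    show "smooth_on ?T (\<lambda>z. matrix (\<lambda>\<xi>. dtrans c d (chart_inv c (fst z)) (snd z *v \<xi>)))"
    proof (intro smooth_on_vec[OF op])
      fix i j :: 'n
      have "smooth_on ?T (\<lambda>z. snd z *v axis j 1)"
        by (rule smooth_on_linear[OF _ op])
          (auto intro!: linear_conv_bounded_linear[THEN iffD1] linearI simp: matrix_vector_mult_add_rdistrib scaleR_matrix_vector_assoc)
      then have "smooth_on ?T (\<lambda>z. dtrans c d (chart_inv c (fst z)) (snd z *v axis j 1))"
        by (rule smooth_dtrans_apply[OF c(1) d(1) op fst]) auto
      then have "smooth_on ?T (\<lambda>z. dtrans c d (chart_inv c (fst z)) (snd z *v axis j 1) $ i)"
        by (rule smooth_on_vec_nth[OF op])
      then show "smooth_on ?T (\<lambda>z. matrix (\<lambda>\<xi>. dtrans c d (chart_inv c (fst z)) (snd z *v \<xi>)) $ i $ j)"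
        by (simp add: matrix_def)
    qed
  qed
  show "smooth_on (snd e ` (fst e \<inter> fst e')) (snd e' \<circ> chart_inv e)"
    unfolding im
  proof (rule smooth_on_cong[OF op _ sm])
    fix z assume z: "z \<in> ?T"
    then have y: "fst z \<in> ?S" and G: "invertible (snd z)" by auto
    then have y': "fst z \<in> snd c ` fst c" by blast
    have ch: "c \<in> charts_at M (chart_inv c (fst z))" "d \<in> charts_at M (chart_inv c (fst z))"
      using overlapD[OF c(1) y] c(1) d(1) by (auto simp: charts_at_def)
    have "chart_inv e z = frame_of M c (chart_inv c (fst z)) (snd z)"
      using chart_inv_fchart[OF c(1) y' G] c(2) by simp
    then show "(snd d (chart_inv c (fst z)), matrix (\<lambda>\<xi>. dtrans c d (chart_inv c (fst z)) (snd z *v \<xi>))) = (snd e' \<circ> chart_inv e) z"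
      by (simp add: d(2) fchart_def fmat_frame_of[OF ch] frames_at_proj[OF frame_of_in[OF ch(1) G]])
  qed
qed

end

lemma chart_inv_mcarrier: "c \<in> A \<Longrightarrow> y \<in> snd c ` fst c \<Longrightarrow> chart_inv c y \<in> mcarrier A"
  by (rule charts_at_mcarrier[OF charts_atI[OF _ chart_inv_right(2)]])

section \<open>Extension by zero, sums of fields and locality of tensorial operations\<close>

section \<open>Local vector fields and tensoriality\<close>

text \<open>The entry of the Hausdorff property into extension by zero: a compact set in a chart is
  closed in the whole manifold.\<close>

lemma compactin_manifold_closedin:
  assumes "Hausdorff_space X" "continuous_map (top_of_set S) X f" "compact K" "K \<subseteq> S"
  shows "closedin X (f ` K)"
  using assms by (intro compactin_imp_closedin image_compactin) (auto simp: compactin_subtopology)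

locale hausdorff_atlas = atlas A for A :: "('a, 'e::euclidean_space) atlas" +
  assumes hausdorff: "Hausdorff_space (manifold_topology A)"

context atlas
begin

text \<open>The topology is generated by pullbacks of open sets under charts; their preimages in
  another chart are open because the transition maps are continuous.\<close>

lemma continuous_chart_inv:
  assumes c: "c \<in> A"
  shows "continuous_map (top_of_set (snd c ` fst c)) (manifold_topology A) (chart_inv c)"
  unfolding manifold_topology_def
proof (rule continuous_on_generated_topo)
  fix U assume "U \<in> {fst c \<inter> snd c -` V |c V. c \<in> A \<and> open V}"
  then obtain d V where d: "d \<in> A" "open V" "U = fst d \<inter> snd d -` V" by blast
  let ?S = "snd c ` (fst c \<inter> fst d)"
  have "open (?S \<inter> (\<lambda>y. snd d (chart_inv c y)) -` V)"
    using smooth_on_continuous_on[OF smooth_transition[OF c d(1)]] open_overlap[OF c d(1)] d(2)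
    by (rule continuous_open_preimage)
  moreover have "chart_inv c -` U \<inter> snd c ` fst c = ?S \<inter> (\<lambda>y. snd d (chart_inv c y)) -` V"
    using overlapI[of _ c d] overlapD[OF c, of _ d] unfolding d(3) by auto
  ultimately show "openin (top_of_set (snd c ` fst c)) (chart_inv c -` U \<inter> topspace (top_of_set (snd c ` fst c)))"
    using open_chart[OF c] by (auto simp: openin_open_eq)
next
  have "fst c \<in> {fst c \<inter> snd c -` V |c V. c \<in> A \<and> open V}"
    using c by (intro CollectI exI[of _ c] exI[of _ UNIV]) simp
  then have "fst c \<subseteq> \<Union> {fst c \<inter> snd c -` V |c V. c \<in> A \<and> open V}" by (rule Union_upper)
  moreover have "chart_inv c ` topspace (top_of_set (snd c ` fst c)) \<subseteq> fst c"
    by (simp add: image_subset_iff chart_inv_left[OF c])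
  ultimately show "chart_inv c ` topspace (top_of_set (snd c ` fst c)) \<subseteq> \<Union> {fst c \<inter> snd c -` V |c V. c \<in> A \<and> open V}"
    by (rule order_trans[rotated])
qed

end

context hausdorff_atlas
begin

lemma open_chart_outside:
  assumes "c \<in> A" "d \<in> A" "compact K" "K \<subseteq> snd c ` fst c"
  shows "open {y \<in> snd d ` fst d. chart_inv d y \<notin> chart_inv c ` K}"
proof -
  let ?S = "snd d ` fst d"
  have cl: "closedin (manifold_topology A) (chart_inv c ` K)"
    by (rule compactin_manifold_closedin[OF hausdorff continuous_chart_inv[OF assms(1)] assms(3,4)])
  have "closedin (top_of_set ?S) {y \<in> ?S. chart_inv d y \<in> chart_inv c ` K}"
    using closedin_continuous_map_preimage[OF continuous_chart_inv[OF assms(2)] cl] by simp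
  then have "openin (top_of_set ?S) (?S - {y \<in> ?S. chart_inv d y \<in> chart_inv c ` K})"
    by (rule openin_diff[OF openin_subtopology_self])
  moreover have "?S - {y \<in> ?S. chart_inv d y \<in> chart_inv c ` K} = {y \<in> ?S. chart_inv d y \<notin> chart_inv c ` K}"
    by blast
  ultimately show ?thesis using open_chart[OF assms(2)] by (simp add: openin_open_eq)
qed

text \<open>Two open sets cover the image of \<open>d\<close>: the overlap with \<open>c\<close>,
  where \<open>g\<close> is smooth by assumption, and the complement of the compact set, where
  \<open>g\<close> is 0.\<close>

lemma smooth_on_extend:
  assumes "c \<in> A" "d \<in> A" "compact K" "K \<subseteq> snd c ` fst c"
    and sm: "smooth_on (snd d ` (fst d \<inter> fst c)) g"
    and zero: "\<And>y. y \<in> snd d ` fst d \<Longrightarrow> chart_inv d y \<notin> chart_inv c ` K \<Longrightarrow> g y = 0"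
  shows "smooth_on (snd d ` fst d) g"
proof (rule smooth_on_local[OF open_chart[OF assms(2)]])
  fix y assume y: "y \<in> snd d ` fst d"
  show "\<exists>T. open T \<and> y \<in> T \<and> smooth_on T g"
  proof (cases "chart_inv d y \<in> chart_inv c ` K")
    case True
    then obtain z where z: "z \<in> K" "chart_inv d y = chart_inv c z" by (rule imageE)
    have "chart_inv d y \<in> fst c" unfolding z(2) by (rule chart_inv_right(2)[OF subsetD[OF assms(4) z(1)]])
    then have "y \<in> snd d ` (fst d \<inter> fst c)" by (rule overlapI[OF y])
    with sm open_overlap[OF assms(2,1)] show ?thesis by (intro exI[of _ "snd d ` (fst d \<inter> fst c)"] conjI)
  next
    case False
    let ?T = "{y \<in> snd d ` fst d. chart_inv d y \<notin> chart_inv c ` K}"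
    have "smooth_on ?T g"
      by (rule smooth_on_cong[OF open_chart_outside[OF assms(1-4)] _ smooth_on_const[of _ 0]])
        (simp add: zero)
    moreover have "y \<in> ?T" using y False by simp
    ultimately show ?thesis using open_chart_outside[OF assms(1-4)] by (intro exI[of _ ?T] conjI)
  qed
qed

definition fun_ext :: "('a, 'e) chart \<Rightarrow> ('e \<Rightarrow> real) \<Rightarrow> 'a \<Rightarrow> real" where
  "fun_ext c f p = (if p \<in> fst c then f (snd c p) else 0)"

definition vf_ext :: "('a, 'e) chart \<Rightarrow> ('e \<Rightarrow> 'e) \<Rightarrow> 'a \<Rightarrow> ('a, 'e) tvec" where
  "vf_ext c \<zeta> = (\<lambda>p\<in>mcarrier A. if p \<in> fst c then tvec_of A c p (\<zeta> (snd c p)) else (p, \<lambda>_. 0))"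

lemma smooth_function_ext:
  assumes c: "c \<in> A" and K: "compact K" "K \<subseteq> snd c ` fst c"
    and f: "smooth_on (snd c ` fst c) f" "\<And>y. y \<in> snd c ` fst c \<Longrightarrow> y \<notin> K \<Longrightarrow> f y = 0"
  shows "smooth_function A (fun_ext c f)"
  unfolding smooth_function_def
proof
  fix d assume d: "d \<in> A"
  show "smooth_on (snd d ` fst d) (fun_ext c f \<circ> chart_inv d)"
  proof (rule smooth_on_extend[OF c d K])
    have "(\<lambda>y. snd c (chart_inv d y)) ` snd d ` (fst d \<inter> fst c) \<subseteq> snd c ` fst c"
      using overlapD(3)[OF d] by blast
    then have "smooth_on (snd d ` (fst d \<inter> fst c)) (\<lambda>y. f (snd c (chart_inv d y)))"
      by (rule smooth_on_compose[OF open_overlap[OF d c] open_chart[OF c] _ smooth_transition[OF d c] f(1)])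
    then show "smooth_on (snd d ` (fst d \<inter> fst c)) (fun_ext c f \<circ> chart_inv d)"
      by (rule smooth_on_cong[OF open_overlap[OF d c], rotated]) (simp add: fun_ext_def overlapD(3)[OF d])
    fix y assume y: "y \<in> snd d ` fst d" "chart_inv d y \<notin> chart_inv c ` K"
    show "(fun_ext c f \<circ> chart_inv d) y = 0"
    proof (cases "chart_inv d y \<in> fst c")
      case True
      have "snd c (chart_inv d y) \<notin> K"
        using y(2) chart_inv_left[OF c True] by (metis imageI)
      then show ?thesis using True f(2) by (simp add: fun_ext_def)
    qed (simp add: fun_ext_def)
  qed
qed

lemma vf_ext_in:
  assumes c: "c \<in> A" and K: "compact K" "K \<subseteq> snd c ` fst c"
    and f: "smooth_on (snd c ` fst c) \<zeta>" "\<And>y. y \<in> snd c ` fst c \<Longrightarrow> y \<notin> K \<Longrightarrow> \<zeta> y = 0"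
  shows "vf_ext c \<zeta> \<in> vector_fields A"
proof (rule vector_fieldI)
  show "vf_ext c \<zeta> \<in> extensional (mcarrier A)" by (simp add: vf_ext_def)
  show "vf_ext c \<zeta> p \<in> tangent_space A p" if p: "p \<in> mcarrier A" for p
  proof (cases "p \<in> fst c")
    case True
    then show ?thesis using p tvec_of_in[OF charts_atI[OF c True]] by (simp add: vf_ext_def)
  next
    case False
    let ?c = "chart_at A p"
    \<comment> \<open>Shows that the zero family belongs to the tangent space at
      \<open>p\<close>.\<close>
    have "tscale 0 (tvec_of A ?c p 0) \<in> tangent_space A p"
      by (rule tangent_space_tscale[OF tvec_of_in[OF chart_at_in[OF p]]])
    then show ?thesis using p False by (simp add: vf_ext_def tscale_def)
  qed
  fix d assume d: "d \<in> A"
  have eq: "snd (vf_ext c \<zeta> (chart_inv d y)) d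
      = (if chart_inv d y \<in> fst c then dtrans c d (chart_inv d y) (\<zeta> (snd c (chart_inv d y))) else 0)"
    if "y \<in> snd d ` fst d" for y
  proof -
    have p: "chart_inv d y \<in> fst d" by (rule chart_inv_right(2)[OF that])
    show ?thesis
      using chart_inv_mcarrier[OF d that] tvec_of_chart[OF charts_atI[OF c] charts_atI[OF d p]] by (simp add: vf_ext_def)
  qed
  show "smooth_on (snd d ` fst d) (\<lambda>y. snd (vf_ext c \<zeta> (chart_inv d y)) d)"
  proof (rule smooth_on_extend[OF c d K])
    let ?S = "snd d ` (fst d \<inter> fst c)"
    have im: "(\<lambda>y. snd c (chart_inv d y)) ` ?S \<subseteq> snd c ` (fst c \<inter> fst d)"
      using overlapD(2,3)[OF d] by blast
    have im': "(\<lambda>y. snd c (chart_inv d y)) ` ?S \<subseteq> snd c ` fst c" using im by blast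
    have "smooth_on ?S (\<lambda>y. dtrans c d (chart_inv c (snd c (chart_inv d y))) (\<zeta> (snd c (chart_inv d y))))"
      by (rule smooth_dtrans_apply[OF c d open_overlap[OF d c] smooth_transition[OF d c] _ im],
        rule smooth_on_compose[OF open_overlap[OF d c] open_chart[OF c] im' smooth_transition[OF d c] f(1)])
    then show "smooth_on ?S (\<lambda>y. snd (vf_ext c \<zeta> (chart_inv d y)) d)"
    proof (rule smooth_on_cong[OF open_overlap[OF d c], rotated])
      fix y assume y: "y \<in> ?S"
      then have "y \<in> snd d ` fst d" by blast
      then show "dtrans c d (chart_inv c (snd c (chart_inv d y))) (\<zeta> (snd c (chart_inv d y)))
          = snd (vf_ext c \<zeta> (chart_inv d y)) d"
        using eq[of y] overlapD(3)[OF d y] chart_inv_left[OF c overlapD(3)[OF d y]] by simp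
    qed
    fix y assume y: "y \<in> snd d ` fst d" "chart_inv d y \<notin> chart_inv c ` K"
    show "snd (vf_ext c \<zeta> (chart_inv d y)) d = 0"
    proof (cases "chart_inv d y \<in> fst c")
      case True
      have p: "chart_inv d y \<in> fst d" by (rule chart_inv_right(2)[OF y(1)])
      have "snd c (chart_inv d y) \<notin> K"
        using y(2) chart_inv_left[OF c True] by (metis imageI)
      then have "\<zeta> (snd c (chart_inv d y)) = 0" using True f(2) by simp
      then show ?thesis
        using linear_0[OF dtrans_linear[OF charts_atI[OF c True] charts_atI[OF d p]]] by (simp add: eq[OF y(1)])
    qed (simp add: eq[OF y(1)])
  qed
qed

lemma snd_vf_ext: "c \<in> A \<Longrightarrow> p \<in> fst c \<Longrightarrow> snd (vf_ext c \<zeta> p) c = \<zeta> (snd c p)"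
  using tvec_of_same[OF charts_atI, of c p] charts_at_mcarrier[OF charts_atI, of c A p] by (simp add: vf_ext_def)

end

context atlas
begin

lemma vf_add_in:
  assumes "X \<in> vector_fields A" "Y \<in> vector_fields A"
  shows "vf_add A X Y \<in> vector_fields A"
proof (rule vector_fieldI)
  show "vf_add A X Y \<in> extensional (mcarrier A)" by (simp add: vf_add_def)
  show "vf_add A X Y p \<in> tangent_space A p" if "p \<in> mcarrier A" for p
    using that tangent_space_tadd[OF vector_fieldD_tangent[OF assms(1) that] vector_fieldD_tangent[OF assms(2) that]]
    by (simp add: vf_add_def)
  fix c assume c: "c \<in> A"
  show "smooth_on (snd c ` fst c) (\<lambda>y. snd (vf_add A X Y (chart_inv c y)) c)"
  proof (rule smooth_on_cong[OF open_chart[OF c] _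
      smooth_on_add[OF open_chart[OF c] vector_fieldD_smooth[OF assms(1) c] vector_fieldD_smooth[OF assms(2) c]]])
    fix y assume "y \<in> snd c ` fst c"
    from chart_inv_mcarrier[OF c this] show "snd (X (chart_inv c y)) c + snd (Y (chart_inv c y)) c = snd (vf_add A X Y (chart_inv c y)) c"
      by (simp add: vf_add_def tadd_def)
  qed
qed

lemma vf_scale_in:
  assumes "smooth_function A f" "X \<in> vector_fields A"
  shows "vf_scale A f X \<in> vector_fields A"
proof (rule vector_fieldI)
  show "vf_scale A f X \<in> extensional (mcarrier A)" by (simp add: vf_scale_def)
  show "vf_scale A f X p \<in> tangent_space A p" if "p \<in> mcarrier A" for p
    using that tangent_space_tscale[OF vector_fieldD_tangent[OF assms(2) that]] by (simp add: vf_scale_def)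
  fix c assume c: "c \<in> A"
  have f: "smooth_on (snd c ` fst c) (\<lambda>y. f (chart_inv c y))"
    using assms(1) c by (simp add: smooth_function_def comp_def)
  show "smooth_on (snd c ` fst c) (\<lambda>y. snd (vf_scale A f X (chart_inv c y)) c)"
  proof (rule smooth_on_cong[OF open_chart[OF c] _
      smooth_on_scaleR[OF open_chart[OF c] f vector_fieldD_smooth[OF assms(2) c]]])
    fix y assume "y \<in> snd c ` fst c"
    from chart_inv_mcarrier[OF c this] show "f (chart_inv c y) *\<^sub>R snd (X (chart_inv c y)) c = snd (vf_scale A f X (chart_inv c y)) c"
      by (simp add: vf_scale_def tscale_def)
  qed
qed

text \<open>The base point is written explicitly, so that the empty sum is the zero field.\<close>

definition vf_sum :: "'i set \<Rightarrow> ('i \<Rightarrow> 'a \<Rightarrow> ('a, 'e) tvec) \<Rightarrow> 'a \<Rightarrow> ('a, 'e) tvec" where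
  "vf_sum I F = (\<lambda>p\<in>mcarrier A. (p, \<lambda>d. \<Sum>i\<in>I. snd (F i p) d))"

lemma vf_sum_insert:
  assumes "finite I" "i \<notin> I" "F i \<in> vector_fields A"
  shows "vf_sum (insert i I) F = vf_add A (F i) (vf_sum I F)"
proof
  fix p
  show "vf_sum (insert i I) F p = vf_add A (F i) (vf_sum I F) p"
    using tangent_space_fst[OF vector_fieldD_tangent[OF assms(3), of p]] assms(1,2)
    by (cases "p \<in> mcarrier A") (simp_all add: vf_sum_def vf_add_def tadd_def)
qed

text \<open>The zero field appears as 0 times some field, so that homogeneity yields the value 0 on
  it.\<close>

lemma vf_sum_empty:
  assumes "X \<in> vector_fields A"
  shows "vf_sum {} F = vf_scale A (\<lambda>_. 0) X"
proof
  fix p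
  show "vf_sum {} F p = vf_scale A (\<lambda>_. 0) X p"
    using tangent_space_fst[OF vector_fieldD_tangent[OF assms, of p]]
    by (cases "p \<in> mcarrier A") (simp_all add: vf_sum_def vf_scale_def tscale_def)
qed

lemma smooth_function_const: "smooth_function A (\<lambda>_. r)"
  unfolding smooth_function_def comp_def by (blast intro: smooth_on_const)

text \<open>Linearity over the smooth functions for an operation with values in the fibre at
  \<open>q\<close>. That the result depends only on the value of the field at \<open>q\<close> is
  the outcome of \<open>local_frame\<close>.\<close>

definition tensorial :: "'a \<Rightarrow> (('a \<Rightarrow> ('a, 'e) tvec) \<Rightarrow> 'v::real_vector) \<Rightarrow> bool" where
  "tensorial q T \<longleftrightarrow>
     (\<forall>X\<in>vector_fields A. \<forall>Y\<in>vector_fields A. T (vf_add A X Y) = T X + T Y) \<and>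
     (\<forall>f. \<forall>X\<in>vector_fields A. smooth_function A f \<longrightarrow> T (vf_scale A f X) = f q *\<^sub>R T X)"

lemma tensorial_vf_sum:
  assumes T: "tensorial q T" and X: "X \<in> vector_fields A"
    and "finite I" "\<And>i. i \<in> I \<Longrightarrow> F i \<in> vector_fields A"
  shows "vf_sum I F \<in> vector_fields A \<and> T (vf_sum I F) = (\<Sum>i\<in>I. T (F i))"
  using assms(3,4)
proof (induction I rule: finite_induct)
  case empty
  then show ?case
    using T X vf_scale_in[OF smooth_function_const X] smooth_function_const
    by (simp add: vf_sum_empty[OF X] tensorial_def)
next
  case (insert i I)
  then have IH: "vf_sum I F \<in> vector_fields A" "T (vf_sum I F) = (\<Sum>i\<in>I. T (F i))" and i: "F i \<in> vector_fields A"
    by auto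
  have "T (vf_add A (F i) (vf_sum I F)) = T (F i) + T (vf_sum I F)"
    using T i IH(1) unfolding tensorial_def by blast
  then show ?case
    using vf_add_in[OF i IH(1)] insert.hyps IH(2) by (simp add: vf_sum_insert[where F = F, OF _ _ i])
qed

end

context hausdorff_atlas
begin

text \<open>With a bump function \<open>\<beta>\<close>, the identity \<open>\<beta>\<^sup>2 X = \<Sum>\<^sub>b (\<beta> X\<^sup>b) (\<beta> \<partial>\<^sub>b)\<close> between global fields and functions
  expresses a tensorial operation at \<open>q\<close> by its values on the fields \<open>\<beta> \<partial>\<^sub>b\<close>.\<close>

lemma local_frame:
  assumes c: "c \<in> A" and p: "p \<in> fst c"
  obtains N e where "open N" "snd c p \<in> N" "N \<subseteq> snd c ` fst c"
    "\<And>a. e a \<in> vector_fields A" "\<And>a y. y \<in> N \<Longrightarrow> snd (e a (chart_inv c y)) c = a"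
    "\<And>q (T :: ('a \<Rightarrow> ('a, 'e) tvec) \<Rightarrow> 'v::real_vector) X. q \<in> fst c \<Longrightarrow> snd c q \<in> N \<Longrightarrow> tensorial q T
      \<Longrightarrow> X \<in> vector_fields A \<Longrightarrow> T X = (\<Sum>b\<in>Basis. (snd (X q) c \<bullet> b) *\<^sub>R T (e b))"
proof -
  let ?S = "snd c ` fst c"
  note op = open_chart[OF c]
  obtain R where R: "R > 0" "cball (snd c p) R \<subseteq> ?S"
    using bspec[OF open_contains_cball[THEN iffD1, OF op]] p by blast
  let ?K = "cball (snd c p) R"
  obtain \<beta> :: "'e \<Rightarrow> real" where \<beta>: "smooth_on UNIV \<beta>" "\<And>y. y \<in> ball (snd c p) (R / 2) \<Longrightarrow> \<beta> y = 1"
    "\<And>y. y \<notin> ?K \<Longrightarrow> \<beta> y = 0"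
    using bump_function_exists[OF R(1)] by blast
  have sm\<beta>: "smooth_on ?S \<beta>" by (rule smooth_on_mono[OF \<beta>(1)]) simp
  define N where "N = ball (snd c p) (R / 2)"
  have N: "open N" "snd c p \<in> N" using R(1) by (simp_all add: N_def)
  have "N \<subseteq> ?K" unfolding N_def using R(1) by (intro order_trans[OF ball_subset_cball] subset_cball) simp
  then have NS: "N \<subseteq> ?S" using R(2) by (rule order_trans)
  define e where "e a = vf_ext c (\<lambda>y. \<beta> y *\<^sub>R a)" for a
  have e: "e a \<in> vector_fields A" for a
    unfolding e_def
    by (rule vf_ext_in[OF c compact_cball R(2)])
      (intro smooth_on_scaleR[OF op] sm\<beta> smooth_on_const, simp add: \<beta>(3) del: mem_cball)
  have e_chart: "snd (e a q) c = \<beta> (snd c q) *\<^sub>R a" if "q \<in> fst c" for a q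
    unfolding e_def by (rule snd_vf_ext[OF c that])
  show ?thesis
  proof (rule that[OF N NS e])
    show "snd (e a (chart_inv c y)) c = a" if y: "y \<in> N" for a y
    proof -
      have "y \<in> ?S" using y NS by blast
      then show ?thesis
        using e_chart[OF chart_inv_right(2), of y a] chart_inv_right(1)[of y c] \<beta>(2)[of y] y by (simp add: N_def)
    qed
    fix q and T :: "('a \<Rightarrow> ('a, 'e) tvec) \<Rightarrow> 'v" and X
    assume q: "q \<in> fst c" "snd c q \<in> N" and T: "tensorial q T" and X: "X \<in> vector_fields A"
    define f where "f b y = \<beta> y * (snd (X (chart_inv c y)) c \<bullet> b)" for b y
    have f: "smooth_function A (fun_ext c (f b))" for b
      unfolding f_def
      by (rule smooth_function_ext[OF c compact_cball R(2)])
        (intro smooth_on_mult[OF op] sm\<beta> smooth_on_inner[OF op] vector_fieldD_smooth[OF X c] smooth_on_const,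
          simp add: \<beta>(3) del: mem_cball)
    have g: "smooth_function A (fun_ext c (\<lambda>y. \<beta> y * \<beta> y))"
      by (rule smooth_function_ext[OF c compact_cball R(2)])
        (intro smooth_on_mult[OF op] sm\<beta>, simp add: \<beta>(3) del: mem_cball)
    define F where "F b = vf_scale A (fun_ext c (f b)) (e b)" for b
    have F: "F b \<in> vector_fields A" for b
      unfolding F_def by (rule vf_scale_in[OF f e])
    have sum: "vf_sum Basis F \<in> vector_fields A" "T (vf_sum Basis F) = (\<Sum>b\<in>Basis. T (F b))"
      using tensorial_vf_sum[OF T X finite_Basis, of F] F by blast+
    have eq: "vf_scale A (fun_ext c (\<lambda>y. \<beta> y * \<beta> y)) X = vf_sum Basis F"
    proof
      fix r
      show "vf_scale A (fun_ext c (\<lambda>y. \<beta> y * \<beta> y)) X r = vf_sum Basis F r"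
      proof (cases "r \<in> mcarrier A")
        case r: True
        note l = vector_fieldD_tangent[OF vf_scale_in[OF g X] r] and rt = vector_fieldD_tangent[OF sum(1) r]
        show ?thesis
        proof (cases "r \<in> fst c")
          case True
          have "snd (vf_scale A (fun_ext c (\<lambda>y. \<beta> y * \<beta> y)) X r) c = (\<beta> (snd c r) * \<beta> (snd c r)) *\<^sub>R snd (X r) c"
            using r True by (simp add: vf_scale_def tscale_def fun_ext_def)
          also have "snd (X r) c = (\<Sum>b\<in>Basis. (snd (X r) c \<bullet> b) *\<^sub>R b)" by (simp add: euclidean_representation)
          also have "(\<beta> (snd c r) * \<beta> (snd c r)) *\<^sub>R \<dots> = (\<Sum>b\<in>Basis. f b (snd c r) *\<^sub>R (\<beta> (snd c r) *\<^sub>R b))"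
            unfolding scaleR_sum_right
            by (intro sum.cong) (simp_all add: f_def chart_inv_left[OF c True] mult_ac)
          also have "\<dots> = snd (vf_sum Basis F r) c"
            using r True by (simp add: vf_sum_def F_def vf_scale_def tscale_def fun_ext_def e_chart[OF True])
          finally show ?thesis by (rule tangent_eqI[OF l rt charts_atI[OF c True]])
        next
          case False
          \<comment> \<open>Outside the domain of \<open>c\<close> the extended functions vanish,
            and so do both sides.\<close>
          have "snd (vf_scale A (fun_ext c (\<lambda>y. \<beta> y * \<beta> y)) X r) (chart_at A r) = snd (vf_sum Basis F r) (chart_at A r)"
            using r False by (simp add: vf_sum_def F_def vf_scale_def tscale_def fun_ext_def)
          then show ?thesis by (rule tangent_eqI[OF l rt chart_at_in[OF r]])
        qed
      qed (simp add: vf_scale_def vf_sum_def)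
    qed
    have \<beta>q: "\<beta> (snd c q) = 1" using \<beta>(2) q(2) by (simp add: N_def)
    have "T X = T (vf_scale A (fun_ext c (\<lambda>y. \<beta> y * \<beta> y)) X)"
      using T X g q(1) \<beta>q by (simp add: tensorial_def fun_ext_def)
    also have "\<dots> = (\<Sum>b\<in>Basis. T (F b))" unfolding eq by (rule sum(2))
    also have "\<dots> = (\<Sum>b\<in>Basis. (snd (X q) c \<bullet> b) *\<^sub>R T (e b))"
    proof (rule sum.cong[OF refl])
      fix b
      have "T (F b) = fun_ext c (f b) q *\<^sub>R T (e b)"
        using T e f unfolding F_def tensorial_def by blast
      then show "T (F b) = (snd (X q) c \<bullet> b) *\<^sub>R T (e b)"
        using q(1) \<beta>q chart_inv_left[OF c q(1)] by (simp add: fun_ext_def f_def)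
    qed
    finally show "T X = (\<Sum>b\<in>Basis. (snd (X q) c \<bullet> b) *\<^sub>R T (e b))" .
  qed
qed

end

section \<open>Deviation of the connection from the flat derivative in a chart\<close>

section \<open>Christoffel symbols\<close>

locale connection_atlas = hausdorff_atlas A for A :: "('a, 'e::euclidean_space) atlas" +
  fixes D :: "('a \<Rightarrow> ('a, 'e) tvec) \<Rightarrow> ('a \<Rightarrow> ('a, 'e) tvec) \<Rightarrow> 'a \<Rightarrow> ('a, 'e) tvec"
  assumes connection: "affine_connection A D"
begin

lemma connection_in: "X \<in> vector_fields A \<Longrightarrow> Y \<in> vector_fields A \<Longrightarrow> D X Y \<in> vector_fields A"
  using connection unfolding affine_connection_def by blast

definition vf_deriv :: "('a, 'e) chart \<Rightarrow> ('a \<Rightarrow> ('a, 'e) tvec) \<Rightarrow> 'a \<Rightarrow> 'e \<Rightarrow> 'e" where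
  "vf_deriv c Y q = frechet_derivative (\<lambda>y. snd (Y (chart_inv c y)) c) (at (snd c q))"

definition conn_diff :: "('a, 'e) chart \<Rightarrow> ('a \<Rightarrow> ('a, 'e) tvec) \<Rightarrow> ('a \<Rightarrow> ('a, 'e) tvec) \<Rightarrow> 'a \<Rightarrow> 'e" where
  "conn_diff c X Y q = snd (D X Y q) c - vf_deriv c Y q (snd (X q) c)"

lemma vf_has_derivative:
  assumes "Y \<in> vector_fields A" "c \<in> A" "q \<in> fst c"
  shows "((\<lambda>y. snd (Y (chart_inv c y)) c) has_derivative vf_deriv c Y q) (at (snd c q))"
  unfolding vf_deriv_def
  by (rule smooth_on_has_derivative[OF vector_fieldD_smooth[OF assms(1,2)] open_chart[OF assms(2)]])
    (use assms(3) in blast)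

lemma vf_deriv_eqI:
  assumes "c \<in> A" "q \<in> fst c" "(f has_derivative F) (at (snd c q))"
    "\<And>y. y \<in> snd c ` fst c \<Longrightarrow> f y = snd (Y (chart_inv c y)) c"
  shows "vf_deriv c Y q = F"
proof -
  have "((\<lambda>y. snd (Y (chart_inv c y)) c) has_derivative F) (at (snd c q))"
    by (rule has_derivative_transform_within_open[OF assms(3) open_chart[OF assms(1)] _ assms(4)])
      (use assms(2) in blast)
  from frechet_derivative_at[OF this] show ?thesis by (simp add: vf_deriv_def)
qed

lemma tensorial_conn_diff_left:
  assumes c: "c \<in> A" and q: "q \<in> fst c" and Y: "Y \<in> vector_fields A"
  shows "tensorial q (\<lambda>X. conn_diff c X Y q)"
  unfolding tensorial_def
proof (intro conjI ballI allI impI)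
  have qm: "q \<in> mcarrier A" by (rule charts_at_mcarrier[OF charts_atI[OF c q]])
  have lin: "linear (vf_deriv c Y q)" by (rule has_derivative_linear[OF vf_has_derivative[OF Y c q]])
  fix X assume X: "X \<in> vector_fields A"
  show "conn_diff c (vf_add A X X') Y q = conn_diff c X Y q + conn_diff c X' Y q"
    if X': "X' \<in> vector_fields A" for X'
  proof -
    have "D (vf_add A X X') Y = vf_add A (D X Y) (D X' Y)"
      using connection X X' Y unfolding affine_connection_def by blast
    then show ?thesis using qm by (simp add: conn_diff_def vf_add_def tadd_def linear_add[OF lin])
  qed
  show "conn_diff c (vf_scale A f X) Y q = f q *\<^sub>R conn_diff c X Y q" if f: "smooth_function A f" for f
  proof -
    have "D (vf_scale A f X) Y = vf_scale A f (D X Y)"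
      using connection X f Y unfolding affine_connection_def by blast
    then show ?thesis
      using qm by (simp add: conn_diff_def vf_scale_def tscale_def linear_scale[OF lin] scaleR_diff_right)
  qed
qed

text \<open>Both \<open>D\<close> and the flat derivative obey the Leibniz rule, and the terms with
  the derivative of \<open>f\<close> cancel in the difference.\<close>

lemma tensorial_conn_diff_right:
  assumes c: "c \<in> A" and q: "q \<in> fst c" and X: "X \<in> vector_fields A"
  shows "tensorial q (\<lambda>Y. conn_diff c X Y q)"
  unfolding tensorial_def
proof (intro conjI ballI allI impI)
  have qm: "q \<in> mcarrier A" by (rule charts_at_mcarrier[OF charts_atI[OF c q]])
  fix Y assume Y: "Y \<in> vector_fields A"
  note dY = vf_has_derivative[OF Y c q]
  show "conn_diff c X (vf_add A Y Y') q = conn_diff c X Y q + conn_diff c X Y' q"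
    if Y': "Y' \<in> vector_fields A" for Y'
  proof -
    have "D X (vf_add A Y Y') = vf_add A (D X Y) (D X Y')"
      using connection X Y Y' unfolding affine_connection_def by blast
    moreover have "vf_deriv c (vf_add A Y Y') q = (\<lambda>h. vf_deriv c Y q h + vf_deriv c Y' q h)"
      by (rule vf_deriv_eqI[OF c q has_derivative_add[OF dY vf_has_derivative[OF Y' c q]]])
        (simp add: vf_add_def tadd_def chart_inv_mcarrier[OF c])
    ultimately show ?thesis using qm by (simp add: conn_diff_def vf_add_def tadd_def)
  qed
  show "conn_diff c X (vf_scale A f Y) q = f q *\<^sub>R conn_diff c X Y q" if f: "smooth_function A f" for f
  proof -
    define df where "df = frechet_derivative (\<lambda>y. f (chart_inv c y)) (at (snd c q))"
    have "smooth_on (snd c ` fst c) (\<lambda>y. f (chart_inv c y))"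
      using f c by (simp add: smooth_function_def comp_def)
    then have f': "((\<lambda>y. f (chart_inv c y)) has_derivative df) (at (snd c q))"
      unfolding df_def by (rule smooth_on_has_derivative[OF _ open_chart[OF c]]) (use q in blast)
    have "D X (vf_scale A f Y) = vf_add A (vf_scale A (\<lambda>p. dirder A f (X p)) Y) (vf_scale A f (D X Y))"
      using connection X Y f unfolding affine_connection_def by blast
    moreover have "dirder A f (X q) = df (snd (X q) c)"
      by (rule dirder_eq[OF vector_fieldD_tangent[OF X qm] charts_atI[OF c q] f'])
    moreover have "vf_deriv c (vf_scale A f Y) q
        = (\<lambda>h. f (chart_inv c (snd c q)) *\<^sub>R vf_deriv c Y q h + df h *\<^sub>R snd (Y (chart_inv c (snd c q))) c)"
      by (rule vf_deriv_eqI[OF c q has_derivative_scaleR[OF f' dY]])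
        (simp add: vf_scale_def tscale_def chart_inv_mcarrier[OF c])
    ultimately show ?thesis
      using qm by (simp add: conn_diff_def vf_add_def tadd_def vf_scale_def tscale_def chart_inv_left[OF c q] algebra_simps)
  qed
qed

text \<open>Christoffel symbols are evaluated on chosen global fields with the given values at
  \<open>q\<close>. Tensoriality makes the choice irrelevant, and the definition refers to no local
  frame.\<close>

definition field_with :: "('a, 'e) chart \<Rightarrow> 'a \<Rightarrow> 'e \<Rightarrow> 'a \<Rightarrow> ('a, 'e) tvec" where
  "field_with c q a = (SOME X. X \<in> vector_fields A \<and> snd (X q) c = a)"

definition christoffel :: "('a, 'e) chart \<Rightarrow> 'a \<Rightarrow> 'e \<Rightarrow> 'e \<Rightarrow> 'e" where
  "christoffel c q a b = conn_diff c (field_with c q a) (field_with c q b) q"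

text \<open>One frame \<open>e\<close> serves for all \<open>q\<close> in \<open>N\<close>. This
  makes the coefficients in the double sum smooth functions of \<open>q\<close>, as
  \<open>smooth_christoffel\<close> requires.\<close>

lemma christoffel_local:
  assumes c: "c \<in> A" and p: "p \<in> fst c"
  obtains N e where "open N" "snd c p \<in> N" "N \<subseteq> snd c ` fst c" "\<And>a. e a \<in> vector_fields A"
    "\<And>q X Y. q \<in> fst c \<Longrightarrow> snd c q \<in> N \<Longrightarrow> X \<in> vector_fields A \<Longrightarrow> Y \<in> vector_fields A \<Longrightarrow>
      conn_diff c X Y q = christoffel c q (snd (X q) c) (snd (Y q) c)"
    "\<And>q a b. q \<in> fst c \<Longrightarrow> snd c q \<in> N \<Longrightarrow>
      christoffel c q a b = (\<Sum>i\<in>Basis. \<Sum>j\<in>Basis. ((a \<bullet> i) * (b \<bullet> j)) *\<^sub>R conn_diff c (e i) (e j) q)"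
    "\<And>a. snd (e a p) c = a"
proof -
  obtain N e where N: "open N" "snd c p \<in> N" "N \<subseteq> snd c ` fst c"
    and e: "\<And>a. e a \<in> vector_fields A" "\<And>a y. y \<in> N \<Longrightarrow> snd (e a (chart_inv c y)) c = a"
    and T: "\<And>q (T :: ('a \<Rightarrow> ('a, 'e) tvec) \<Rightarrow> 'e) X. q \<in> fst c \<Longrightarrow> snd c q \<in> N \<Longrightarrow> tensorial q T
      \<Longrightarrow> X \<in> vector_fields A \<Longrightarrow> T X = (\<Sum>b\<in>Basis. (snd (X q) c \<bullet> b) *\<^sub>R T (e b))"
    by (rule local_frame[OF c p]) (rule that; assumption)
  have sum: "conn_diff c X Y q
      = (\<Sum>i\<in>Basis. \<Sum>j\<in>Basis. ((snd (X q) c \<bullet> i) * (snd (Y q) c \<bullet> j)) *\<^sub>R conn_diff c (e i) (e j) q)"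
    if q: "q \<in> fst c" "snd c q \<in> N" and X: "X \<in> vector_fields A" and Y: "Y \<in> vector_fields A" for q X Y
  proof -
    have "conn_diff c X Y q = (\<Sum>i\<in>Basis. (snd (X q) c \<bullet> i) *\<^sub>R conn_diff c (e i) Y q)"
      by (rule T[OF q tensorial_conn_diff_left[OF c q(1) Y] X])
    also have "\<dots> = (\<Sum>i\<in>Basis. (snd (X q) c \<bullet> i) *\<^sub>R
        (\<Sum>j\<in>Basis. (snd (Y q) c \<bullet> j) *\<^sub>R conn_diff c (e i) (e j) q))"
      by (intro sum.cong refl arg_cong[where f = "\<lambda>z. _ *\<^sub>R z"] T[OF q tensorial_conn_diff_right[OF c q(1) e(1)] Y])
    finally show ?thesis by (simp add: scaleR_sum_right)
  qed
  \<comment> \<open>The field \<open>e a\<close> witnesses that the choice in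
    \<open>field_with\<close> is possible.\<close>
  have fw: "field_with c q a \<in> vector_fields A \<and> snd (field_with c q a q) c = a"
    if q: "q \<in> fst c" "snd c q \<in> N" for q a
    unfolding field_with_def
    by (rule someI[of _ "e a"]) (use e(1) e(2)[OF q(2)] chart_inv_left[OF c q(1)] in simp)
  have chr: "christoffel c q a b = (\<Sum>i\<in>Basis. \<Sum>j\<in>Basis. ((a \<bullet> i) * (b \<bullet> j)) *\<^sub>R conn_diff c (e i) (e j) q)"
    if q: "q \<in> fst c" "snd c q \<in> N" for q a b
    using sum[OF q, of "field_with c q a" "field_with c q b"] fw[OF q] by (simp add: christoffel_def)
  show ?thesis
  proof (rule that[OF N e(1) _ chr])
    show "conn_diff c X Y q = christoffel c q (snd (X q) c) (snd (Y q) c)"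
      if "q \<in> fst c" "snd c q \<in> N" "X \<in> vector_fields A" "Y \<in> vector_fields A" for q X Y
      unfolding chr[OF that(1,2)] by (rule sum[OF that])
    show "snd (e a p) c = a" for a
      using e(2)[OF N(2)] chart_inv_left[OF c p] by simp
  qed
qed

lemma field_with_value:
  assumes "c \<in> A" "p \<in> fst c"
  obtains X where "X \<in> vector_fields A" "snd (X p) c = a"
  using christoffel_local[OF assms] by metis

lemma connection_chart:
  assumes "c \<in> A" "p \<in> fst c" "X \<in> vector_fields A" "Y \<in> vector_fields A"
  shows "snd (D X Y p) c = vf_deriv c Y p (snd (X p) c) + christoffel c p (snd (X p) c) (snd (Y p) c)"
proof -
  have "conn_diff c X Y p = christoffel c p (snd (X p) c) (snd (Y p) c)"
    by (rule christoffel_local[OF assms(1,2)]) (use assms in blast)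
  then show ?thesis by (simp add: conn_diff_def algebra_simps)
qed

lemma christoffel_linear:
  assumes "c \<in> A" "p \<in> fst c"
  shows "linear (\<lambda>a. christoffel c p a b)" "linear (\<lambda>b. christoffel c p a b)"
proof -
  obtain e where e: "\<And>a b. christoffel c p a b = (\<Sum>i\<in>Basis. \<Sum>j\<in>Basis. ((a \<bullet> i) * (b \<bullet> j)) *\<^sub>R conn_diff c (e i) (e j) p)"
    by (rule christoffel_local[OF assms]) (use assms(2) in blast)
  show "linear (\<lambda>a. christoffel c p a b)" "linear (\<lambda>b. christoffel c p a b)"
    unfolding e by (rule linearI; simp add: inner_add_left algebra_simps sum.distrib scaleR_sum_right)+
qed

lemma smooth_christoffel:
  assumes c: "c \<in> A"
  shows "smooth_on (snd c ` fst c) (\<lambda>y. christoffel c (chart_inv c y) a b)"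
proof (rule smooth_on_local[OF open_chart[OF c]])
  fix y assume y: "y \<in> snd c ` fst c"
  obtain N e where N: "open N" "snd c (chart_inv c y) \<in> N" "N \<subseteq> snd c ` fst c" and e: "\<And>a. e a \<in> vector_fields A"
    and chr: "\<And>q a b. q \<in> fst c \<Longrightarrow> snd c q \<in> N \<Longrightarrow>
      christoffel c q a b = (\<Sum>i\<in>Basis. \<Sum>j\<in>Basis. ((a \<bullet> i) * (b \<bullet> j)) *\<^sub>R conn_diff c (e i) (e j) q)"
    by (rule christoffel_local[OF c chart_inv_right(2)[OF y]]) (rule that; assumption)
  have cd: "smooth_on N (\<lambda>z. conn_diff c X Y (chart_inv c z))"
    if X: "X \<in> vector_fields A" and Y: "Y \<in> vector_fields A" for X Y
  proof (rule smooth_on_cong[OF N(1)])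
    have "smooth_on (snd c ` fst c) (\<lambda>z. snd (D X Y (chart_inv c z)) c -
        frechet_derivative (\<lambda>y. snd (Y (chart_inv c y)) c) (at z) (snd (X (chart_inv c z)) c))"
      by (intro smooth_on_diff[OF open_chart[OF c]] smooth_on_frechet_derivative_apply[OF open_chart[OF c]]
        vector_fieldD_smooth[OF _ c] connection_in X Y)
    then show "smooth_on N (\<lambda>z. snd (D X Y (chart_inv c z)) c -
        frechet_derivative (\<lambda>y. snd (Y (chart_inv c y)) c) (at z) (snd (X (chart_inv c z)) c))"
      by (rule smooth_on_mono[OF _ N(3)])
    fix z assume "z \<in> N"
    then have "z \<in> snd c ` fst c" using N(3) by blast
    then show "snd (D X Y (chart_inv c z)) c -
        frechet_derivative (\<lambda>y. snd (Y (chart_inv c y)) c) (at z) (snd (X (chart_inv c z)) c) = conn_diff c X Y (chart_inv c z)"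
      by (simp add: conn_diff_def vf_deriv_def chart_inv_right(1))
  qed
  have "smooth_on N (\<lambda>z. christoffel c (chart_inv c z) a b)"
  proof (rule smooth_on_cong[OF N(1)])
    show "smooth_on N (\<lambda>z. \<Sum>i\<in>Basis. \<Sum>j\<in>Basis. ((a \<bullet> i) * (b \<bullet> j)) *\<^sub>R conn_diff c (e i) (e j) (chart_inv c z))"
      by (intro smooth_on_sum[OF N(1)] smooth_on_scaleR[OF N(1)] smooth_on_const cd e)
    fix z assume z: "z \<in> N"
    then have zS: "z \<in> snd c ` fst c" using N(3) by blast
    show "(\<Sum>i\<in>Basis. \<Sum>j\<in>Basis. ((a \<bullet> i) * (b \<bullet> j)) *\<^sub>R conn_diff c (e i) (e j) (chart_inv c z))
        = christoffel c (chart_inv c z) a b"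
      by (rule chr[symmetric]) (use z zS in \<open>simp_all add: chart_inv_right\<close>)
  qed
  then show "\<exists>T. open T \<and> y \<in> T \<and> smooth_on T (\<lambda>y. christoffel c (chart_inv c y) a b)"
    using N(1,2) chart_inv_right(1)[OF y] by (intro exI[of _ N]) simp
qed

end

section \<open>Frame coordinates of the bundle maps and of horizontal vectors\<close>

section \<open>The horizontal bundle\<close>

lemma bounded_bilinear_matrix_vector: "bounded_bilinear ((*v) :: real^'n^'m \<Rightarrow> real^'n \<Rightarrow> real^'m)"
proof -
  have "bilinear ((*v) :: real^'n^'m \<Rightarrow> real^'n \<Rightarrow> real^'m)"
    unfolding bilinear_def
    by (auto intro!: linearI simp: matrix_vector_mult_add_rdistrib matrix_vector_right_distrib
        scaleR_matrix_vector_assoc matrix_vector_mult_scaleR)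
  then show ?thesis by (simp add: bilinear_conv_bounded_bilinear)
qed

lemma bounded_bilinear_matrix_mult: "bounded_bilinear ((**) :: real^'n^'n \<Rightarrow> real^'n^'n \<Rightarrow> real^'n^'n)"
proof -
  have "bilinear ((**) :: real^'n^'n \<Rightarrow> real^'n^'n \<Rightarrow> real^'n^'n)"
    unfolding bilinear_def
    by (auto intro!: linearI simp: vec_eq_iff matrix_matrix_mult_def sum.distrib algebra_simps sum_distrib_left)
  then show ?thesis by (simp add: bilinear_conv_bounded_bilinear)
qed

text \<open>Cramer's rule: component \<open>k\<close> is a quotient of determinants, with column
  \<open>k\<close> of \<open>G x\<close> replaced by \<open>f x\<close> in the numerator.\<close>

lemma smooth_on_matrix_inv:
  fixes G :: "'e::real_normed_vector \<Rightarrow> real^'n^'n" and f :: "'e \<Rightarrow> real^'n"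
  assumes "open S" "\<And>x. x \<in> S \<Longrightarrow> invertible (G x)" "smooth_on S G" "smooth_on S f"
  shows "smooth_on S (\<lambda>x. matrix_inv (G x) *v f x)"
proof (rule smooth_on_vec[OF assms(1)])
  fix k :: 'n
  let ?A = "\<lambda>x. (\<chi> i j. if j = k then f x $ i else G x $ i $ j) :: real^'n^'n"
  have G: "smooth_on S (\<lambda>x. G x $ i $ j)" for i j
    by (intro smooth_on_vec_nth assms(1,3))
  have A: "smooth_on S (\<lambda>x. ?A x $ i $ j)" for i j
    using G smooth_on_vec_nth[OF assms(1,4), of i] by (cases "j = k") simp_all
  have "Ck_on m S (\<lambda>x. inverse (det (G x)))" for m
    by (rule Ck_on_inverse[OF assms(1)])
      (use assms(2) smooth_on_det[OF assms(1) G] in \<open>simp_all add: smooth_on_def invertible_det_nz\<close>)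
  then have "smooth_on S (\<lambda>x. inverse (det (G x)))" by (simp add: smooth_on_def)
  then have sm: "smooth_on S (\<lambda>x. det (?A x) * inverse (det (G x)))"
    by (rule smooth_on_mult[OF assms(1) smooth_on_det[OF assms(1) A]])
  show "smooth_on S (\<lambda>x. (matrix_inv (G x) *v f x) $ k)"
  proof (rule smooth_on_cong[OF assms(1) _ sm])
    fix x assume x: "x \<in> S"
    have "det (?A x) = (matrix_inv (G x) *v f x) $ k * det (G x)"
      using cramer_lemma[of k "G x" "matrix_inv (G x) *v f x"]
      unfolding matrix_inv_works(2)[OF assms(2)[OF x]] .
    then show "det (?A x) * inverse (det (G x)) = (matrix_inv (G x) *v f x) $ k"
      using assms(2)[OF x] by (simp add: invertible_det_nz)
  qed
qed

locale affine_manifold = connection_atlas M D + euclidean_atlas M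
  for M :: "('a, real^'n::finite) atlas" and D
begin

sublocale TA: atlas "tangent_atlas M" by standard (rule smooth_atlas_tangent)
sublocale FA: atlas "frame_atlas M" by standard (rule smooth_atlas_frame)

abbreviation fdom :: "('a, real^'n) chart \<Rightarrow> ((real^'n) \<times> (real^'n^'n)) set" where
  "fdom c \<equiv> (snd c ` fst c) \<times> {G. invertible G}"

lemma open_fdom: "c \<in> M \<Longrightarrow> open (fdom c)"
  using open_fchart_image[of c c] by simp

lemma fchart_coords: "u \<in> frames_at M p \<Longrightarrow> snd (fchart M c) u = (snd c p, fmat c u)"
  using frames_at_proj[of u M p] by (simp add: fchart_def)

lemma fchart_in_fdom: "u \<in> frames_at M p \<Longrightarrow> c \<in> charts_at M p \<Longrightarrow> (snd c p, fmat c u) \<in> fdom c"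
proof -
  assume u: "u \<in> frames_at M p" and c: "c \<in> charts_at M p"
  have "snd c p \<in> snd c ` fst c" by (rule imageI[OF charts_atD(2)[OF c]])
  then show ?thesis using fmat_invertible[OF u c] by simp
qed

lemma fchart_inv:
  assumes "c \<in> M" "z \<in> fdom c"
  shows "chart_inv (fchart M c) z = frame_of M c (chart_inv c (fst z)) (snd z)"
    "c \<in> charts_at M (chart_inv c (fst z))" "snd c (chart_inv c (fst z)) = fst z"
    "frame_of M c (chart_inv c (fst z)) (snd z) \<in> frames_at M (chart_inv c (fst z))"
    "frame_proj (frame_of M c (chart_inv c (fst z)) (snd z)) = chart_inv c (fst z)"
    "fmat c (frame_of M c (chart_inv c (fst z)) (snd z)) = snd z"
proof -
  have z: "fst z \<in> snd c ` fst c" "invertible (snd z)" using assms(2) by auto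
  show "chart_inv (fchart M c) z = frame_of M c (chart_inv c (fst z)) (snd z)"
    using chart_inv_fchart[OF assms(1) z] by simp
  show c: "c \<in> charts_at M (chart_inv c (fst z))"
    by (rule charts_atI[OF assms(1) chart_inv_right(2)[OF z(1)]])
  show "snd c (chart_inv c (fst z)) = fst z" by (rule chart_inv_right(1)[OF z(1)])
  show u: "frame_of M c (chart_inv c (fst z)) (snd z) \<in> frames_at M (chart_inv c (fst z))"
    by (rule frame_of_in[OF c z(2)])
  show "frame_proj (frame_of M c (chart_inv c (fst z)) (snd z)) = chart_inv c (fst z)"
    by (rule frames_at_proj[OF u])
  show "fmat c (frame_of M c (chart_inv c (fst z)) (snd z)) = snd z"
    by (rule fmat_frame_of_same[OF c])
qed

lemma eventually_fdom:
  assumes "u \<in> frames_at M p" "c \<in> charts_at M p"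
  shows "\<forall>\<^sub>F z in nhds (snd (fchart M c) u). z \<in> fdom c"
  unfolding fchart_coords[OF assms(1)]
  by (rule eventually_nhds_in_open[OF open_fdom[OF charts_atD(1)[OF assms(2)]] fchart_in_fdom[OF assms]])

lemma chart_inv_fchart_coords:
  assumes "u \<in> frames_at M p" "c \<in> charts_at M p"
  shows "chart_inv (fchart M c) (snd c p, fmat c u) = u"
  using fchart_inv(1)[OF charts_atD(1)[OF assms(2)] fchart_in_fdom[OF assms]] frame_of_fmat[OF assms]
    chart_inv_left[OF charts_atD[OF assms(2)]] by simp

text \<open>In frame coordinates the projection is (y, G) to y, a linear map and thus its own
  derivative.\<close>

lemma tproj_chart:
  assumes u: "u \<in> frames_at M p" and c: "c \<in> charts_at M p" and h: "h \<in> tangent_space (frame_atlas M) u"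
  shows "tproj M h = tvec_of M c p (fst (snd h (fchart M c)))"
proof -
  note cM = charts_atD(1)[OF c]
  have "tproj M h = tvec_of M c (frame_proj u) (fst (snd h (fchart M c)))"
  proof (rule tmap_eq[OF smooth_atlas_frame atlas h fchart_at[OF u c]])
    show "c \<in> charts_at M (frame_proj u)" using c by (simp add: frames_at_proj[OF u])
    have ev: "\<forall>\<^sub>F z in nhds (snd (fchart M c) u). fst z = snd c (frame_proj (chart_inv (fchart M c) z))"
      using eventually_fdom[OF u c] by eventually_elim (simp add: fchart_inv[OF cM])
    show "((\<lambda>z. snd c (frame_proj (chart_inv (fchart M c) z))) has_derivative fst) (at (snd (fchart M c) u))"
      by (rule has_derivative_eventually_eq[OF _ ev]) (intro has_derivative_fst has_derivative_ident)
    show "\<forall>\<^sub>F z in nhds (snd (fchart M c) u). frame_proj (chart_inv (fchart M c) z) \<in> fst c"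
      using eventually_fdom[OF u c]
      by eventually_elim (simp add: fchart_inv[OF cM], rule charts_atD(2)[OF fchart_inv(2)[OF cM]], simp)
  qed
  then show ?thesis by (simp add: frames_at_proj[OF u])
qed

lemma frame_act_frame_of: "frame_act g (frame_of M c p G) = frame_of M c p (G ** g)"
  by (simp add: frame_act_def frame_of_def matrix_vector_mul_assoc)

lemma invertible_matrix_mult: "invertible (G ** g)" if "invertible G" "invertible g" for G g :: "real^'n^'n"
  using that by (simp add: invertible_det_nz det_mul)

lemma frame_act_frames_at:
  assumes "u \<in> frames_at M p" "c \<in> charts_at M p" "invertible g"
  shows "frame_act g u \<in> frames_at M p" "fmat c (frame_act g u) = fmat c u ** g"
proof -
  have eq: "frame_act g u = frame_of M c p (fmat c u ** g)"
    using frame_act_frame_of[of g c p "fmat c u"] by (simp add: frame_of_fmat[OF assms(1,2)])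
  show "frame_act g u \<in> frames_at M p"
    unfolding eq by (rule frame_of_in[OF assms(2) invertible_matrix_mult[OF fmat_invertible[OF assms(1,2)] assms(3)]])
  show "fmat c (frame_act g u) = fmat c u ** g"
    unfolding eq by (rule fmat_frame_of_same[OF assms(2)])
qed

text \<open>In frame coordinates the action is (y, G) to (y, G g), again linear.\<close>

lemma tmap_frame_act:
  assumes u: "u \<in> frames_at M p" and c: "c \<in> charts_at M p" and g: "invertible g"
    and h: "h \<in> tangent_space (frame_atlas M) u"
  shows "tmap (frame_atlas M) (frame_atlas M) (frame_act g) h
    = tvec_of (frame_atlas M) (fchart M c) (frame_act g u)
        (fst (snd h (fchart M c)), snd (snd h (fchart M c)) ** g)"
proof -
  note cM = charts_atD(1)[OF c]
  let ?D = "\<lambda>k :: (real^'n) \<times> (real^'n^'n). (fst k, snd k ** g)"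
  have act: "fchart M c \<in> charts_at (frame_atlas M) (frame_act g u)"
    by (rule fchart_at[OF frame_act_frames_at(1)[OF u c g] c])
  have ev: "\<forall>\<^sub>F z in nhds (snd (fchart M c) u).
      (fst z, snd z ** g) = snd (fchart M c) (frame_act g (chart_inv (fchart M c) z))"
    using eventually_fdom[OF u c]
  proof eventually_elim
    case (elim z)
    note z = fchart_inv[OF cM elim]
    show ?case
      by (simp only: z(1) fchart_coords[OF frame_act_frames_at(1)[OF z(4,2) g]]
        frame_act_frames_at(2)[OF z(4,2) g] z(3,6))
  qed
  have ev2: "\<forall>\<^sub>F z in nhds (snd (fchart M c) u). frame_act g (chart_inv (fchart M c) z) \<in> fst (fchart M c)"
    using eventually_fdom[OF u c]
  proof eventually_elim
    case (elim z)
    note z = fchart_inv[OF cM elim]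
    show ?case
      unfolding z(1) by (rule charts_atD(2)[OF fchart_at[OF frame_act_frames_at(1)[OF z(4,2) g] z(2)]])
  qed
  have lin: "bounded_linear (\<lambda>k :: real^'n^'n. k ** g)"
    by (rule bounded_bilinear.bounded_linear_left[OF bounded_bilinear_matrix_mult])
  have "((\<lambda>z. snd (fchart M c) (frame_act g (chart_inv (fchart M c) z))) has_derivative ?D) (at (snd (fchart M c) u))"
    by (rule has_derivative_eventually_eq[OF _ ev])
      (intro has_derivative_Pair has_derivative_fst has_derivative_snd has_derivative_ident
        bounded_linear.has_derivative[OF lin])
  from tmap_eq[OF smooth_atlas_frame smooth_atlas_frame h fchart_at[OF u c] act this ev2]
  show ?thesis .
qed

text \<open>Evaluation at \<xi> is (y, G) to (y, G \<xi>) in coordinates, again linear.\<close>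

lemma tmap_frame_eval:
  assumes u: "u \<in> frames_at M p" and c: "c \<in> charts_at M p" and h: "h \<in> tangent_space (frame_atlas M) u"
  shows "tmap (frame_atlas M) (tangent_atlas M) (\<lambda>u'. u' \<xi>) h
    = tvec_of (tangent_atlas M) (tchart M c) (u \<xi>)
        (fst (snd h (fchart M c)), snd (snd h (fchart M c)) *v \<xi>)"
proof -
  note cM = charts_atD(1)[OF c]
  let ?D = "\<lambda>k :: (real^'n) \<times> (real^'n^'n). (fst k, snd k *v \<xi>)"
  have ch: "tchart M c \<in> charts_at (tangent_atlas M) (u \<xi>)"
    by (rule tchart_at[OF frames_at_tangent[OF u] c])
  have ev: "\<forall>\<^sub>F z in nhds (snd (fchart M c) u). (fst z, snd z *v \<xi>) = snd (tchart M c) (chart_inv (fchart M c) z \<xi>)"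
    using eventually_fdom[OF u c]
  proof eventually_elim
    case (elim z)
    note z = fchart_inv[OF cM elim]
    show ?case
      unfolding z(1) tchart_def using fmat_works[OF z(4), of c \<xi>] z(3,6) tangent_space_fst[OF frames_at_tangent[OF z(4), of \<xi>]]
      by simp
  qed
  have ev2: "\<forall>\<^sub>F z in nhds (snd (fchart M c) u). chart_inv (fchart M c) z \<xi> \<in> fst (tchart M c)"
    using eventually_fdom[OF u c]
  proof eventually_elim
    case (elim z)
    note z = fchart_inv[OF cM elim]
    show ?case
      unfolding z(1) by (rule charts_atD(2)[OF tchart_at[OF frames_at_tangent[OF z(4)] z(2)]])
  qed
  have lin: "bounded_linear (\<lambda>k :: real^'n^'n. k *v \<xi>)"
    by (rule bounded_bilinear.bounded_linear_left[OF bounded_bilinear_matrix_vector])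
  have "((\<lambda>z. snd (tchart M c) (chart_inv (fchart M c) z \<xi>)) has_derivative ?D) (at (snd (fchart M c) u))"
    by (rule has_derivative_eventually_eq[OF _ ev])
      (intro has_derivative_Pair has_derivative_fst has_derivative_snd has_derivative_ident
        bounded_linear.has_derivative[OF lin])
  from tmap_eq[OF smooth_atlas_frame smooth_atlas_tangent h fchart_at[OF u c] ch this ev2]
  show ?thesis .
qed

text \<open>In coordinates the function is k = G^(-1) Y. The inverse is not differentiated: Cramer's
  rule gives smoothness of k, and comparing the product rule for G k with the derivative of Y yields
  G k' = Y' - G' k.\<close>

lemma dirder_frame:
  assumes u: "u \<in> frames_at M p" and c: "c \<in> charts_at M p" and h: "h \<in> tangent_space (frame_atlas M) u"
    and Y: "Y \<in> vector_fields M"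
  shows "fmat c u *v dirder (frame_atlas M) (\<lambda>u'. inv u' (Y (frame_proj u'))) h
    = vf_deriv c Y p (fst (snd h (fchart M c))) - snd (snd h (fchart M c)) *v inv u (Y p)"
proof -
  note cM = charts_atD(1)[OF c]
  let ?f = "\<lambda>u'. inv u' (Y (frame_proj u'))"
  define k where "k z = ?f (chart_inv (fchart M c) z)" for z
  define k' where "k' z = matrix_inv (snd z) *v snd (Y (chart_inv c (fst z))) c"
    for z :: "(real^'n) \<times> (real^'n^'n)"
  have tanY: "Y (chart_inv c (fst z)) \<in> tangent_space M (chart_inv c (fst z))" if "z \<in> fdom c" for z
    by (rule vector_fieldD_tangent[OF Y charts_at_mcarrier[OF fchart_inv(2)[OF cM that]]])
  have kk': "k z = k' z" if "z \<in> fdom c" for z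
    unfolding k_def k'_def fchart_inv(1)[OF cM that] fchart_inv(5)[OF cM that]
      inv_frame(1)[OF fchart_inv(4)[OF cM that] tanY[OF that] fchart_inv(2)[OF cM that]] fchart_inv(6)[OF cM that] ..
  note op = open_fdom[OF cM]
  have fst: "smooth_on (fdom c) fst" by (rule smooth_on_linear[OF bounded_linear_fst op])
  have "smooth_on (fdom c) (\<lambda>z. snd (Y (chart_inv c (fst z))) c)"
    by (rule smooth_on_compose[OF op open_chart[OF cM] _ fst vector_fieldD_smooth[OF Y cM]]) auto
  then have "smooth_on (fdom c) k'"
    unfolding k'_def
    by (intro smooth_on_matrix_inv[OF op] smooth_on_linear[OF bounded_linear_snd op]) auto
  then have smk: "smooth_on (fdom c) k"
    by (rule smooth_on_cong[OF op, rotated]) (rule kk'[symmetric])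
  define z0 where "z0 = snd (fchart M c) u"
  have z0: "z0 = (snd c p, fmat c u)" "z0 \<in> fdom c"
    unfolding z0_def fchart_coords[OF u] using fchart_in_fdom[OF u c] by simp_all
  define K where "K = frechet_derivative k (at z0)"
  have K: "(k has_derivative K) (at z0)"
    unfolding K_def by (rule smooth_on_has_derivative[OF smk op z0(2)])
  have 1: "((\<lambda>z. snd z *v k z) has_derivative (\<lambda>l. snd z0 *v K l + snd l *v k z0)) (at z0)"
    by (rule bounded_bilinear.FDERIV[OF bounded_bilinear_matrix_vector has_derivative_snd[OF has_derivative_ident] K])
  have pc: "p \<in> fst c" by (rule charts_atD(2)[OF c])
  have fz: "fst z0 = snd c p" "snd z0 = fmat c u" by (simp_all add: z0(1))
  have "((\<lambda>z. snd (Y (chart_inv c (fst z))) c) has_derivative (\<lambda>l. vf_deriv c Y p (fst l))) (at z0)"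
    by (rule has_derivative_compose[OF has_derivative_fst[OF has_derivative_ident]])
      (simp only: fz vf_has_derivative[OF Y cM pc])
  then have 2: "((\<lambda>z. snd z *v k z) has_derivative (\<lambda>l. vf_deriv c Y p (fst l))) (at z0)"
  proof (rule has_derivative_transform_within_open[OF _ op z0(2)])
    show "snd (Y (chart_inv c (fst z))) c = snd z *v k z" if "z \<in> fdom c" for z
      unfolding kk'[OF that] k'_def using that by (auto simp: matrix_inv_works(2))
  qed
  have eq: "snd z0 *v K l + snd l *v k z0 = vf_deriv c Y p (fst l)" for l
    using fun_cong[OF has_derivative_unique[OF 1 2], of l] .
  have "dirder (frame_atlas M) ?f h = K (snd h (fchart M c))"
    by (rule FA.dirder_eq[OF h fchart_at[OF u c]]) (use K in \<open>simp add: k_def[abs_def] z0_def\<close>)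
  moreover have "k z0 = inv u (Y p)"
    unfolding k_def z0(1) chart_inv_fchart_coords[OF u c] frames_at_proj[OF u] ..
  ultimately show ?thesis using eq[of "snd h (fchart M c)"] by (simp add: fz algebra_simps)
qed

text \<open>The largest set of vectors that satisfies the defining property of \<^const>\<open>corresponds\<close>. As it is
  defined without charts, its description by Christoffel symbols holds in every chart, and their
  transformation law is not needed.\<close>

definition horizontal :: "('a, 'n) frame_tvec set" where
  "horizontal = {h \<in> tangent_bundle (frame_atlas M). \<forall>X\<in>vector_fields M. \<forall>Y\<in>vector_fields M.
     tproj M h = X (frame_proj (fst h)) \<longrightarrow>
     D X Y (frame_proj (fst h)) =
       fst h (dirder (frame_atlas M) (\<lambda>u'. inv u' (Y (frame_proj u'))) h)}"

definition hmat :: "('a, real^'n) chart \<Rightarrow> 'a \<Rightarrow> real^'n \<Rightarrow> real^'n^'n \<Rightarrow> real^'n^'n" where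
  "hmat c p a G = matrix (\<lambda>\<xi>. - christoffel c p a (G *v \<xi>))"

lemma hmat_works: "c \<in> charts_at M p \<Longrightarrow> hmat c p a G *v \<xi> = - christoffel c p a (G *v \<xi>)"
proof -
  assume c: "c \<in> charts_at M p"
  have "linear (\<lambda>\<xi>. - christoffel c p a (G *v \<xi>))"
    by (rule linear_compose_neg, rule linear_compose[unfolded comp_def, OF matrix_vector_mul_linear
      christoffel_linear(2)[OF charts_atD[OF c]]])
  from fun_cong[OF matrix_vector_mul(2)[OF this]] show ?thesis by (simp add: hmat_def)
qed

lemma hmat_add:
  assumes "c \<in> charts_at M p"
  shows "hmat c p (a + a') G = hmat c p a G + hmat c p a' G"
  unfolding matrix_eq
  by (simp add: hmat_works[OF assms] matrix_vector_mult_add_rdistrib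
      linear_add[OF christoffel_linear(1)[OF charts_atD[OF assms]]])

lemma hmat_scale:
  assumes "c \<in> charts_at M p"
  shows "hmat c p (r *\<^sub>R a) G = r *\<^sub>R hmat c p a G"
  unfolding matrix_eq
  by (simp add: hmat_works[OF assms] scaleR_matrix_vector_assoc[symmetric]
      linear_scale[OF christoffel_linear(1)[OF charts_atD[OF assms]]])

text \<open>This equivariance is the source of the invariance of the horizontal vectors under
  GL(n).\<close>

lemma hmat_mult: "c \<in> charts_at M p \<Longrightarrow> hmat c p a (G ** g) = hmat c p a G ** g"
  unfolding matrix_eq by (simp add: hmat_works matrix_vector_mul_assoc[symmetric])

text \<open>For h with coordinates (a, b), \<open>D X Y\<close> is Y'(a) + \<Gamma>(a, Y), while the
  frame side is Y'(a) - b G^(-1) Y by \<open>dirder_frame\<close>. The derivatives of Y cancel, and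
  what remains involves only the value of Y at \<open>p\<close>.\<close>

lemma horizontal_iff:
  assumes u: "u \<in> frames_at M p" and c: "c \<in> charts_at M p" and h: "h \<in> tangent_space (frame_atlas M) u"
  shows "h \<in> horizontal \<longleftrightarrow> snd (snd h (fchart M c)) = hmat c p (fst (snd h (fchart M c))) (fmat c u)"
proof -
  note cM = charts_atD[OF c]
  define a b where "a = fst (snd h (fchart M c))" and "b = snd (snd h (fchart M c))"
  have pm: "p \<in> mcarrier M" by (rule charts_at_mcarrier[OF c])
  have fst: "fst h = u" by (rule tangent_space_fst[OF h])
  have proj: "frame_proj u = p" by (rule frames_at_proj[OF u])
  have hb: "h \<in> tangent_bundle (frame_atlas M)"
    by (rule tangent_bundleI[OF h charts_at_mcarrier[OF fchart_at[OF u c]]])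
  have tp: "tproj M h = tvec_of M c p a" unfolding a_def by (rule tproj_chart[OF u c h])
  have key: "D X Y p = u (dirder (frame_atlas M) (\<lambda>u'. inv u' (Y (frame_proj u'))) h) \<longleftrightarrow>
      b *v (matrix_inv (fmat c u) *v snd (Y p) c) = - christoffel c p a (snd (Y p) c)"
    if X: "X \<in> vector_fields M" and Y: "Y \<in> vector_fields M" and Xp: "tproj M h = X p" for X Y
  proof -
    let ?d = "dirder (frame_atlas M) (\<lambda>u'. inv u' (Y (frame_proj u'))) h"
    have Xa: "snd (X p) c = a" using Xp tvec_of_same[OF c, of a] by (simp add: tp)
    have 1: "D X Y p \<in> tangent_space M p" by (rule vector_fieldD_tangent[OF connection_in[OF X Y] pm])
    have 2: "snd (D X Y p) c = vf_deriv c Y p a + christoffel c p a (snd (Y p) c)"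
      using connection_chart[OF cM X Y] by (simp add: Xa)
    have 3: "snd (u ?d) c = vf_deriv c Y p a - b *v (matrix_inv (fmat c u) *v snd (Y p) c)"
      using dirder_frame[OF u c h Y]
      unfolding fmat_works[OF u] inv_frame(1)[OF u vector_fieldD_tangent[OF Y pm] c] a_def b_def .
    have "D X Y p = u ?d \<longleftrightarrow> snd (D X Y p) c = snd (u ?d) c"
      by (rule iffI, erule arg_cong) (rule tangent_eqI[OF 1 frames_at_tangent[OF u] c])
    also have "\<dots> \<longleftrightarrow> b *v (matrix_inv (fmat c u) *v snd (Y p) c) = - christoffel c p a (snd (Y p) c)"
      unfolding 2 3 diff_conv_add_uminus add_left_cancel by (metis minus_minus)
    finally show ?thesis .
  qed
  have "h \<in> horizontal \<longleftrightarrow> b = hmat c p a (fmat c u)"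
  proof
    assume "h \<in> horizontal"
    then have "\<forall>X\<in>vector_fields M. \<forall>Y\<in>vector_fields M. tproj M h = X (frame_proj (fst h)) \<longrightarrow>
        D X Y (frame_proj (fst h)) = fst h (dirder (frame_atlas M) (\<lambda>u'. inv u' (Y (frame_proj u'))) h)"
      unfolding horizontal_def mem_Collect_eq by (rule conjunct2)
    then have H: "D X Y p = u (dirder (frame_atlas M) (\<lambda>u'. inv u' (Y (frame_proj u'))) h)"
      if "X \<in> vector_fields M" "Y \<in> vector_fields M" "tproj M h = X p" for X Y
      using that unfolding fst proj by blast
    obtain X where X: "X \<in> vector_fields M" "snd (X p) c = a"
      by (rule field_with_value[OF cM])
    have Xp: "tproj M h = X p"
      unfolding tp X(2)[symmetric] by (rule tvec_of_snd[OF vector_fieldD_tangent[OF X(1) pm] c])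
    show "b = hmat c p a (fmat c u)"
      unfolding matrix_eq
    proof
      fix \<xi> :: "real^'n"
      \<comment> \<open>A field with value u \<xi> at \<open>p\<close>, so that G^(-1) Y becomes
        \<xi>.\<close>
      obtain Y where Y: "Y \<in> vector_fields M" "snd (Y p) c = fmat c u *v \<xi>"
        by (rule field_with_value[OF cM])
      have "b *v (matrix_inv (fmat c u) *v snd (Y p) c) = - christoffel c p a (snd (Y p) c)"
        using key[OF X(1) Y(1) Xp] H[OF X(1) Y(1) Xp] by blast
      then show "b *v \<xi> = hmat c p a (fmat c u) *v \<xi>"
        unfolding Y(2) hmat_works[OF c] matrix_inv_works(1)[OF fmat_invertible[OF u c]] .
    qed
  next
    assume b: "b = hmat c p a (fmat c u)"
    have "D X Y p = u (dirder (frame_atlas M) (\<lambda>u'. inv u' (Y (frame_proj u'))) h)"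
      if "X \<in> vector_fields M" "Y \<in> vector_fields M" "tproj M h = X p" for X Y
      unfolding key[OF that] unfolding b hmat_works[OF c] matrix_inv_works(2)[OF fmat_invertible[OF u c]] ..
    then show "h \<in> horizontal"
      unfolding horizontal_def using hb by (simp add: fst proj)
  qed
  then show ?thesis by (simp add: a_def b_def)
qed

end

section \<open>Existence and uniqueness of the corresponding principal connection\<close>

context affine_manifold
begin

definition hlift :: "('a, real^'n) chart \<Rightarrow> ('a, 'n) frame \<Rightarrow> real^'n \<Rightarrow> ('a, 'n) frame_tvec" where
  "hlift c u a = tvec_of (frame_atlas M) (fchart M c) u (a, hmat c (frame_proj u) a (fmat c u))"

lemma hlift:
  assumes u: "u \<in> frames_at M p" and c: "c \<in> charts_at M p"
  shows "hlift c u a \<in> tangent_space (frame_atlas M) u" "hlift c u a \<in> horizontal" "fst (hlift c u a) = u"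
    "snd (hlift c u a) (fchart M c) = (a, hmat c p a (fmat c u))"
proof -
  note fc = fchart_at[OF u c]
  show tan: "hlift c u a \<in> tangent_space (frame_atlas M) u" unfolding hlift_def by (rule FA.tvec_of_in[OF fc])
  show ch: "snd (hlift c u a) (fchart M c) = (a, hmat c p a (fmat c u))"
    unfolding hlift_def FA.tvec_of_same[OF fc] frames_at_proj[OF u] ..
  show "hlift c u a \<in> horizontal" unfolding horizontal_iff[OF u c tan] ch by simp
  show "fst (hlift c u a) = u" by (rule tangent_space_fst[OF tan])
qed

lemma horizontalD:
  assumes "h \<in> horizontal"
  shows "h \<in> tangent_space (frame_atlas M) (fst h)" "fst h \<in> frames M"
proof -
  have "h \<in> tangent_bundle (frame_atlas M)" using assms unfolding horizontal_def mem_Collect_eq by (rule conjunct1)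
  from tangent_bundleD[OF this] show "h \<in> tangent_space (frame_atlas M) (fst h)" "fst h \<in> frames M"
    by (simp_all add: mcarrier_frame_atlas)
qed

lemma horizontal_eq_hlift:
  assumes u: "u \<in> frames_at M p" and c: "c \<in> charts_at M p" and h: "h \<in> horizontal" "fst h = u"
  shows "h = hlift c u (fst (snd h (fchart M c)))"
proof -
  have tan: "h \<in> tangent_space (frame_atlas M) u" using horizontalD(1)[OF h(1)] h(2) by simp
  have "snd (snd h (fchart M c)) = hmat c p (fst (snd h (fchart M c))) (fmat c u)"
    using h(1) unfolding horizontal_iff[OF u c tan] .
  then have "snd h (fchart M c) = snd (hlift c u (fst (snd h (fchart M c)))) (fchart M c)"
    unfolding hlift(4)[OF u c] by (simp add: prod_eq_iff)
  then show ?thesis by (rule tangent_eqI[OF tan hlift(1)[OF u c] fchart_at[OF u c]])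
qed

lemma tproj_hlift:
  assumes u: "u \<in> frames_at M p" and c: "c \<in> charts_at M p"
  shows "tproj M (hlift c u a) = tvec_of M c p a"
  using tproj_chart[OF u c hlift(1)[OF u c]] by (simp add: hlift(4)[OF u c])

lemma vertical_iff:
  assumes u: "u \<in> frames_at M p" and c: "c \<in> charts_at M p" and w: "w \<in> tangent_space (frame_atlas M) u"
  shows "w \<in> vertical_space M u \<longleftrightarrow> fst (snd w (fchart M c)) = 0"
proof -
  have "w \<in> vertical_space M u \<longleftrightarrow> tvec_of M c p (fst (snd w (fchart M c))) = (p, \<lambda>_. 0)"
    using w by (simp add: vertical_space_def tproj_chart[OF u c w] frames_at_proj[OF u])
  also have "\<dots> \<longleftrightarrow> fst (snd w (fchart M c)) = 0"
  proof
    assume "tvec_of M c p (fst (snd w (fchart M c))) = (p, \<lambda>_. 0)"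
    then have "snd (tvec_of M c p (fst (snd w (fchart M c)))) c = snd (p, \<lambda>_. 0) c" by (rule arg_cong)
    then show "fst (snd w (fchart M c)) = 0" by (simp add: tvec_of_same[OF c])
  next
    assume "fst (snd w (fchart M c)) = 0"
    then show "tvec_of M c p (fst (snd w (fchart M c))) = (p, \<lambda>_. 0)"
      using linear_0[OF dtrans_linear[OF c]] by (auto simp: tvec_of_def)
  qed
  finally show ?thesis .
qed

lemma horizontal_subspace:
  assumes "u \<in> frames M"
  shows "tsubspace {h \<in> horizontal. fst h = u}"
proof -
  note u = framesD(1)[OF assms]
  note c = chart_at_in[OF framesD(2)[OF assms]]
  let ?c = "chart_at M (frame_proj u)"
  have l: "\<exists>a. h = hlift ?c u a" if "h \<in> {h \<in> horizontal. fst h = u}" for h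
    using horizontal_eq_hlift[OF u c] that by blast
  have add: "tadd (hlift ?c u a) (hlift ?c u a') = hlift ?c u (a + a')" for a a'
    by (rule tangent_eqI[OF FA.tangent_space_tadd[OF hlift(1)[OF u c] hlift(1)[OF u c]] hlift(1)[OF u c] fchart_at[OF u c]])
      (simp add: tadd_def hlift(4)[OF u c] hmat_add[OF c])
  have scale: "tscale r (hlift ?c u a) = hlift ?c u (r *\<^sub>R a)" for a r
    by (rule tangent_eqI[OF FA.tangent_space_tscale[OF hlift(1)[OF u c]] hlift(1)[OF u c] fchart_at[OF u c]])
      (simp add: tscale_def hlift(4)[OF u c] hmat_scale[OF c])
  have mem: "hlift ?c u a \<in> {h \<in> horizontal. fst h = u}" for a
    using hlift(2,3)[OF u c] by simp
  show ?thesis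
    unfolding tsubspace_def
  proof (intro conjI ballI allI)
    show "{h \<in> horizontal. fst h = u} \<noteq> {}" using mem by blast
    show "tadd v w \<in> {h \<in> horizontal. fst h = u}"
      if vw: "v \<in> {h \<in> horizontal. fst h = u}" "w \<in> {h \<in> horizontal. fst h = u}" for v w
    proof -
      obtain a a' where "v = hlift ?c u a" "w = hlift ?c u a'" using l[OF vw(1)] l[OF vw(2)] by blast
      then show ?thesis using mem[of "a + a'"] by (simp only: add)
    qed
    show "tscale r v \<in> {h \<in> horizontal. fst h = u}" if v: "v \<in> {h \<in> horizontal. fst h = u}" for r v
    proof -
      obtain a where "v = hlift ?c u a" using l[OF v] by blast
      then show ?thesis using mem[of "r *\<^sub>R a"] by (simp only: scale)
    qed
  qed
qed

text \<open>Vertical vectors have first component 0, so the horizontal part must share the first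
  component a of \<open>w\<close>; the remainder (0, b - \<open>hmat\<close>) is vertical.\<close>

lemma horizontal_complement:
  assumes u: "u \<in> frames_at M p" and c: "c \<in> charts_at M p" and w: "w \<in> tangent_space (frame_atlas M) u"
  shows "\<exists>k\<in>vertical_space M u. w = tadd (hlift c u (fst (snd w (fchart M c)))) k"
    "h \<in> horizontal \<Longrightarrow> fst h = u \<Longrightarrow> k \<in> vertical_space M u \<Longrightarrow> w = tadd h k \<Longrightarrow>
      h = hlift c u (fst (snd w (fchart M c)))"
proof -
  note fc = fchart_at[OF u c]
  let ?a = "fst (snd w (fchart M c))" and ?b = "snd (snd w (fchart M c))"
  let ?k = "tvec_of (frame_atlas M) (fchart M c) u (0, ?b - hmat c p ?a (fmat c u))"
  have k: "?k \<in> tangent_space (frame_atlas M) u" by (rule FA.tvec_of_in[OF fc])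
  have "?k \<in> vertical_space M u" unfolding vertical_iff[OF u c k] FA.tvec_of_same[OF fc] by simp
  moreover have "w = tadd (hlift c u ?a) ?k"
    by (rule tangent_eqI[OF w FA.tangent_space_tadd[OF hlift(1)[OF u c] k] fc])
      (simp add: tadd_def hlift(4)[OF u c] FA.tvec_of_same[OF fc])
  ultimately show "\<exists>k\<in>vertical_space M u. w = tadd (hlift c u ?a) k" by blast
  assume h: "h \<in> horizontal" "fst h = u" and k: "k \<in> vertical_space M u" and eq: "w = tadd h k"
  have kt: "k \<in> tangent_space (frame_atlas M) u" using k by (simp add: vertical_space_def)
  have "snd w (fchart M c) = snd h (fchart M c) + snd k (fchart M c)" by (simp add: eq tadd_def)
  then have "?a = fst (snd h (fchart M c))" using k unfolding vertical_iff[OF u c kt] by simp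
  then show "h = hlift c u ?a" using horizontal_eq_hlift[OF u c h] by simp
qed

lemma horizontal_complement_unique:
  assumes u: "u \<in> frames M" and w: "w \<in> tangent_space (frame_atlas M) u"
  shows "\<exists>!h. h \<in> horizontal \<and> fst h = u \<and> (\<exists>k\<in>vertical_space M u. w = tadd h k)"
proof -
  note u' = framesD(1)[OF u]
  note c = chart_at_in[OF framesD(2)[OF u]]
  show ?thesis
  proof (rule ex1I, intro conjI)
    show "hlift (chart_at M (frame_proj u)) u (fst (snd w (fchart M (chart_at M (frame_proj u))))) \<in> horizontal"
      by (rule hlift(2)[OF u' c])
    show "fst (hlift (chart_at M (frame_proj u)) u (fst (snd w (fchart M (chart_at M (frame_proj u)))))) = u"
      by (rule hlift(3)[OF u' c])
    show "\<exists>k\<in>vertical_space M u. w = tadd (hlift (chart_at M (frame_proj u)) u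
        (fst (snd w (fchart M (chart_at M (frame_proj u)))))) k"
      by (rule horizontal_complement(1)[OF u' c w])
    show "h = hlift (chart_at M (frame_proj u)) u (fst (snd w (fchart M (chart_at M (frame_proj u)))))"
      if "h \<in> horizontal \<and> fst h = u \<and> (\<exists>k\<in>vertical_space M u. w = tadd h k)" for h
      using that horizontal_complement(2)[OF u' c w] by blast
  qed
qed

lemma frame_act_hlift:
  assumes u: "u \<in> frames_at M p" and c: "c \<in> charts_at M p" and g: "invertible g"
  shows "tmap (frame_atlas M) (frame_atlas M) (frame_act g) (hlift c u a) = hlift c (frame_act g u) a"
proof -
  note u' = frame_act_frames_at[OF u c g]
  show ?thesis
    unfolding tmap_frame_act[OF u c g hlift(1)[OF u c]] hlift(4)[OF u c]
    by (simp add: hlift_def frames_at_proj[OF u'(1)] u'(2) hmat_mult[OF c])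
qed

lemma horizontal_invariant:
  assumes u: "u \<in> frames M" and g: "invertible g"
  shows "tmap (frame_atlas M) (frame_atlas M) (frame_act g) ` {h \<in> horizontal. fst h = u}
    = {h \<in> horizontal. fst h = frame_act g u}"
proof (intro equalityI subsetI)
  note u0 = framesD(1)[OF u] and c = chart_at_in[OF framesD(2)[OF u]]
  note u' = frame_act_frames_at(1)[OF u0 c g]
  let ?c = "chart_at M (frame_proj u)"
  fix h
  show "h \<in> {h \<in> horizontal. fst h = frame_act g u}"
    if "h \<in> tmap (frame_atlas M) (frame_atlas M) (frame_act g) ` {h \<in> horizontal. fst h = u}"
  proof -
    obtain h' where h': "h' \<in> horizontal" "fst h' = u" "h = tmap (frame_atlas M) (frame_atlas M) (frame_act g) h'"
      using \<open>h \<in> _ ` _\<close> by blast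
    have "h = hlift ?c (frame_act g u) (fst (snd h' (fchart M ?c)))"
      unfolding h'(3) by (subst horizontal_eq_hlift[OF u0 c h'(1,2)]) (rule frame_act_hlift[OF u0 c g])
    then show ?thesis using hlift(2,3)[OF u' c] by simp
  qed
  show "h \<in> tmap (frame_atlas M) (frame_atlas M) (frame_act g) ` {h \<in> horizontal. fst h = u}"
    if h: "h \<in> {h \<in> horizontal. fst h = frame_act g u}"
  proof (rule rev_image_eqI)
    show "hlift ?c u (fst (snd h (fchart M ?c))) \<in> {h \<in> horizontal. fst h = u}"
      using hlift(2,3)[OF u0 c] by simp
    show "h = tmap (frame_atlas M) (frame_atlas M) (frame_act g) (hlift ?c u (fst (snd h (fchart M ?c))))"
      unfolding frame_act_hlift[OF u0 c g] using horizontal_eq_hlift[OF u' c] h by blast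
  qed
qed

lemma smooth_hmat:
  fixes a :: "(real^'n) \<times> (real^'n^'n) \<Rightarrow> real^'n"
  assumes c: "c \<in> M" and a: "smooth_on (fdom c) a"
  shows "smooth_on (fdom c) (\<lambda>z. hmat c (chart_inv c (fst z)) (a z) (snd z))"
proof (intro smooth_on_vec[OF open_fdom[OF c]])
  fix i j :: 'n
  note op = open_fdom[OF c]
  have p: "chart_inv c (fst z) \<in> fst c" if "z \<in> fdom c" for z
    using that by (intro chart_inv_right(2)) auto
  have col: "smooth_on (fdom c) (\<lambda>z. snd z *v axis j 1)"
    by (rule smooth_on_bounded_linear[OF bounded_bilinear.bounded_linear_left[OF bounded_bilinear_matrix_vector] op
      smooth_on_linear[OF bounded_linear_snd op]])
  have "smooth_on (fdom c) (\<lambda>z. christoffel c (chart_inv c (fst z)) (a z) (snd z *v axis j 1))"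
  proof (rule smooth_on_apply_linear[OF op _ _ a])
    show "linear (\<lambda>a. christoffel c (chart_inv c (fst z)) a (snd z *v axis j 1))" if "z \<in> fdom c" for z
      by (rule christoffel_linear(1)[OF c p[OF that]])
    show "smooth_on (fdom c) (\<lambda>z. christoffel c (chart_inv c (fst z)) b (snd z *v axis j 1))" for b
    proof (rule smooth_on_apply_linear[OF op _ _ col])
      show "linear (christoffel c (chart_inv c (fst z)) b)" if "z \<in> fdom c" for z
        by (rule christoffel_linear(2)[OF c p[OF that]])
      show "smooth_on (fdom c) (\<lambda>z. christoffel c (chart_inv c (fst z)) b b')" for b'
        by (rule smooth_on_compose[OF op open_chart[OF c] _ smooth_on_linear[OF bounded_linear_fst op]
          smooth_christoffel[OF c]]) auto
    qed
  qed
  then have "smooth_on (fdom c) (\<lambda>z. (- christoffel c (chart_inv c (fst z)) (a z) (snd z *v axis j 1)) $ i)"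
    by (intro smooth_on_vec_nth[OF op] smooth_on_minus[OF op])
  then show "smooth_on (fdom c) (\<lambda>z. hmat c (chart_inv c (fst z)) (a z) (snd z) $ i $ j)"
    by (simp add: hmat_def matrix_def)
qed

text \<open>\<open>chart_at\<close> may change from frame to frame without control. Since the
  horizontal part is unique, \<open>W'\<close> can be computed in any chart, and smoothness is
  checked in the chart under consideration.\<close>

lemma horizontal_part_smooth:
  assumes W: "W \<in> vector_fields (frame_atlas M)"
  shows "\<exists>W'\<in>vector_fields (frame_atlas M).
    \<forall>u\<in>frames M. W' u \<in> horizontal \<and> (\<exists>k\<in>vertical_space M u. W u = tadd (W' u) k)"
proof
  define W' where "W' = (\<lambda>u\<in>frames M. hlift (chart_at M (frame_proj u)) u
    (fst (snd (W u) (fchart M (chart_at M (frame_proj u))))))"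
  have Wt: "W u \<in> tangent_space (frame_atlas M) u" if "u \<in> frames M" for u
    by (rule FA.vector_fieldD_tangent[OF W]) (simp add: mcarrier_frame_atlas that)
  have W'_chart: "W' u = hlift c u (fst (snd (W u) (fchart M c)))"
    if u: "u \<in> frames M" and c: "c \<in> charts_at M (frame_proj u)" for u c
  proof -
    note u0 = framesD(1)[OF u] and c0 = chart_at_in[OF framesD(2)[OF u]]
    have W': "W' u = hlift (chart_at M (frame_proj u)) u (fst (snd (W u) (fchart M (chart_at M (frame_proj u)))))"
      using u by (simp add: W'_def)
    obtain k where k: "k \<in> vertical_space M u" "W u = tadd (W' u) k"
      using horizontal_complement(1)[OF u0 c0 Wt[OF u]] W' by metis
    show ?thesis
      by (rule horizontal_complement(2)[OF u0 c Wt[OF u] _ _ k]) (simp_all only: W' hlift(2,3)[OF u0 c0])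
  qed
  show "\<forall>u\<in>frames M. W' u \<in> horizontal \<and> (\<exists>k\<in>vertical_space M u. W u = tadd (W' u) k)"
  proof
    fix u assume u: "u \<in> frames M"
    note u0 = framesD(1)[OF u] and c0 = chart_at_in[OF framesD(2)[OF u]]
    show "W' u \<in> horizontal \<and> (\<exists>k\<in>vertical_space M u. W u = tadd (W' u) k)"
      unfolding W'_chart[OF u c0] using hlift(2)[OF u0 c0] horizontal_complement(1)[OF u0 c0 Wt[OF u]] by blast
  qed
  show "W' \<in> vector_fields (frame_atlas M)"
  proof (rule FA.vector_fieldI)
    show "W' \<in> extensional (mcarrier (frame_atlas M))"
      by (simp add: mcarrier_frame_atlas W'_def)
    show "W' u \<in> tangent_space (frame_atlas M) u" if "u \<in> mcarrier (frame_atlas M)" for u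
    proof -
      have u: "u \<in> frames M" using that by (simp add: mcarrier_frame_atlas)
      note u0 = framesD(1)[OF u] and c0 = chart_at_in[OF framesD(2)[OF u]]
      show ?thesis unfolding W'_chart[OF u c0] by (rule hlift(1)[OF u0 c0])
    qed
    fix e assume e: "e \<in> frame_atlas M"
    then obtain c where c: "c \<in> M" "e = fchart M c" by (auto simp: frame_atlas_eq)
    have im: "snd e ` fst e = fdom c" unfolding c(2) by (rule fchart_image_self[OF c(1)])
    note op = open_fdom[OF c(1)]
    let ?a = "\<lambda>z. fst (snd (W (chart_inv e z)) e)"
    have a: "smooth_on (fdom c) ?a"
      using FA.vector_fieldD_smooth[OF W e] unfolding im by (rule smooth_on_fst[OF op])
    have sm: "smooth_on (fdom c) (\<lambda>z. (?a z, hmat c (chart_inv c (fst z)) (?a z) (snd z)))"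
      by (rule smooth_on_Pair[OF op a smooth_hmat[OF c(1) a]])
    show "smooth_on (snd e ` fst e) (\<lambda>z. snd (W' (chart_inv e z)) e)"
      unfolding im
    proof (rule smooth_on_cong[OF op _ sm])
      fix z assume z: "z \<in> fdom c"
      note f = fchart_inv[OF c(1) z]
      let ?u = "frame_of M c (chart_inv c (fst z)) (snd z)"
      have eu: "chart_inv e z = ?u" unfolding c(2) by (rule f(1))
      have u: "?u \<in> frames M" by (rule frames_at_frames[OF f(4) charts_at_mcarrier[OF f(2)]])
      have "W' ?u = hlift c ?u (fst (snd (W ?u) e))"
        unfolding c(2) by (rule W'_chart[OF u]) (simp only: f(5) f(2))
      then have "snd (W' ?u) e = (fst (snd (W ?u) e), hmat c (chart_inv c (fst z)) (fst (snd (W ?u) e)) (snd z))"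
        using hlift(4)[OF f(4,2)] f(6) by (simp only: c(2))
      then show "(?a z, hmat c (chart_inv c (fst z)) (?a z) (snd z)) = snd (W' (chart_inv e z)) e"
        unfolding eu by (rule sym)
    qed
  qed
qed

lemma principal_connection_horizontal: "principal_connection M horizontal"
  unfolding principal_connection_def
proof (intro conjI ballI allI impI)
  show "horizontal \<subseteq> tangent_bundle (frame_atlas M)"
    by (rule subsetI, unfold horizontal_def mem_Collect_eq, erule conjunct1)
qed (fact horizontal_subspace horizontal_complement_unique horizontal_invariant horizontal_part_smooth)+

lemma corresponds_horizontal: "corresponds M horizontal D"
  unfolding corresponds_def
proof (intro ballI impI)
  fix X Y u h
  assume *: "X \<in> vector_fields M" "Y \<in> vector_fields M" "h \<in> horizontal"
    "fst h = u \<and> tproj M h = X (frame_proj u)"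
  have "\<forall>X\<in>vector_fields M. \<forall>Y\<in>vector_fields M. tproj M h = X (frame_proj (fst h)) \<longrightarrow>
      D X Y (frame_proj (fst h)) = fst h (dirder (frame_atlas M) (\<lambda>u'. inv u' (Y (frame_proj u'))) h)"
    using *(3) unfolding horizontal_def mem_Collect_eq by (rule conjunct2)
  then show "D X Y (frame_proj u) = u (dirder (frame_atlas M) (\<lambda>u'. inv u' (Y (frame_proj u'))) h)"
    using *(1,2,4) by blast
qed

text \<open>Any corresponding \<open>H\<close> lies in \<open>horizontal\<close> by the definition
  of the latter. Conversely, split a horizontal h along \<open>H\<close> as h' + k with k vertical;
  h' is horizontal too, so uniqueness of the horizontal part gives h' = h.\<close>

lemma connection_of_eq: "connection_of M D = horizontal"
  unfolding connection_of_def
proof (rule the_equality)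
  show "principal_connection M horizontal \<and> corresponds M horizontal D"
    using principal_connection_horizontal corresponds_horizontal by blast
  fix H assume H: "principal_connection M H \<and> corresponds M H D"
  have Hb: "H \<subseteq> tangent_bundle (frame_atlas M)" using H unfolding principal_connection_def by blast
  have fr: "fst h \<in> frames M" if "h \<in> H" for h
    using tangent_bundleD[OF subsetD[OF Hb that]] by (simp add: mcarrier_frame_atlas)
  have sub: "H \<subseteq> horizontal"
  proof
    fix h assume h: "h \<in> H"
    show "h \<in> horizontal"
      unfolding horizontal_def
      using H h fr[OF h] subsetD[OF Hb h] unfolding corresponds_def by blast
  qed
  moreover have "horizontal \<subseteq> H"
  proof
    fix h assume h: "h \<in> horizontal"
    note u = horizontalD(2)[OF h] and tan = horizontalD(1)[OF h]
    note u0 = framesD(1)[OF u] and c0 = chart_at_in[OF framesD(2)[OF u]]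
    let ?c = "chart_at M (frame_proj (fst h))"
    obtain h' k where h': "h' \<in> H" "fst h' = fst h" "k \<in> vertical_space M (fst h)" "h = tadd h' k"
    proof -
      have "\<forall>u\<in>frames M. tsubspace {h \<in> H. fst h = u} \<and> (\<forall>w\<in>tangent_space (frame_atlas M) u.
          \<exists>!h. h \<in> H \<and> fst h = u \<and> (\<exists>k\<in>vertical_space M u. w = tadd h k))"
        using H unfolding principal_connection_def by (elim conjE)
      from ex1_implies_ex[OF bspec[OF conjunct2[OF bspec[OF this u]] tan]] show ?thesis
        using that by (elim exE conjE bexE)
    qed
    have "h' = hlift ?c (fst h) (fst (snd h (fchart M ?c)))"
      by (rule horizontal_complement(2)[OF u0 c0 tan subsetD[OF sub h'(1)] h'(2-4)])
    then have "h' = h" using horizontal_eq_hlift[OF u0 c0 h refl] by simp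
    then show "h \<in> H" using h'(1) by simp
  qed
  ultimately show "H = horizontal" by blast
qed

section \<open>Evaluation of the spray\<close>

section \<open>The geodesic spray in a chart\<close>

lemma std_horizontal_eq:
  assumes u: "u \<in> frames_at M p" and c: "c \<in> charts_at M p"
  shows "std_horizontal M D \<xi> u = hlift c u (snd (u \<xi>) c)"
  unfolding std_horizontal_def connection_of_eq
proof (rule the_equality, intro conjI)
  show "hlift c u (snd (u \<xi>) c) \<in> horizontal" "fst (hlift c u (snd (u \<xi>) c)) = u"
    by (rule hlift(2)[OF u c], rule hlift(3)[OF u c])
  show "tproj M (hlift c u (snd (u \<xi>) c)) = u \<xi>"
    unfolding tproj_hlift[OF u c] by (rule tvec_of_snd[OF frames_at_tangent[OF u] c])
  fix h assume h: "h \<in> horizontal \<and> fst h = u \<and> tproj M h = u \<xi>"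
  have tan: "h \<in> tangent_space (frame_atlas M) u" using horizontalD(1)[of h] h by simp
  have "tvec_of M c p (fst (snd h (fchart M c))) = u \<xi>"
    using h tproj_chart[OF u c tan] by simp
  then have "snd (tvec_of M c p (fst (snd h (fchart M c)))) c = snd (u \<xi>) c" by simp
  then have "fst (snd h (fchart M c)) = snd (u \<xi>) c" by (simp only: tvec_of_same[OF c])
  then show "h = hlift c u (snd (u \<xi>) c)" using horizontal_eq_hlift[OF u c] h by metis
qed

text \<open>The frame and \<xi> enter only through the product G \<xi>, the coordinates of
  \<open>v\<close>; hence the value is the same for all admissible pairs.\<close>

lemma geodesic_spray_chart:
  assumes v: "v \<in> tangent_space M p" and c: "c \<in> charts_at M p"
  shows "geodesic_spray M D v
    = tvec_of (tangent_atlas M) (tchart M c) v (snd v c, - christoffel c p (snd v c) (snd v c))"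
  unfolding geodesic_spray_def tangent_space_fst[OF v]
proof (rule the_equality)
  let ?z = "tvec_of (tangent_atlas M) (tchart M c) v (snd v c, - christoffel c p (snd v c) (snd v c))"
  have key: "tmap (frame_atlas M) (tangent_atlas M) (\<lambda>u'. u' \<xi>) (std_horizontal M D \<xi> u) = ?z"
    if u: "u \<in> frames_at M p" and \<xi>: "u \<xi> = v" for u \<xi>
    unfolding std_horizontal_eq[OF u c] tmap_frame_eval[OF u c hlift(1)[OF u c]] hlift(4)[OF u c]
    by (simp add: hmat_works[OF c] fmat_works[OF u] \<xi>)
  \<comment> \<open>The coordinate frame of the chart: it supplies an admissible pair, with the
    coordinates of \<open>v\<close> as \<xi>, also for \<open>v\<close> zero.\<close>
  have u: "frame_of M c p (mat 1) \<in> frames_at M p"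
    by (rule frame_of_in[OF c]) (auto simp: invertible_def intro!: exI[of _ "mat 1"])
  have "frame_of M c p (mat 1) (snd v c) = v"
    by (simp add: frame_of_def tvec_of_snd[OF v c])
  then show "\<exists>u\<in>frames_at M p. \<exists>\<xi>. u \<xi> = v \<and>
      ?z = tmap (frame_atlas M) (tangent_atlas M) (\<lambda>u'. u' \<xi>) (std_horizontal M D \<xi> u)"
    by (intro bexI[OF _ u] exI[of _ "snd v c"] conjI) (simp_all add: key[OF u])
  fix z assume "\<exists>u\<in>frames_at M p. \<exists>\<xi>. u \<xi> = v \<and>
      z = tmap (frame_atlas M) (tangent_atlas M) (\<lambda>u'. u' \<xi>) (std_horizontal M D \<xi> u)"
  then obtain u \<xi> where "u \<in> frames_at M p" "u \<xi> = v"
      "z = tmap (frame_atlas M) (tangent_atlas M) (\<lambda>u'. u' \<xi>) (std_horizontal M D \<xi> u)" by blast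
  then show "z = ?z" using key[of u \<xi>] by simp
qed

end

section \<open>Uniqueness of integral curves; coordinates of the two lifts\<close>

section \<open>Flows\<close>

context atlas
begin

lemma continuous_map_curve:
  assumes "open J" and vel: "\<And>t. t \<in> J \<Longrightarrow> \<exists>w. has_velocity A \<gamma> t w"
  shows "continuous_map (top_of_set J) (manifold_topology A) \<gamma>"
  unfolding manifold_topology_def
proof (rule continuous_on_generated_topo)
  fix U assume "U \<in> {fst c \<inter> snd c -` V |c V. c \<in> A \<and> open V}"
  then obtain c V where c: "c \<in> A" "open V" "U = fst c \<inter> snd c -` V" by blast
  have "open (\<gamma> -` U \<inter> J)"
  proof (subst open_subopen, intro ballI)
    fix t assume t: "t \<in> \<gamma> -` U \<inter> J"
    then obtain w where w: "has_velocity A \<gamma> t w" using vel by blast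
    have ct: "c \<in> charts_at A (\<gamma> t)" using t c by (simp add: charts_at_def)
    have 1: "\<forall>\<^sub>F s in nhds t. \<gamma> s \<in> fst c" and 2: "((snd c \<circ> \<gamma>) has_vector_derivative snd w c) (at t)"
      using w ct by (auto simp: has_velocity_def)
    have "((snd c \<circ> \<gamma>) \<longlongrightarrow> (snd c \<circ> \<gamma>) t) (nhds t)"
      by (rule isCont_tendsto_nhds[OF has_vector_derivative_continuous[OF 2]])
    moreover have "(snd c \<circ> \<gamma>) t \<in> V" using t c(3) by simp
    ultimately have 3: "\<forall>\<^sub>F s in nhds t. (snd c \<circ> \<gamma>) s \<in> V" using c(2) by (blast intro: topological_tendstoD)
    have "\<forall>\<^sub>F s in nhds t. s \<in> J" using assms(1) t by (intro eventually_nhds_in_open) auto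
    with 1 3 have "\<forall>\<^sub>F s in nhds t. s \<in> \<gamma> -` U \<inter> J"
      by eventually_elim (simp add: c(3))
    then show "\<exists>T. open T \<and> t \<in> T \<and> T \<subseteq> \<gamma> -` U \<inter> J"
      unfolding eventually_nhds by blast
  qed
  then show "openin (top_of_set J) (\<gamma> -` U \<inter> topspace (top_of_set J))"
    using assms(1) by (simp add: openin_open_eq)
next
  show "\<gamma> ` topspace (top_of_set J) \<subseteq> \<Union> {fst c \<inter> snd c -` V |c V. c \<in> A \<and> open V}"
  proof
    fix p assume "p \<in> \<gamma> ` topspace (top_of_set J)"
    then obtain t where t: "t \<in> J" "p = \<gamma> t" by auto
    then have "p \<in> mcarrier A" using vel unfolding has_velocity_def by blast
    then obtain c where "c \<in> A" "p \<in> fst c \<inter> snd c -` UNIV" by (auto simp: mcarrier_def)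
    then show "p \<in> \<Union> {fst c \<inter> snd c -` V |c V. c \<in> A \<and> open V}" using open_UNIV by blast
  qed
qed

lemma integral_curve_chart:
  assumes \<gamma>: "integral_curve A X J \<gamma>" and t: "t \<in> J" and c: "c \<in> A" "\<gamma> t \<in> fst c"
  shows "\<forall>\<^sub>F s in nhds t. \<gamma> s \<in> fst c \<and>
    ((\<lambda>s. snd c (\<gamma> s)) has_vector_derivative snd (X (chart_inv c (snd c (\<gamma> s)))) c) (at s)"
proof -
  have vel: "has_velocity A \<gamma> s (X (\<gamma> s))" if "s \<in> J" for s
    using \<gamma> that by (simp add: integral_curve_def)
  have "\<forall>\<^sub>F s in nhds t. \<gamma> s \<in> fst c"
    using vel[OF t] charts_atI[where A = A, OF c] unfolding has_velocity_def by blast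
  moreover have "\<forall>\<^sub>F s in nhds t. s \<in> J"
    using \<gamma> t by (intro eventually_nhds_in_open) (simp_all add: integral_curve_def)
  ultimately show ?thesis
  proof eventually_elim
    case (elim s)
    have "((snd c \<circ> \<gamma>) has_vector_derivative snd (X (\<gamma> s)) c) (at s)"
      using vel[OF elim(2)] charts_atI[where A = A, OF c(1) elim(1)] unfolding has_velocity_def by blast
    then show ?case using elim(1) by (simp add: chart_inv_left[OF c(1) elim(1)] comp_def)
  qed
qed

end

context hausdorff_atlas
begin

text \<open>The set of agreement is closed because the manifold is Hausdorff, open by local
  uniqueness in a chart, and contains 0; the common interval is connected.\<close>

lemma integral_curve_unique:
  assumes X: "X \<in> vector_fields A"
    and g1: "integral_curve A X J\<^sub>1 \<gamma>\<^sub>1" and g2: "integral_curve A X J\<^sub>2 \<gamma>\<^sub>2"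
    and start: "\<gamma>\<^sub>1 0 = \<gamma>\<^sub>2 0" and t: "t \<in> J\<^sub>1" "t \<in> J\<^sub>2"
  shows "\<gamma>\<^sub>1 t = \<gamma>\<^sub>2 t"
proof -
  let ?J = "J\<^sub>1 \<inter> J\<^sub>2"
  define E where "E = {s \<in> ?J. \<gamma>\<^sub>1 s = \<gamma>\<^sub>2 s}"
  have J: "open J\<^sub>1" "open J\<^sub>2" "is_interval J\<^sub>1" "is_interval J\<^sub>2" "0 \<in> ?J"
    using g1 g2 by (simp_all add: integral_curve_def)
  have v1: "has_velocity A \<gamma>\<^sub>1 s (X (\<gamma>\<^sub>1 s))" if "s \<in> ?J" for s
    using g1 that by (simp add: integral_curve_def)
  have v2: "has_velocity A \<gamma>\<^sub>2 s (X (\<gamma>\<^sub>2 s))" if "s \<in> ?J" for s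
    using g2 that by (simp add: integral_curve_def)
  have oJ: "open ?J" using J by (intro open_Int)
  have "closedin (top_of_set ?J) {s \<in> topspace (top_of_set ?J). \<gamma>\<^sub>1 s = \<gamma>\<^sub>2 s}"
    by (rule closedin_continuous_maps_eq[OF hausdorff continuous_map_curve[OF oJ] continuous_map_curve[OF oJ]])
      (rule exI, erule v1, rule exI, erule v2)
  then have cl: "closedin (top_of_set ?J) E" by (simp add: E_def)
  have "open E"
  proof (subst open_subopen, intro ballI)
    fix s assume s: "s \<in> E"
    then have sJ: "s \<in> ?J" and eq: "\<gamma>\<^sub>1 s = \<gamma>\<^sub>2 s" by (simp_all add: E_def)
    have "\<gamma>\<^sub>1 s \<in> mcarrier A" using v1[OF sJ] by (simp add: has_velocity_def)
    then obtain c where c: "c \<in> A" "\<gamma>\<^sub>1 s \<in> fst c" by (auto simp: mcarrier_def)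
    have c2: "\<gamma>\<^sub>2 s \<in> fst c" using c(2) eq by simp
    note e1 = integral_curve_chart[OF g1 IntD1[OF sJ] c] and e2 = integral_curve_chart[OF g2 IntD2[OF sJ] c(1) c2]
    have "\<forall>\<^sub>F r in nhds s. snd c (\<gamma>\<^sub>1 r) = snd c (\<gamma>\<^sub>2 r)"
    proof (rule ode_unique_local[OF vector_fieldD_smooth[OF X c(1)] open_chart[OF c(1)]])
      show "snd c (\<gamma>\<^sub>1 s) \<in> snd c ` fst c" by (rule imageI[OF c(2)])
      show "snd c (\<gamma>\<^sub>1 s) = snd c (\<gamma>\<^sub>2 s)" by (simp only: eq)
      show "\<forall>\<^sub>F r in nhds s. ((\<lambda>r. snd c (\<gamma>\<^sub>1 r)) has_vector_derivative
          snd (X (chart_inv c (snd c (\<gamma>\<^sub>1 r)))) c) (at r)"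
        using e1 by (rule eventually_mono) (rule conjunct2)
      show "\<forall>\<^sub>F r in nhds s. ((\<lambda>r. snd c (\<gamma>\<^sub>2 r)) has_vector_derivative
          snd (X (chart_inv c (snd c (\<gamma>\<^sub>2 r)))) c) (at r)"
        using e2 by (rule eventually_mono) (rule conjunct2)
    qed
    moreover have "\<forall>\<^sub>F r in nhds s. r \<in> ?J" by (rule eventually_nhds_in_open[OF oJ sJ])
    ultimately have "\<forall>\<^sub>F r in nhds s. r \<in> E"
      using e1 e2
    proof eventually_elim
      case (elim r)
      have "\<gamma>\<^sub>1 r = chart_inv c (snd c (\<gamma>\<^sub>1 r))" using chart_inv_left[OF c(1)] elim(3) by simp
      also have "\<dots> = \<gamma>\<^sub>2 r" unfolding elim(1) using chart_inv_left[OF c(1)] elim(4) by simp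
      finally show ?case using elim(2) by (simp add: E_def)
    qed
    then show "\<exists>T. open T \<and> s \<in> T \<and> T \<subseteq> E" unfolding eventually_nhds by blast
  qed
  then have "openin (top_of_set ?J) E"
    using oJ by (auto simp: openin_open_eq E_def)
  moreover have "connected ?J"
    by (rule is_interval_connected[OF is_interval_Int[OF J(3,4)]])
  ultimately have "E = {} \<or> E = ?J" using cl unfolding connected_clopen by blast
  moreover have "0 \<in> E" using start J(5) by (simp add: E_def)
  ultimately have "t \<in> E" using t by blast
  then show ?thesis by (simp add: E_def)
qed

text \<open>\<open>flow\<close> refers to all integral curves through \<open>y\<close>, which may
  leave any given chart. Global uniqueness lets a single local curve determine it.\<close>

lemma flow_eq:
  assumes X: "X \<in> vector_fields A" and \<gamma>: "integral_curve A X J \<gamma>" "\<gamma> 0 = y" "t \<in> J"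
  shows "flow A X t y = \<gamma> t"
  unfolding flow_def
proof (rule the_equality)
  show "\<exists>J \<gamma>'. integral_curve A X J \<gamma>' \<and> \<gamma>' 0 = y \<and> t \<in> J \<and> \<gamma>' t = \<gamma> t"
    using \<gamma> by blast
  fix z assume "\<exists>J \<gamma>. integral_curve A X J \<gamma> \<and> \<gamma> 0 = y \<and> t \<in> J \<and> \<gamma> t = z"
  then obtain J' \<gamma>' where \<gamma>': "integral_curve A X J' \<gamma>'" "\<gamma>' 0 = y" "t \<in> J'" "\<gamma>' t = z" by blast
  have "\<gamma>' 0 = \<gamma> 0" using \<gamma>(2) \<gamma>'(2) by simp
  from integral_curve_unique[OF X \<gamma>'(1) \<gamma>(1) this \<gamma>'(3) \<gamma>(3)] show "z = \<gamma> t" using \<gamma>'(4) by simp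
qed

end

context affine_manifold
begin

text \<open>A velocity at 0 depends only on small times, when the flow near \<open>p\<close> is the
  local flow in the chart. The curve of tangent vectors has the coordinates (\<Phi> t a, W t v),
  which are differentiated at 0.\<close>

lemma tangent_lift_chart:
  assumes X: "X \<in> vector_fields M" and v: "v \<in> tangent_space M p" and c: "c \<in> charts_at M p"
  shows "tangent_lift M X v
    = tvec_of (tangent_atlas M) (tchart M c) v (snd (X p) c, vf_deriv c X p (snd v c))"
proof -
  note cM = charts_atD(1)[OF c] and pc = charts_atD(2)[OF c]
  let ?S = "snd c ` fst c" and ?a = "snd c p"
  define F where "F y = snd (X (chart_inv c y)) c" for y
  have F: "smooth_on ?S F" unfolding F_def by (rule vector_fieldD_smooth[OF X cM])
  have aS: "?a \<in> ?S" by (rule imageI[OF pc])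
  have ap: "chart_inv c ?a = p" by (rule chart_inv_left[OF cM pc])
  obtain r T \<Phi> W where r: "r > 0" and T: "T > 0" and rS: "ball ?a r \<subseteq> ?S"
    and \<Phi>: "\<And>y t. y \<in> ball ?a r \<Longrightarrow> \<bar>t\<bar> < T \<Longrightarrow> \<Phi> t y \<in> ?S \<and> ((\<lambda>t. \<Phi> t y) has_vector_derivative F (\<Phi> t y)) (at t)"
    and \<Phi>0: "\<And>y. y \<in> ball ?a r \<Longrightarrow> \<Phi> 0 y = y"
    and W: "\<And>t. \<bar>t\<bar> < T \<Longrightarrow> (\<Phi> t has_derivative W t) (at ?a)"
    and W0: "\<And>h. W 0 h = h"
    and W': "\<And>h. ((\<lambda>t. W t h) has_vector_derivative frechet_derivative F (at ?a) h) (at 0)"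
    by (rule local_flow[OF F open_chart[OF cM] aS]) (rule that; assumption)
  have ab: "?a \<in> ball ?a r" using r by simp
  have evT: "\<forall>\<^sub>F s in nhds t. \<bar>s\<bar> < T" if "\<bar>t\<bar> < T" for t :: real
    using eventually_nhds_in_open[OF open_greaterThanLessThan, of t "- T" T] that
    by (auto simp: abs_less_iff elim: eventually_mono)
  have curve: "integral_curve M X {- T<..<T} (\<lambda>t. chart_inv c (\<Phi> t y))" if y: "y \<in> ball ?a r" for y
    unfolding integral_curve_def
  proof (intro conjI ballI)
    fix t assume "t \<in> {- T<..<T}"
    then have t: "\<bar>t\<bar> < T" by auto
    have S: "\<Phi> t y \<in> ?S" using \<Phi>[OF y t] by blast
    have ct: "c \<in> charts_at M (chart_inv c (\<Phi> t y))" by (rule charts_atI[OF cM chart_inv_right(2)[OF S]])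
    have "has_velocity M (\<lambda>t. chart_inv c (\<Phi> t y)) t (tvec_of M c (chart_inv c (\<Phi> t y)) (F (\<Phi> t y)))"
    proof (rule has_velocityI[where \<gamma> = "\<lambda>t. chart_inv c (\<Phi> t y)" and t = t, OF ct])
      show "\<forall>\<^sub>F s in nhds t. chart_inv c (\<Phi> s y) \<in> fst c"
        using evT[OF t] by eventually_elim (rule chart_inv_right(2)[OF conjunct1[OF \<Phi>[OF y]]])
      have "\<forall>\<^sub>F s in nhds t. \<Phi> s y = snd c (chart_inv c (\<Phi> s y))"
        using evT[OF t]
      proof eventually_elim
        case (elim s)
        show ?case by (rule chart_inv_right(1)[OF conjunct1[OF \<Phi>[OF y elim]], symmetric])
      qed
      then show "((\<lambda>s. snd c (chart_inv c (\<Phi> s y))) has_vector_derivative F (\<Phi> t y)) (at t)"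
        using conjunct2[OF \<Phi>[OF y t]] unfolding has_vector_derivative_def by (rule has_derivative_eventually_eq[rotated])
    qed
    moreover have "tvec_of M c (chart_inv c (\<Phi> t y)) (F (\<Phi> t y)) = X (chart_inv c (\<Phi> t y))"
      unfolding F_def by (rule tvec_of_snd[OF vector_fieldD_tangent[OF X charts_at_mcarrier[OF ct]] ct])
    ultimately show "has_velocity M (\<lambda>t. chart_inv c (\<Phi> t y)) t (X (chart_inv c (\<Phi> t y)))" by simp
  qed (use T in auto)
  \<comment> \<open>This holds for all \<open>y\<close> near the base point and not just there, as
    differentiating the flow in space requires.\<close>
  have fl: "flow M X t (chart_inv c y) = chart_inv c (\<Phi> t y)" if "y \<in> ball ?a r" "\<bar>t\<bar> < T" for t y
    by (rule flow_eq[OF X curve[OF that(1)]]) (use that in \<open>auto simp: \<Phi>0\<close>)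
  define \<beta> where "\<beta> t = tmap M M (flow M X t) v" for t
  have ct: "c \<in> charts_at M (chart_inv c (\<Phi> t ?a))" if "\<bar>t\<bar> < T" for t
    by (rule charts_atI[OF cM chart_inv_right(2)[OF conjunct1[OF \<Phi>[OF ab that]]]])
  have \<beta>: "\<beta> t = tvec_of M c (chart_inv c (\<Phi> t ?a)) (W t (snd v c))" if t: "\<bar>t\<bar> < T" for t
  proof -
    have flp: "flow M X t p = chart_inv c (\<Phi> t ?a)" using fl[OF ab t] by (simp only: ap)
    have evb: "\<forall>\<^sub>F y in nhds ?a. y \<in> ball ?a r" by (rule eventually_nhds_in_open[OF open_ball ab])
    have "\<forall>\<^sub>F y in nhds ?a. \<Phi> t y = snd c (flow M X t (chart_inv c y))"
      using evb
    proof eventually_elim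
      case (elim y)
      show ?case unfolding fl[OF elim t] by (rule chart_inv_right(1)[OF conjunct1[OF \<Phi>[OF elim t]], symmetric])
    qed
    note der = has_derivative_eventually_eq[OF W[OF t] this]
    have "\<forall>\<^sub>F y in nhds ?a. flow M X t (chart_inv c y) \<in> fst c"
      using evb
    proof eventually_elim
      case (elim y)
      show ?case unfolding fl[OF elim t] by (rule chart_inv_right(2)[OF conjunct1[OF \<Phi>[OF elim t]]])
    qed
    from tmap_eq[OF atlas atlas v c _ der this] show ?thesis
      unfolding \<beta>_def flp using ct[OF t] by simp
  qed
  have \<beta>0: "\<beta> 0 = v" using \<beta>[of 0] T by (simp add: \<Phi>0[OF ab] ap W0 tvec_of_snd[OF v c])
  have "has_velocity (tangent_atlas M) \<beta> 0
      (tvec_of (tangent_atlas M) (tchart M c) (\<beta> 0) (F ?a, frechet_derivative F (at ?a) (snd v c)))"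
  proof (rule TA.has_velocityI)
    show "tchart M c \<in> charts_at (tangent_atlas M) (\<beta> 0)" unfolding \<beta>0 by (rule tchart_at[OF v c])
    have ev: "\<forall>\<^sub>F s in nhds 0. \<bar>s\<bar> < T" using evT[of 0] T by simp
    then show "\<forall>\<^sub>F s in nhds 0. \<beta> s \<in> fst (tchart M c)"
    proof eventually_elim
      case (elim s)
      show ?case unfolding \<beta>[OF elim] by (rule charts_atD(2)[OF tchart_at[OF tvec_of_in[OF ct[OF elim]] ct[OF elim]]])
    qed
    have "\<forall>\<^sub>F s in nhds 0. (\<Phi> s ?a, W s (snd v c)) = snd (tchart M c) (\<beta> s)"
      using ev
    proof eventually_elim
      case (elim s)
      show ?case
        unfolding \<beta>[OF elim] tchart_def
        by (simp add: tvec_of_same[OF ct[OF elim]] chart_inv_right(1)[OF conjunct1[OF \<Phi>[OF ab elim]]])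
    qed
    moreover have "((\<lambda>s. (\<Phi> s ?a, W s (snd v c))) has_vector_derivative (F ?a, frechet_derivative F (at ?a) (snd v c))) (at 0)"
      by (rule has_vector_derivative_Pair[OF _ W']) (use \<Phi>[OF ab, of 0] T in \<open>simp add: \<Phi>0[OF ab]\<close>)
    ultimately show "((\<lambda>s. snd (tchart M c) (\<beta> s)) has_vector_derivative
        (F ?a, frechet_derivative F (at ?a) (snd v c))) (at 0)"
      unfolding has_vector_derivative_def by (rule has_derivative_eventually_eq[rotated])
  qed
  from velocity_eq[OF this] show ?thesis
    unfolding tangent_lift_def vf_deriv_def \<beta>0 F_def[abs_def] ap by (simp only: \<beta>_def[abs_def])
qed

text \<open>The curve has a constant base point and is affine in the fibre coordinates.\<close>

lemma vlft_chart:
  assumes v: "v \<in> tangent_space M p" and w: "w \<in> tangent_space M p" and c: "c \<in> charts_at M p"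
  shows "vlft M v w = tvec_of (tangent_atlas M) (tchart M c) v (0, snd w c)"
proof -
  define \<beta> where "\<beta> t = tadd v (tscale t w)" for t
  have \<beta>: "\<beta> t \<in> tangent_space M p" for t
    unfolding \<beta>_def by (rule tangent_space_tadd[OF v tangent_space_tscale[OF w]])
  have \<beta>0: "\<beta> 0 = v" by (simp add: \<beta>_def tadd_def tscale_def)
  have "has_velocity (tangent_atlas M) \<beta> 0 (tvec_of (tangent_atlas M) (tchart M c) (\<beta> 0) (0, snd w c))"
  proof (rule TA.has_velocityI)
    show "tchart M c \<in> charts_at (tangent_atlas M) (\<beta> 0)" by (rule tchart_at[OF \<beta> c])
    show "\<forall>\<^sub>F s in nhds 0. \<beta> s \<in> fst (tchart M c)"
      by (intro always_eventually allI charts_atD(2)[OF tchart_at[OF \<beta> c]])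
    have "(\<lambda>s. snd (tchart M c) (\<beta> s)) = (\<lambda>s. (snd c p, snd v c + s *\<^sub>R snd w c))"
      by (simp add: tchart_def tangent_space_fst[OF \<beta>]) (simp add: \<beta>_def tadd_def tscale_def)
    moreover have "((\<lambda>s. (snd c p, snd v c + s *\<^sub>R snd w c)) has_vector_derivative (0, snd w c)) (at 0)"
      by (rule has_vector_derivative_Pair) (auto intro!: derivative_eq_intros)
    ultimately show "((\<lambda>s. snd (tchart M c) (\<beta> s)) has_vector_derivative (0, snd w c)) (at 0)"
      by (simp only:)
  qed
  from velocity_eq[OF this] show ?thesis
    unfolding vlft_def \<beta>0 by (simp only: \<beta>_def[abs_def])
qed

end

lemma (in atlas) tminus_tvec_of:
  assumes "c \<in> charts_at A p"
  shows "tminus (tvec_of A c p \<xi>) (tvec_of A c p \<eta>) = tvec_of A c p (\<xi> - \<eta>)"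
  using linear_diff[OF dtrans_linear[OF assms]] by (auto simp: tminus_def tvec_of_def)

theorem proposition3p4:
  fixes M :: "('a, real^'n::finite) atlas"
    and D :: "('a \<Rightarrow> ('a, real^'n) tvec) \<Rightarrow> ('a \<Rightarrow> ('a, real^'n) tvec) \<Rightarrow> 'a \<Rightarrow> ('a, real^'n) tvec"
    and x :: 'a and v :: "('a, real^'n) tvec" and X :: "'a \<Rightarrow> ('a, real^'n) tvec"
  assumes "smooth_manifold M"
    and "affine_connection M D"
    and "x \<in> mcarrier M"
    and "v \<in> tangent_space M x"
    and "X \<in> vector_fields M"
    and "X x = v"
  shows "geodesic_spray M D v = tminus (tangent_lift M X v) (vlft M v (D X X x))"
proof -
  interpret affine_manifold M D
    using assms(1,2) by unfold_locales (simp_all add: smooth_manifold_def)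
  obtain c where c: "c \<in> charts_at M x" using chart_at_in[OF assms(3)] by blast
  note DX = vector_fieldD_tangent[OF connection_in[OF assms(5,5)] assms(3)]
  have "snd (D X X x) c = vf_deriv c X x (snd v c) + christoffel c x (snd v c) (snd v c)"
    using connection_chart[OF charts_atD[OF c] assms(5,5)] by (simp only: assms(6))
  \<comment> \<open>The derivative of \<open>X\<close> along \<open>v\<close> occurs in the tangent
    lift and in the vertical lift and cancels; this is why the extension \<open>X\<close> of
    \<open>v\<close> is arbitrary.\<close>
  then show ?thesis
    unfolding geodesic_spray_chart[OF assms(4) c] tangent_lift_chart[OF assms(5,4) c] assms(6)
      vlft_chart[OF assms(4) DX c] TA.tminus_tvec_of[OF tchart_at[OF assms(4) c]]
    by simp
qed

end
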